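(* Let $\mathbb{B}$ be the unit ball of $\mathbb{C}^n$, $k\in\mathbb{N}$ and $2<p<\infty$. Let $S$ be a sequence of points in $\mathbb{B}$. Suppose that $S$ is $A_k^p$ interpolating and has the linear extension property with range $E_S^p:=\mathrm{Span}\{k_{a,p},\ a\in S\}$; that is, there is a bounded linear operator $E:\ell^p(S)\to A_k^p(\mathbb{B})$ with $\langle E(\lambda),k_{a,p'}\rangle=\lambda_a$ for all $\lambda\in\ell^p(S)$, $a\in S$, and whose range is $E_S^p$. Then $S$ is strictly $A_k^p$ interpolating.
   Context: $\mathbb{N}$ includes $0$; $p'$ is the conjugate exponent of $p$. A sequence $S$ of points is indexed by its (distinct) points. The weighted Bergman space $A_k^p(\mathbb{B})$ consists of the holomorphic $f$ on $\mathbb{B}$ with $\|f\|_{k,p}^p:=\int_{\mathbb{B}}|f(z)|^p(1-|z|^2)^k\,dm(z)<\infty$, $m$ being Lebesgue measure, with $(1-|z|^2)^k\,dm$ normalized to total mass one. $\langle\cdot,\cdot\rangle$ is the scalar product of $A_k^2(\mathbb{B})$. The reproducing kernel of $a\in\mathbb{B}$ is $k_a(z)=(1-\sum_j\bar a_jz_j)^{-(n+k+1)}$, so $f(a)=\langle f,k_a\rangle$, and the normalized kernel is $k_{a,p}=k_a/\|k_a\|_{k,p}$, where $\|k_a\|_{k,p}\simeq(1-|a|^2)^{-(n+k+1)/p'}$. Span means closed linear span in $A_k^p(\mathbb{B})$. $S$ is $A_k^p$ interpolating if $\{k_{a,p'}\}_{a\in S}$ is $p'$-besselian: there is $c>0$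 with $\|\sum_{a\in S}\lambda_ak_{a,p'}\|\ge c\|\lambda\|_{\ell^{p'}(S)}$ in $A_k^{p'}(\mathbb{B})=(A_k^p(\mathbb{B}))'$ for all finitely supported $\lambda\in\ell^{p'}(S)$; equivalently, for every $\lambda\in\ell^p(S)$ there is $f\in A_k^p(\mathbb{B})$ with $\langle f,k_{a,p'}\rangle=\lambda_a$ for all $a\in S$. The Grammian of $S$ is the matrix $G_{a,b}:=\langle k_{a,p'},k_{b,p}\rangle$, acting on $\mu\in\ell^{p'}(S)$ by $(G\mu)_b:=\sum_{a\in S}\mu_aG_{a,b}$, $b\in S$. $S$ is strictly $A_k^p$ interpolating if $G$ is bounded below on $\ell^{p'}(S)$: there is $c>0$ with $\|G\mu\|_{\ell^{p'}(S)}\ge c\|\mu\|_{\ell^{p'}(S)}$ for all $\mu\in\ell^{p'}(S)$. *)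

theory Defs
  imports "HOL-Analysis.Analysis"
begin

text \<open>
  The ball of \<open>\<complex>\<^sup>n\<close> is \<open>ball 0 1\<close> in \<open>complex ^ 'n\<close>, with \<open>n = CARD('n)\<close>.  A function on the
  ball is represented by its extension by zero to \<open>complex ^ 'n\<close>, and a scalar family indexed
  by \<open>S\<close> by its extension by zero off \<open>S\<close>; thus equality of functions (of families) is equality
  in HOL, and the vector operations are the pointwise ones.
\<close>

definition conj_exp :: "real \<Rightarrow> real" where
  "conj_exp p = p / (p - 1)"


section \<open>Weighted Bergman spaces\<close>

text \<open>Holomorphy in several variables: the Frechet derivative exists and is complex-linear.\<close>

definition holomorphic_several_on :: "(complex ^ 'n \<Rightarrow> complex) \<Rightarrow> (complex ^ 'n) set \<Rightarrow> bool" where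
  "holomorphic_several_on f U \<longleftrightarrow>
     (\<forall>z\<in>U. \<exists>L. (f has_derivative L) (at z within U) \<and> (\<forall>c v. L (c *s v) = c * L v))"

definition bergman_measure :: "nat \<Rightarrow> (complex ^ 'n) measure" where
  "bergman_measure k =
     density lborel (\<lambda>z. ennreal (indicator (ball 0 1) z * (1 - (norm z)\<^sup>2) ^ k
                                   / (LINT w:ball 0 1|lborel. (1 - (norm (w :: complex ^ 'n))\<^sup>2) ^ k)))"

definition bergman_space :: "nat \<Rightarrow> real \<Rightarrow> (complex ^ 'n \<Rightarrow> complex) set" where
  "bergman_space k p =
     {f. holomorphic_several_on f (ball 0 1) \<and> (\<forall>z. z \<notin> ball 0 1 \<longrightarrow> f z = 0) \<and>
         integrable (bergman_measure k) (\<lambda>z. norm (f z) powr p)}"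

definition bergman_norm :: "nat \<Rightarrow> real \<Rightarrow> (complex ^ 'n \<Rightarrow> complex) \<Rightarrow> real" where
  "bergman_norm k p f = (LINT z|bergman_measure k. norm (f z) powr p) powr (1 / p)"

text \<open>
  The scalar product of the Bergman space with exponent 2; the same integral is the pairing
  between the spaces with conjugate exponents.
\<close>

definition bergman_pairing ::
    "nat \<Rightarrow> (complex ^ 'n \<Rightarrow> complex) \<Rightarrow> (complex ^ 'n \<Rightarrow> complex) \<Rightarrow> complex" where
  "bergman_pairing k f g = (LINT z|bergman_measure k. f z * cnj (g z))"

definition bergman_kernel :: "nat \<Rightarrow> complex ^ 'n \<Rightarrow> complex ^ 'n \<Rightarrow> complex" where
  "bergman_kernel k a z =
     (if z \<in> ball 0 1
      then inverse ((1 - (\<Sum>j\<in>UNIV. cnj (a $ j) * z $ j)) ^ (CARD('n) + k + 1))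
      else 0)"

definition normalized_kernel :: "nat \<Rightarrow> real \<Rightarrow> complex ^ 'n \<Rightarrow> complex ^ 'n \<Rightarrow> complex" where
  "normalized_kernel k p a z = bergman_kernel k a z / of_real (bergman_norm k p (bergman_kernel k a))"

text \<open>The closed linear span, in the Bergman space, of the normalized kernels at the points of \<open>S\<close>.\<close>

definition kernel_span :: "nat \<Rightarrow> real \<Rightarrow> (complex ^ 'n) set \<Rightarrow> (complex ^ 'n \<Rightarrow> complex) set" where
  "kernel_span k p S =
     {f \<in> bergman_space k p.
        \<forall>e>0. \<exists>F c. finite F \<and> F \<subseteq> S \<and>
          bergman_norm k p (\<lambda>z. f z - (\<Sum>a\<in>F. c a * normalized_kernel k p a z)) < e}"


section \<open>Sequence spaces\<close>

definition lp_space :: "real \<Rightarrow> 'a set \<Rightarrow> ('a \<Rightarrow> complex) set" where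
  "lp_space q S = {x. (\<forall>a. a \<notin> S \<longrightarrow> x a = 0) \<and> (\<lambda>a. norm (x a) powr q) summable_on S}"

definition lp_norm :: "real \<Rightarrow> 'a set \<Rightarrow> ('a \<Rightarrow> complex) \<Rightarrow> real" where
  "lp_norm q S x = (\<Sum>\<^sub>\<infinity>a\<in>S. norm (x a) powr q) powr (1 / q)"


section \<open>Interpolating sequences\<close>

definition interpolating :: "nat \<Rightarrow> real \<Rightarrow> (complex ^ 'n) set \<Rightarrow> bool" where
  "interpolating k p S \<longleftrightarrow>
     (\<exists>c>0. \<forall>x \<in> lp_space (conj_exp p) S. finite {a. x a \<noteq> 0} \<longrightarrow>
        bergman_norm k (conj_exp p)
            (\<lambda>z. \<Sum>a | x a \<noteq> 0. x a * normalized_kernel k (conj_exp p) a z)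
          \<ge> c * lp_norm (conj_exp p) S x)"

definition bounded_linear_lp_bergman ::
    "nat \<Rightarrow> real \<Rightarrow> (complex ^ 'n) set \<Rightarrow>
     ((complex ^ 'n \<Rightarrow> complex) \<Rightarrow> (complex ^ 'n \<Rightarrow> complex)) \<Rightarrow> bool" where
  "bounded_linear_lp_bergman k p S E \<longleftrightarrow>
     E ` lp_space p S \<subseteq> bergman_space k p \<and>
     (\<forall>x \<in> lp_space p S. \<forall>y \<in> lp_space p S. E (\<lambda>a. x a + y a) = (\<lambda>z. E x z + E y z)) \<and>
     (\<forall>x \<in> lp_space p S. \<forall>c. E (\<lambda>a. c * x a) = (\<lambda>z. c * E x z)) \<and>
     (\<exists>C. \<forall>x \<in> lp_space p S. bergman_norm k p (E x) \<le> C * lp_norm p S x)"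

definition linear_extension_with_range ::
    "nat \<Rightarrow> real \<Rightarrow> (complex ^ 'n) set \<Rightarrow> (complex ^ 'n \<Rightarrow> complex) set \<Rightarrow> bool" where
  "linear_extension_with_range k p S R \<longleftrightarrow>
     (\<exists>E. bounded_linear_lp_bergman k p S E \<and>
          (\<forall>x \<in> lp_space p S. \<forall>a\<in>S. bergman_pairing k (E x) (normalized_kernel k (conj_exp p) a) = x a) \<and>
          E ` lp_space p S = R)"

definition grammian :: "nat \<Rightarrow> real \<Rightarrow> complex ^ 'n \<Rightarrow> complex ^ 'n \<Rightarrow> complex" where
  "grammian k p a b = bergman_pairing k (normalized_kernel k (conj_exp p) a) (normalized_kernel k p b)"

definition grammian_apply ::
    "nat \<Rightarrow> real \<Rightarrow> (complex ^ 'n) set \<Rightarrow> (complex ^ 'n \<Rightarrow> complex) \<Rightarrow> complex ^ 'n \<Rightarrow> complex" where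
  "grammian_apply k p S x b = (if b \<in> S then (\<Sum>\<^sub>\<infinity>a\<in>S. x a * grammian k p a b) else 0)"

text \<open>
  That the Grammian acts on the sequence space (the series defining its values converge and the
  resulting family lies in the space) is stated explicitly, because \<open>infsum\<close> is 0 on
  families that are not summable.
\<close>

definition strictly_interpolating :: "nat \<Rightarrow> real \<Rightarrow> (complex ^ 'n) set \<Rightarrow> bool" where
  "strictly_interpolating k p S \<longleftrightarrow>
     (\<forall>x \<in> lp_space (conj_exp p) S.
        (\<forall>b\<in>S. (\<lambda>a. x a * grammian k p a b) summable_on S) \<and>
        grammian_apply k p S x \<in> lp_space (conj_exp p) S) \<and>
     (\<exists>c>0. \<forall>x \<in> lp_space (conj_exp p) S.
        lp_norm (conj_exp p) S (grammian_apply k p S x) \<ge> c * lp_norm (conj_exp p) S x)"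

end

theory Submission
  imports Defs "HOL-Complex_Analysis.Complex_Analysis" "HOL-Probability.Probability_Measure"
begin

text \<open>
  The extension operator provides functions that vanish on \<open>S\<close> except at one point and have
  norms bounded uniformly, so by the Schwarz lemma the points of \<open>S\<close> lie in disjoint nonisotropic boxes
  \<open>a + kbox \<delta> a\<close>.  With the Forelli-Rudin integral estimates, Schur's test then bounds the
  synthesis map \<open>\<lambda> \<mapsto> \<Sum> \<lambda>\<^sub>a k\<^bsub>a,r\<^esub>\<close> from \<open>\<ell>\<^sup>r\<close> to
  the Bergman space, for every \<open>1 < r < \<infinity>\<close>.  In particular the Grammian is bounded, and by duality
  so is the restriction map.

  For \<open>p > 2\<close> put \<open>1/q = 1 - 2/p = 1/p' - 1/p\<close>.  Products of an extension with exponent \<open>p\<close> and a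
  sum of kernels with exponent \<open>q\<close> solve the interpolation problem for the exponent \<open>p'\<close>, up to
  off-diagonal terms that disappear when one averages over unimodular multipliers.  Hence the family
  \<open>k\<^bsub>a,p\<^esub>\<close> is \<open>p\<close>-besselian.  A sequence in \<open>\<ell>\<^sup>p\<close> is therefore,
  via its extension in the span of these kernels, close to the restriction of a sum of kernels with controlled
  coefficients; testing an element of \<open>\<ell>\<^bsup>p'\<^esup>\<close> against it yields the lower bound for the Grammian.
\<close>

section \<open>Isometries of Lebesgue measure and averages over circles\<close>

text \<open>The Grammian sees only finite sums of the kernels k_{b,p}: testing \<open>G x\<close>
  against y amounts to testing x against the restriction of the sum of the y_b k_{b,p}. An
  interpolating function outside their closed span is out of reach of this argument, which is why
  the range of the extension matters. Approximating sums help only if their coefficients stay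
  bounded, which is why the besselian property of the k_{b,p} is needed; it is there that p > 2
  enters, since q has to be a finite exponent above 1. On the analytic side everything is reduced to
  one complex variable. Functions on the ball are examined only along complex lines, and after
  averaging over rotations the integrals behind the kernel estimates depend on z only through its
  Hermitian product with a fixed a. So the moments of \<open>norm (cip z a)\<close> over the ball
  suffice; they come from Gaussian moments, which a generating function determines.\<close>

lemma nn_integral_lborel_shift:
  fixes f :: "'a::euclidean_space \<Rightarrow> ennreal"
  assumes [measurable]: "f \<in> borel_measurable borel"
  shows "(\<integral>\<^sup>+x. f (c + x) \<partial>lborel) = (\<integral>\<^sup>+x. f x \<partial>lborel)"
proof -
  have "(\<integral>\<^sup>+x. f x \<partial>lborel) = (\<integral>\<^sup>+x. f x \<partial>distr lborel borel ((+) c))"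
    by (simp only: lborel_distr_plus)
  also have "\<dots> = (\<integral>\<^sup>+x. f (c + x) \<partial>lborel)"
    by (rule nn_integral_distr) auto
  finally show ?thesis by simp
qed

lemma nn_integral_lborel_reflect:
  fixes f :: "'a::euclidean_space \<Rightarrow> ennreal"
  assumes [measurable]: "f \<in> borel_measurable borel"
  shows "(\<integral>\<^sup>+x. f (c - x) \<partial>lborel) = (\<integral>\<^sup>+x. f x \<partial>lborel)"
proof -
  have "lborel = density (distr lborel borel (\<lambda>x::'a. c + (-1) *\<^sub>R x)) (\<lambda>_. \<bar>-1::real\<bar>^DIM('a))"
    by (rule lborel_affine) auto
  hence "lborel = distr lborel borel (\<lambda>x::'a. c - x)"
    by (simp add: density_1)
  hence "(\<integral>\<^sup>+x. f x \<partial>lborel) = (\<integral>\<^sup>+x. f x \<partial>distr lborel borel (\<lambda>x. c - x))"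
    by simp
  also have "\<dots> = (\<integral>\<^sup>+x. f (c - x) \<partial>lborel)"
    by (rule nn_integral_distr) auto
  finally show ?thesis by simp
qed

text \<open>Uniqueness of the translation-invariant measure, carried out by hand: multiply the
  integral of \<open>f (T y)\<close> by the volume of the unit ball, translate in both variables and
  exchange the order of integration. Since T preserves the unit ball, \<open>x - T y\<close> lies in
  it exactly when \<open>inv T x - y\<close> does, and the volume cancels at the end. No determinant
  is computed.\<close>

lemma lborel_distr_linear_isometry:
  fixes T :: "'a::euclidean_space \<Rightarrow> 'a"
  assumes lin: "linear T" and iso: "\<And>x. norm (T x) = norm x"
  shows "distr lborel borel T = lborel"
proof -
  have Tm[measurable]: "T \<in> borel_measurable borel"
    using lin by (intro borel_measurable_continuous_onI linear_continuous_on) (simp add: linear_conv_bounded_linear)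
  have inj: "inj T"
    unfolding linear_injective_0[OF lin] using iso by (metis norm_eq_zero)
  have "surj T" by (rule linear_inj_imp_surj[OF lin inj])
  then have TS: "\<And>y. T (inv T y) = y" by (simp add: surj_f_inv_f)
  have key: "emeasure lborel (ball (0::'a) 1) * (\<integral>\<^sup>+y. f (T y) \<partial>lborel)
     = emeasure lborel (ball (0::'a) 1) * (\<integral>\<^sup>+y. f y \<partial>lborel)"
    if f[measurable]: "f \<in> borel_measurable borel" for f :: "'a \<Rightarrow> ennreal"
  proof -
    let ?g = "indicator (ball (0::'a) 1) :: 'a \<Rightarrow> ennreal"
    have gm[measurable]: "?g \<in> borel_measurable borel"
      by (intro borel_measurable_indicator borel_open open_ball)
    have "emeasure lborel (ball (0::'a) 1) * (\<integral>\<^sup>+y. f (T y) \<partial>lborel)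
      = (\<integral>\<^sup>+x. ?g x * (\<integral>\<^sup>+y. f (T y) \<partial>lborel) \<partial>lborel)"
      by (subst nn_integral_multc) (auto simp: gm)
    also have "\<dots> = (\<integral>\<^sup>+x. (\<integral>\<^sup>+y. ?g x * f (x + T y) \<partial>lborel) \<partial>lborel)"
    proof (rule nn_integral_cong)
      fix x :: 'a
      have "(\<integral>\<^sup>+y. f (T y) \<partial>lborel) = (\<integral>\<^sup>+y. f (T (inv T x + y)) \<partial>lborel)"
        by (rule nn_integral_lborel_shift[symmetric]) simp
      also have "\<dots> = (\<integral>\<^sup>+y. f (x + T y) \<partial>lborel)"
        by (simp add: linear_add[OF lin] TS)
      finally show "?g x * (\<integral>\<^sup>+y. f (T y) \<partial>lborel) = (\<integral>\<^sup>+y. ?g x * f (x + T y) \<partial>lborel)"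
        by (simp add: nn_integral_cmult)
    qed
    also have "\<dots> = (\<integral>\<^sup>+y. (\<integral>\<^sup>+x. ?g x * f (x + T y) \<partial>lborel) \<partial>lborel)"
      by (rule lborel_pair.Fubini') simp
    also have "\<dots> = (\<integral>\<^sup>+y. (\<integral>\<^sup>+x. ?g (x - T y) * f x \<partial>lborel) \<partial>lborel)"
    proof (rule nn_integral_cong)
      fix y :: 'a
      show "(\<integral>\<^sup>+x. ?g x * f (x + T y) \<partial>lborel) = (\<integral>\<^sup>+x. ?g (x - T y) * f x \<partial>lborel)"
        using nn_integral_lborel_shift[of "\<lambda>x. ?g (x - T y) * f x" "T y"]
        by (simp add: add.commute)
    qed
    also have "\<dots> = (\<integral>\<^sup>+x. (\<integral>\<^sup>+y. ?g (x - T y) * f x \<partial>lborel) \<partial>lborel)"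
      by (rule lborel_pair.Fubini') simp
    also have "\<dots> = (\<integral>\<^sup>+x. emeasure lborel (ball (0::'a) 1) * f x \<partial>lborel)"
    proof (rule nn_integral_cong)
      fix x :: 'a
      have "?g (x - T y) = ?g (inv T x - y)" for y
      proof -
        have "x - T y = T (inv T x - y)" by (simp add: linear_diff[OF lin] TS)
        then show ?thesis by (simp add: indicator_def iso)
      qed
      then have "(\<integral>\<^sup>+y. ?g (x - T y) \<partial>lborel) = (\<integral>\<^sup>+y. ?g (inv T x - y) \<partial>lborel)" by simp
      also have "\<dots> = emeasure lborel (ball (0::'a) 1)"
        by (subst nn_integral_lborel_reflect) auto
      finally show "(\<integral>\<^sup>+y. ?g (x - T y) * f x \<partial>lborel) = emeasure lborel (ball (0::'a) 1) * f x"
        by (simp add: nn_integral_multc)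
    qed
    also have "\<dots> = emeasure lborel (ball (0::'a) 1) * (\<integral>\<^sup>+y. f y \<partial>lborel)"
      by (simp add: nn_integral_cmult)
    finally show ?thesis .
  qed
  have fin: "emeasure lborel (ball (0::'a) 1) \<noteq> \<infinity>"
    using emeasure_bounded_finite[of "ball (0::'a) 1"] by auto
  have "emeasure lborel (ball (0::'a) 1) \<noteq> 0"
    using less_imp_neq[OF unit_ball_vol_pos[of "real DIM('a)"], symmetric] by (simp add: emeasure_ball)
  show ?thesis
  proof (rule measure_eqI)
    fix A assume "A \<in> sets (distr lborel borel T)"
    then have [measurable]: "A \<in> sets borel" by simp
    have "emeasure (distr lborel borel T) A = (\<integral>\<^sup>+y. indicator A (T y) \<partial>lborel)"
      by (simp add: nn_integral_distr flip: nn_integral_indicator)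
    also have "\<dots> = (\<integral>\<^sup>+y. indicator A y \<partial>lborel)"
      using key[OF borel_measurable_indicator[OF \<open>A \<in> sets borel\<close>]] \<open>emeasure lborel (ball (0::'a) 1) \<noteq> 0\<close> fin
      by (auto simp: ennreal_mult_cancel_left)
    finally show "emeasure (distr lborel borel T) A = emeasure lborel A" by simp
  qed simp
qed

section \<open>Circle averages and Fourier coefficients\<close>

definition circle_measure :: "real measure" where
  "circle_measure = uniform_measure lborel {0..2*pi}"

lemma circle_measure_prob: "prob_space circle_measure"
  unfolding circle_measure_def by (rule prob_space_uniform_measure) auto

lemma sets_circle_measure [measurable_cong, simp]: "sets circle_measure = sets borel"
  by (simp add: circle_measure_def)

lemma space_circle_measure [simp]: "space circle_measure = UNIV"
  by (simp add: circle_measure_def)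

text \<open>Fubini, with g replaced by its average over the orbits. Joint integrability holds
  because each \<open>T t\<close> preserves the integral of the norm of g and the circle has total
  mass 1; integrability of the average h is therefore a conclusion and need not be checked by the
  user.\<close>

lemma integral_circle_average:
  fixes g h :: "'a \<Rightarrow> 'b::{banach, second_countable_topology}"
  assumes "sigma_finite_measure M"
    and T[measurable]: "(\<lambda>(t, x). T t x) \<in> circle_measure \<Otimes>\<^sub>M M \<rightarrow>\<^sub>M M"
    and inv: "\<And>t. distr M M (T t) = M"
    and g: "integrable M g"
    and avg: "\<And>x. x \<in> space M \<Longrightarrow> (LINT t|circle_measure. g (T t x)) = h x"
  shows "integrable M h" "(LINT x|M. g x) = (LINT x|M. h x)"
proof -
  interpret C: prob_space circle_measure by (rule circle_measure_prob)
  interpret M: sigma_finite_measure M by fact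
  interpret P: pair_sigma_finite circle_measure M ..
  have gm[measurable]: "g \<in> borel_measurable M" using g by auto
  have Tm[measurable]: "T t \<in> M \<rightarrow>\<^sub>M M" for t
    using measurable_compose[OF measurable_Pair1' T, of t] by simp
  have int: "integrable (circle_measure \<Otimes>\<^sub>M M) (\<lambda>(t, x). g (T t x))"
  proof (rule integrableI_bounded)
    show "(\<lambda>(t, x). g (T t x)) \<in> borel_measurable (circle_measure \<Otimes>\<^sub>M M)"
      using measurable_compose[OF T gm] by (simp add: case_prod_unfold)
    have m: "(\<lambda>z. ennreal (norm (case z of (t, x) \<Rightarrow> g (T t x)))) \<in> borel_measurable (circle_measure \<Otimes>\<^sub>M M)"
      using measurable_compose[OF T gm] by (simp add: case_prod_unfold)
    have "(\<integral>\<^sup>+z. ennreal (norm (case z of (t, x) \<Rightarrow> g (T t x))) \<partial>(circle_measure \<Otimes>\<^sub>M M))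
      = (\<integral>\<^sup>+t. (\<integral>\<^sup>+x. ennreal (norm (g (T t x))) \<partial>M) \<partial>circle_measure)"
      by (subst M.nn_integral_fst[OF m, symmetric]) simp
    also have "\<dots> = (\<integral>\<^sup>+t. (\<integral>\<^sup>+x. ennreal (norm (g x)) \<partial>M) \<partial>circle_measure)"
    proof (rule nn_integral_cong)
      fix t
      have "(\<integral>\<^sup>+x. ennreal (norm (g x)) \<partial>M) = (\<integral>\<^sup>+x. ennreal (norm (g x)) \<partial>distr M M (T t))"
        by (simp add: inv)
      also have "\<dots> = (\<integral>\<^sup>+x. ennreal (norm (g (T t x))) \<partial>M)"
        by (rule nn_integral_distr) auto
      finally show "(\<integral>\<^sup>+x. ennreal (norm (g (T t x))) \<partial>M) = (\<integral>\<^sup>+x. ennreal (norm (g x)) \<partial>M)" by simp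
    qed
    also have "\<dots> < \<infinity>"
      using g by (simp add: C.emeasure_space_1[simplified] integrable_iff_bounded)
    finally show "(\<integral>\<^sup>+z. ennreal (norm (case z of (t, x) \<Rightarrow> g (T t x))) \<partial>(circle_measure \<Otimes>\<^sub>M M)) < \<infinity>" .
  qed
  have "integrable M (\<lambda>x. LINT t|circle_measure. g (T t x))"
    using P.integrable_snd[OF int] .
  then show "integrable M h" by (subst (asm) Bochner_Integration.integrable_cong[OF refl avg])
  have "(LINT x|M. h x) = (LINT x|M. (LINT t|circle_measure. g (T t x)))"
    by (rule Bochner_Integration.integral_cong) (auto simp: avg)
  also have "\<dots> = (LINT t|circle_measure. (LINT x|M. g (T t x)))"
    using P.integral_snd[OF int] P.integral_fst[OF int] by simp
  also have "\<dots> = (LINT t|circle_measure. (LINT x|M. g x))"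
  proof (rule Bochner_Integration.integral_cong)
    fix t
    have "(LINT x|M. g x) = (LINT x|distr M M (T t). g x)" by (simp add: inv)
    also have "\<dots> = (LINT x|M. g (T t x))" by (rule integral_distr) auto
    finally show "(LINT x|M. g (T t x)) = (LINT x|M. g x)" by simp
  qed simp
  also have "\<dots> = (LINT x|M. g x)" by (simp add: C.prob_space[simplified])
  finally show "(LINT x|M. g x) = (LINT x|M. h x)" by simp
qed

lemma integral_circle_measure:
  fixes f :: "real \<Rightarrow> complex"
  assumes [measurable]: "f \<in> borel_measurable borel"
  shows "(LINT t|circle_measure. f t) = (LINT t:{0..2*pi}|lborel. f t) / of_real (2*pi)"
proof -
  have circ: "circle_measure = density lborel (\<lambda>x. ennreal (indicator {0..2*pi} x / (2*pi)))"
    unfolding circle_measure_def uniform_measure_def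
    by (intro density_cong) (auto simp: indicator_def divide_ennreal ennreal_1[symmetric] simp del: ennreal_1)
  have "(LINT t|circle_measure. f t) = (LINT t|lborel. (indicator {0..2*pi} t / (2*pi)) *\<^sub>R f t)"
    by (subst circ, subst integral_density) auto
  also have "\<dots> = (LINT t|lborel. (indicator {0..2*pi} t *\<^sub>R f t) / of_real (2*pi))"
    by (intro Bochner_Integration.integral_cong) (auto simp: scaleR_conv_of_real)
  also have "\<dots> = (LINT t:{0..2*pi}|lborel. f t) / of_real (2*pi)"
    unfolding set_lebesgue_integral_def by (rule integral_divide_zero)
  finally show ?thesis .
qed

lemma circle_orthogonality:
  "(LINT t|circle_measure. cis (of_int j * t)) = (if j = 0 then 1 else 0)"
proof (cases "j = 0")
  case True
  interpret C: prob_space circle_measure by (rule circle_measure_prob)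
  show ?thesis using True by (simp add: C.prob_space[simplified])
next
  case False
  let ?F = "\<lambda>t. cis (of_int j * t) / (\<i> * of_int j)"
  have "(LINT t:{0..2*pi}|lborel. cis (of_int j * t)) = ?F (2*pi) - ?F 0"
    unfolding set_lebesgue_integral_def
  proof (rule integral_FTC_Icc)
    fix x :: real
    have "((\<lambda>t. exp (\<i> * (of_int j * of_real t)) / (\<i> * of_int j)) has_vector_derivative
       exp (\<i> * (of_int j * of_real x))) (at x within {0..2*pi})"
      by (auto intro!: derivative_eq_intros has_vector_derivative_real_field simp: False ac_simps)
    then show "(?F has_vector_derivative cis (of_int j * x)) (at x within {0..2*pi})"
      by (simp add: cis_conv_exp)
  qed (auto intro!: continuous_intros)
  also have "cis (of_int j * (2*pi)) = 1"
    using cis_multiple_2pi[of "of_int j"] by (simp add: mult_ac)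
  finally show ?thesis using False
    by (subst integral_circle_measure) (auto intro!: borel_measurable_continuous_onI continuous_intros)
qed

lemma integrable_circle_bounded:
  fixes f :: "real \<Rightarrow> complex"
  assumes [measurable]: "f \<in> borel_measurable borel" and "\<And>t. norm (f t) \<le> K"
  shows "integrable circle_measure f"
proof -
  interpret C: prob_space circle_measure by (rule circle_measure_prob)
  show ?thesis by (rule C.integrable_const_bound[of _ K]) (use assms in auto)
qed

lemma measurable_cis [measurable]: "cis \<in> borel_measurable borel"
  by (intro borel_measurable_continuous_onI continuous_intros)

lemma measurable_cnj [measurable]: "cnj \<in> borel_measurable borel"
  by (intro borel_measurable_continuous_onI continuous_intros)

lemma circle_coefficient:
  fixes c :: "nat \<Rightarrow> complex"
  assumes sum: "summable (\<lambda>m. norm (c m) * norm z ^ m)"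
  shows "(LINT t|circle_measure. (\<Sum>m. c m * (z * cis t) ^ m) * cis (- (real l * t))) = c l * z ^ l"
proof -
  interpret C: prob_space circle_measure by (rule circle_measure_prob)
  let ?f = "\<lambda>m t. c m * (z * cis t) ^ m * cis (- (real l * t))"
  have f: "?f m t = c m * z ^ m * cis (of_int (int m - int l) * t)" for m t
    by (simp add: power_mult_distrib Complex.DeMoivre cis_mult algebra_simps)
  have nf: "norm (?f m t) = norm (c m) * norm z ^ m" for m t
    by (simp add: norm_mult norm_power)
  have ps: "summable (\<lambda>m. c m * (z * cis t) ^ m)" for t
    by (rule summable_norm_cancel) (use sum in \<open>simp add: norm_mult norm_power\<close>)
  have "(\<lambda>m. LINT t|circle_measure. ?f m t) sums (LINT t|circle_measure. (\<Sum>m. ?f m t))"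
  proof (rule sums_integral)
    show "integrable circle_measure (?f m)" for m
      by (rule integrable_circle_bounded[of _ "norm (c m) * norm z ^ m"]) (auto simp: nf)
    show "AE t in circle_measure. summable (\<lambda>m. norm (?f m t))"
      by (simp add: nf sum)
    show "summable (\<lambda>m. LINT t|circle_measure. norm (?f m t))"
      by (simp add: nf sum C.prob_space[simplified])
  qed
  also have "(\<lambda>m. LINT t|circle_measure. ?f m t) = (\<lambda>m. if m = l then c l * z ^ l else 0)"
  proof
    fix m
    show "(LINT t|circle_measure. ?f m t) = (if m = l then c l * z ^ l else 0)"
      unfolding f by (simp only: integral_mult_right_zero circle_orthogonality) auto
  qed
  finally have "(LINT t|circle_measure. (\<Sum>m. ?f m t)) = c l * z ^ l"
    using sums_single[of l "\<lambda>_. c l * z ^ l"] sums_unique2 by fastforce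
  also have "(\<lambda>t. \<Sum>m. ?f m t) = (\<lambda>t. (\<Sum>m. c m * (z * cis t) ^ m) * cis (- (real l * t)))"
    by (intro ext suminf_mult2[symmetric] ps)
  finally show ?thesis .
qed

text \<open>Polarized Parseval identity on the circle through z. Only the second series is
  integrated term by term; the first is kept as a bounded function, and
  \<open>circle_coefficient\<close> extracts its coefficient.\<close>

lemma circle_parseval:
  fixes c d :: "nat \<Rightarrow> complex"
  assumes c: "summable (\<lambda>m. norm (c m) * norm z ^ m)" and d: "summable (\<lambda>m. norm (d m) * norm z ^ m)"
  shows "(\<lambda>m. c m * cnj (d m) * of_real (norm z ^ (2 * m))) sums
    (LINT t|circle_measure. (\<Sum>m. c m * (z * cis t) ^ m) * cnj (\<Sum>m. d m * (z * cis t) ^ m))"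
proof -
  interpret C: prob_space circle_measure by (rule circle_measure_prob)
  let ?F = "\<lambda>t. \<Sum>m. c m * (z * cis t) ^ m"
  let ?K = "\<Sum>m. norm (c m) * norm z ^ m"
  have FK: "norm (?F t) \<le> ?K" for t
  proof -
    have "norm (?F t) \<le> (\<Sum>m. norm (c m * (z * cis t) ^ m))"
      by (rule summable_norm) (use c in \<open>simp add: norm_mult norm_power\<close>)
    then show ?thesis by (simp add: norm_mult norm_power)
  qed
  have K0: "0 \<le> ?K" by (rule suminf_nonneg[OF c]) auto
  have Fm[measurable]: "?F \<in> borel_measurable borel" by measurable
  let ?f = "\<lambda>m t. ?F t * cnj (d m * (z * cis t) ^ m)"
  have nf: "norm (?f m t) \<le> ?K * (norm (d m) * norm z ^ m)" for m t
    using mult_right_mono[OF FK, of "norm (d m) * norm z ^ m" t] by (simp add: norm_mult norm_power)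
  have dm: "norm (d m) * norm z ^ m \<ge> 0" for m by simp
  have "(\<lambda>m. LINT t|circle_measure. ?f m t) sums (LINT t|circle_measure. (\<Sum>m. ?f m t))"
  proof (rule sums_integral)
    show int: "integrable circle_measure (?f m)" for m
      by (rule integrable_circle_bounded[OF _ nf]) measurable
    show "AE t in circle_measure. summable (\<lambda>m. norm (?f m t))"
      by (intro AE_I2 summable_comparison_test'[OF summable_mult[OF d, of ?K]]) (use nf in auto)
    show "summable (\<lambda>m. LINT t|circle_measure. norm (?f m t))"
    proof (rule summable_comparison_test'[OF summable_mult[OF d, of ?K]])
      fix m
      have "(LINT t|circle_measure. norm (?f m t)) \<le> (LINT t|circle_measure. ?K * (norm (d m) * norm z ^ m))"
        by (intro integral_mono integrable_norm int) (use nf in auto)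
      then show "norm (LINT t|circle_measure. norm (?f m t)) \<le> ?K * (norm (d m) * norm z ^ m)"
        by (simp add: C.prob_space[simplified])
    qed
  qed
  also have "(\<lambda>m. LINT t|circle_measure. ?f m t) = (\<lambda>m. c m * cnj (d m) * of_real (norm z ^ (2 * m)))"
  proof
    fix m
    have "?f m = (\<lambda>t. cnj (d m) * cnj z ^ m * (?F t * cis (- (real m * t))))"
      by (auto simp: power_mult_distrib cis_cnj Complex.DeMoivre)
    then have "(LINT t|circle_measure. ?f m t) = cnj (d m) * cnj z ^ m * (c m * z ^ m)"
      by (simp only: integral_mult_right_zero circle_coefficient[OF c])
    also have "\<dots> = c m * cnj (d m) * (z * cnj z) ^ m" by (simp add: power_mult_distrib mult_ac)
    also have "(z * cnj z) ^ m = of_real (norm z ^ (2 * m))"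
      by (simp add: complex_norm_square[symmetric] power_mult)
    finally show "(LINT t|circle_measure. ?f m t) = c m * cnj (d m) * of_real (norm z ^ (2 * m))" .
  qed
  also have "(\<lambda>t. \<Sum>m. ?f m t) = (\<lambda>t. ?F t * cnj (\<Sum>m. d m * (z * cis t) ^ m))"
  proof
    fix t
    have s: "summable (\<lambda>m. d m * (z * cis t) ^ m)"
      by (rule summable_norm_cancel) (use d in \<open>simp add: norm_mult norm_power\<close>)
    then have "(\<lambda>m. cnj (d m * (z * cis t) ^ m)) sums cnj (\<Sum>m. d m * (z * cis t) ^ m)"
      by (subst sums_cnj) (rule summable_sums)
    from sums_mult[OF this, of "?F t"]
    show "(\<Sum>m. ?f m t) = ?F t * cnj (\<Sum>m. d m * (z * cis t) ^ m)"
      by (rule sums_unique[symmetric])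
  qed
  finally show ?thesis .
qed

section \<open>The Hermitian product and radial measures\<close>

text \<open>The standard Hermitian product, linear in the first argument and conjugate-linear in the
  second, so that the kernel of a at z is a power of \<open>1 - cip z a\<close>.\<close>

definition cip :: "complex ^ 'n \<Rightarrow> complex ^ 'n \<Rightarrow> complex" where
  "cip z a = (\<Sum>j\<in>UNIV. cnj (a $ j) * z $ j)"

lemma cip_add_left: "cip (x + y) a = cip x a + cip y a"
  by (simp add: cip_def algebra_simps sum.distrib)

lemma cip_diff_left: "cip (x - y) a = cip x a - cip y a"
  by (simp add: cip_def algebra_simps sum_subtractf)

lemma cip_diff_right: "cip a (x - y) = cip a x - cip a y"
  by (simp add: cip_def algebra_simps sum_subtractf)

lemma cip_smult_left [simp]: "cip (c *s z) a = c * cip z a"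
  by (simp add: cip_def sum_distrib_left mult_ac)

lemma cip_scaleR_left [simp]: "cip (r *\<^sub>R z) a = of_real r * cip z a"
  by (simp add: cip_def sum_distrib_left mult_ac scaleR_conv_of_real[where 'a=complex])

lemma cip_scaleR_right [simp]: "cip z (r *\<^sub>R a) = of_real r * cip z a"
  by (simp add: cip_def sum_distrib_left mult_ac scaleR_conv_of_real[where 'a=complex])

lemma cip_zero [simp]: "cip 0 a = 0" "cip z 0 = 0"
  by (simp_all add: cip_def)

lemma cnj_cip: "cnj (cip z a) = cip a z"
  by (simp add: cip_def mult_ac)

lemma norm_cip_commute: "norm (cip z a) = norm (cip a z)"
  by (metis cnj_cip complex_mod_cnj)

lemma inner_eq_Re_cip: "z \<bullet> a = Re (cip z a)"
  by (simp add: cip_def inner_vec_def inner_complex_def mult_ac)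

lemma cip_self: "cip z z = of_real ((norm z)\<^sup>2)"
  by (rule complex_eqI)
     (simp_all add: inner_eq_Re_cip[symmetric] dot_square_norm, simp add: cip_def mult.commute)

lemma norm_smult [simp]: "norm (c *s z) = norm c * norm (z :: complex ^ 'n)"
  by (simp add: norm_vec_def norm_mult L2_set_right_distrib)

lemma norm_cip_le: "norm (cip z a) \<le> norm z * norm a"
proof -
  \<comment> \<open>A factor of modulus at most 1 makes the product real and nonnegative, so that
    the real Cauchy-Schwarz inequality applies.\<close>
  let ?c = "cnj (sgn (cip z a))"
  have "norm (cip z a) = Re (cip (?c *s z) a)"
    by (simp add: sgn_eq complex_norm_square[symmetric] power2_eq_square mult.commute
        flip: of_real_mult)
  also have "\<dots> = (?c *s z) \<bullet> a" by (simp only: inner_eq_Re_cip)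
  also have "\<dots> \<le> norm (?c *s z) * norm a" by (rule norm_cauchy_schwarz)
  also have "\<dots> \<le> norm z * norm a"
    by (intro mult_right_mono) (auto simp: norm_sgn)
  finally show ?thesis .
qed

lemma norm_add_sq: "(norm (x + y))\<^sup>2 = (norm x)\<^sup>2 + 2 * Re (cip x y) + (norm y)\<^sup>2"
  by (simp add: power2_norm_eq_inner inner_add_left inner_add_right inner_commute
      flip: inner_eq_Re_cip)

lemma norm_diff_sq: "(norm (x - y))\<^sup>2 = (norm x)\<^sup>2 - 2 * Re (cip x y) + (norm y)\<^sup>2"
  by (simp add: power2_norm_eq_inner inner_diff_left inner_diff_right inner_commute
      flip: inner_eq_Re_cip)

lemma continuous_on_cip [continuous_intros]:
  assumes "continuous_on A f" "continuous_on A g"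
  shows "continuous_on A (\<lambda>x. cip (f x) (g x))"
  unfolding cip_def by (intro continuous_intros assms)

lemma borel_measurable_cip [measurable (raw)]:
  fixes f g :: "_ \<Rightarrow> complex ^ 'n"
  assumes "f \<in> borel_measurable M" "g \<in> borel_measurable M"
  shows "(\<lambda>x. cip (f x) (g x)) \<in> borel_measurable M"
proof -
  have "(\<lambda>p. cip (fst p) (snd p)) \<in> borel_measurable (borel :: ((complex^'n) \<times> (complex^'n)) measure)"
    by (intro borel_measurable_continuous_onI continuous_intros)
  from borel_measurable_Pair[OF assms, THEN measurable_compose, OF this]
  show ?thesis by simp
qed

lemma continuous_on_smult [continuous_intros]:
  fixes g :: "_ \<Rightarrow> complex ^ 'n"
  assumes "continuous_on A f" "continuous_on A g"
  shows "continuous_on A (\<lambda>x. f x *s g x)"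
  unfolding vector_scalar_mult_def by (intro continuous_intros assms)

text \<open>The unitary map that fixes a and multiplies the orthogonal complement of a by
  \<open>cis t\<close>. For a = 0 the division by zero makes the projection vanish and leaves the
  scalar rotation \<open>cis t *s z\<close>. Both cases are used: the first averages f over the
  directions that the kernel of a does not see, the second removes the cross terms of power series
  in \<open>cip z a\<close>.\<close>

definition axis_rotation :: "complex ^ 'n \<Rightarrow> real \<Rightarrow> complex ^ 'n \<Rightarrow> complex ^ 'n" where
  "axis_rotation a t z =
     (cip z a / of_real ((norm a)\<^sup>2)) *s a + cis t *s (z - (cip z a / of_real ((norm a)\<^sup>2)) *s a)"

lemma axis_rotation_0 [simp]: "axis_rotation 0 t z = cis t *s z"
  by (simp add: axis_rotation_def)

lemma cip_axis_rotation:
  assumes "a \<noteq> 0"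
  shows "cip (axis_rotation a t z) a = cip z a"
  using assms by (simp add: axis_rotation_def cip_add_left cip_diff_left cip_self)

lemma norm_axis_slice:
  "(norm ((cip z a / of_real ((norm a)\<^sup>2)) *s a + c *s (z - (cip z a / of_real ((norm a)\<^sup>2)) *s a)))\<^sup>2
    = (norm ((cip z a / of_real ((norm a)\<^sup>2)) *s a))\<^sup>2 
      + (norm c)\<^sup>2 * (norm (z - (cip z a / of_real ((norm a)\<^sup>2)) *s a))\<^sup>2"
proof -
  define w where "w = (cip z a / of_real ((norm a)\<^sup>2)) *s a"
  have "cip (z - w) a = 0"
    by (cases "a = 0") (simp_all add: cip_diff_left cip_self w_def)
  then have "cip a (z - w) = 0" by (metis cnj_cip complex_cnj_zero)
  then have "cip (z - w) w = 0" by (metis cip_smult_left cnj_cip complex_cnj_zero mult_zero_right w_def)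
  then have "cip w (c *s (z - w)) = 0"
    by (metis cip_smult_left cnj_cip complex_cnj_zero mult_zero_right)
  then show ?thesis unfolding w_def[symmetric]
    by (simp only: norm_add_sq norm_smult power_mult_distrib zero_complex.sel mult_zero_right add_0_right)
qed

lemma norm_axis_rotation [simp]: "norm (axis_rotation a t z) = norm z"
proof -
  have "(norm (axis_rotation a t z))\<^sup>2 = (norm z)\<^sup>2"
    using norm_axis_slice[of z a "cis t"] norm_axis_slice[of z a 1]
    by (simp add: axis_rotation_def)
  then show ?thesis by simp
qed

lemma linear_axis_rotation: "linear (axis_rotation a t)"
  by (rule linearI)
     (simp_all add: axis_rotation_def cip_add_left vec_eq_iff algebra_simps add_divide_distrib diff_divide_distrib
        scaleR_conv_of_real[where 'a=complex])

lemma measurable_axis_rotation [measurable]: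
  "(\<lambda>(t, z). axis_rotation a t z) \<in> borel \<Otimes>\<^sub>M borel \<rightarrow>\<^sub>M borel"
proof -
  have "continuous_on UNIV (\<lambda>p. axis_rotation a (fst p) (snd p))"
    by (cases "a = 0") (auto simp: axis_rotation_def intro!: continuous_intros)
  then have "(\<lambda>p. axis_rotation a (fst p) (snd p)) \<in> borel_measurable borel"
    by (rule borel_measurable_continuous_onI)
  then show ?thesis by (simp add: borel_prod case_prod_unfold)
qed

text \<open>Covers the Gaussian measure and all weights on the ball at once, so that invariance
  under unitary maps and the averaging argument are proved a single time.\<close>

definition radial_measure :: "(real \<Rightarrow> real) \<Rightarrow> (complex ^ 'n) measure" where
  "radial_measure \<rho> = density lborel (\<lambda>z. ennreal (\<rho> (norm z)))"

lemma sets_radial_measure [measurable_cong, simp]: "sets (radial_measure \<rho>) = sets borel"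
  and space_radial_measure [simp]: "space (radial_measure \<rho>) = UNIV"
  by (simp_all add: radial_measure_def)

lemma sigma_finite_radial_measure:
  assumes "\<rho> \<in> borel_measurable borel"
  shows "sigma_finite_measure (radial_measure \<rho>)"
  unfolding radial_measure_def
  using assms by (subst sigma_finite_measure.sigma_finite_iff_density_finite[OF sigma_finite_lborel]) auto

lemma distr_radial_measure:
  fixes T :: "complex ^ 'n \<Rightarrow> complex ^ 'n"
  assumes [measurable]: "\<rho> \<in> borel_measurable borel" and "linear T" and iso: "\<And>x. norm (T x) = norm x"
  shows "distr (radial_measure \<rho>) (radial_measure \<rho>) T = radial_measure \<rho>"
proof (rule measure_eqI)
  have [measurable]: "T \<in> borel_measurable borel"
    using \<open>linear T\<close> by (intro borel_measurable_continuous_onI linear_continuous_on) (simp add: linear_conv_bounded_linear)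
  have Tm: "T \<in> radial_measure \<rho> \<rightarrow>\<^sub>M radial_measure \<rho>"
    by (simp cong: measurable_cong_sets)
  fix A assume "A \<in> sets (distr (radial_measure \<rho>) (radial_measure \<rho>) T)"
  then have [measurable]: "A \<in> sets borel" by simp
  have "emeasure (distr (radial_measure \<rho>) (radial_measure \<rho>) T) A = emeasure (radial_measure \<rho>) (T -` A)"
    by (subst emeasure_distr[OF Tm]) auto
  also have "\<dots> = (\<integral>\<^sup>+z. ennreal (\<rho> (norm z)) * indicator (T -` A) z \<partial>lborel)"
    unfolding radial_measure_def using measurable_sets[of T borel borel A]
    by (subst emeasure_density) auto
  also have "\<dots> = (\<integral>\<^sup>+z. ennreal (\<rho> (norm (T z))) * indicator A (T z) \<partial>lborel)"
    by (simp add: iso indicator_def)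
  also have "\<dots> = (\<integral>\<^sup>+z. ennreal (\<rho> (norm z)) * indicator A z \<partial>distr lborel borel T)"
    by (subst nn_integral_distr) auto
  also have "\<dots> = emeasure (radial_measure \<rho>) A"
    unfolding radial_measure_def lborel_distr_linear_isometry[OF assms(2) iso]
    by (subst emeasure_density) auto
  finally show "emeasure (distr (radial_measure \<rho>) (radial_measure \<rho>) T) A = emeasure (radial_measure \<rho>) A" .
qed simp

lemma integral_radial_average:
  fixes g h :: "complex ^ 'n \<Rightarrow> complex"
  assumes \<rho>: "\<rho> \<in> borel_measurable borel"
    and "integrable (radial_measure \<rho>) g"
    and "\<And>z. (LINT t|circle_measure. g (axis_rotation a t z)) = h z"
  shows "integrable (radial_measure \<rho>) h" "(LINT z|radial_measure \<rho>. g z) = (LINT z|radial_measure \<rho>. h z)"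
proof -
  have m: "(\<lambda>(t, z). axis_rotation a t z) \<in> circle_measure \<Otimes>\<^sub>M radial_measure \<rho> \<rightarrow>\<^sub>M radial_measure \<rho>"
    using measurable_axis_rotation[of a] by (simp cong: measurable_cong_sets sets_pair_measure_cong)
  have d: "distr (radial_measure \<rho>) (radial_measure \<rho>) (axis_rotation a t) = radial_measure \<rho>" for t
    by (rule distr_radial_measure[OF \<rho> linear_axis_rotation]) simp
  note * = integral_circle_average[OF sigma_finite_radial_measure[OF \<rho>] m d assms(2)]
  show "integrable (radial_measure \<rho>) h" "(LINT z|radial_measure \<rho>. g z) = (LINT z|radial_measure \<rho>. h z)"
    by (rule *; use assms(3) in simp)+
qed

section \<open>Gaussian and ball moments\<close>

lemma nn_integral_lborel_scale:
  fixes f :: "'a::euclidean_space \<Rightarrow> ennreal"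
  assumes [measurable]: "f \<in> borel_measurable borel" and r: "0 < r"
  shows "(\<integral>\<^sup>+x. f x \<partial>lborel) = ennreal (r ^ DIM('a)) * (\<integral>\<^sup>+x. f (r *\<^sub>R x) \<partial>lborel)"
proof -
  have "lborel = density (distr lborel borel (\<lambda>x::'a. 0 + r *\<^sub>R x)) (\<lambda>_. \<bar>r\<bar>^DIM('a))"
    by (rule lborel_affine) (use r in auto)
  then have "(\<integral>\<^sup>+x. f x \<partial>lborel) = (\<integral>\<^sup>+x. f x \<partial>density (distr lborel borel (\<lambda>x::'a. 0 + r *\<^sub>R x)) (\<lambda>_. \<bar>r\<bar>^DIM('a)))"
    by simp
  also have "\<dots> = ennreal (r ^ DIM('a)) * (\<integral>\<^sup>+x. f (r *\<^sub>R x) \<partial>lborel)"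
    using r by (subst nn_integral_density) (auto simp: nn_integral_distr nn_integral_cmult)
  finally show ?thesis .
qed

lemma nn_integral_Gamma_shift:
  fixes s \<kappa> :: real
  assumes "-1 < \<kappa>"
  shows "(\<integral>\<^sup>+t. ennreal (indicator {s..} t * (t - s) powr \<kappa> * exp (- t)) \<partial>lborel) = ennreal (exp (- s) * Gamma (\<kappa> + 1))"
proof -
  have "(\<integral>\<^sup>+t. ennreal (indicator {s..} t * (t - s) powr \<kappa> * exp (- t)) \<partial>lborel)
    = (\<integral>\<^sup>+t. ennreal (indicator {s..} (s + t) * ((s + t) - s) powr \<kappa> * exp (- (s + t))) \<partial>lborel)"
    by (rule nn_integral_lborel_shift[symmetric]) measurable
  also have "\<dots> = (\<integral>\<^sup>+t. ennreal (exp (- s)) * ennreal (indicator {0..} t * t powr (\<kappa> + 1 - 1) / exp t) \<partial>lborel)"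
    by (intro nn_integral_cong)
       (auto simp: indicator_def ennreal_mult'[symmetric] exp_diff exp_minus field_simps exp_add)
  also have "\<dots> = ennreal (exp (- s)) * ennreal (Gamma (\<kappa> + 1))"
    using assms by (subst nn_integral_cmult) (auto simp: Gamma_conv_nn_integral_real)
  finally show ?thesis by (simp add: ennreal_mult')
qed

text \<open>Integrating \<open>(t - (norm z)\<^sup>2) powr \<kappa> * exp (- t)\<close> over t above
  \<open>(norm z)\<^sup>2\<close> gives \<open>Gamma (\<kappa> + 1)\<close> times the Gaussian
  density. In the other order of integration, scaling z by \<open>sqrt t\<close> turns the inner
  integral into the ball moment times a power of t, and the t integral becomes the other Gamma
  factor. This takes the place of polar coordinates.\<close>

lemma nn_integral_ball_moment:
  fixes u :: "complex ^ 'n" and \<kappa> :: real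
  assumes \<kappa>: "-1 < \<kappa>"
  shows "ennreal (Gamma (CARD('n) + \<kappa> + 1 + real m)) *
      (\<integral>\<^sup>+z. ennreal (indicator {..<1} (norm z) * (1 - (norm z)\<^sup>2) powr \<kappa> * norm (cip z u) ^ (2 * m)) \<partial>lborel)
    = ennreal (Gamma (\<kappa> + 1)) * (\<integral>\<^sup>+z. ennreal (exp (- (norm z)\<^sup>2) * norm (cip z u) ^ (2 * m)) \<partial>lborel)"
    (is "ennreal ?G * ?I = _ * ?J")
proof -
  let ?q = "\<lambda>z. norm (cip z u) ^ (2 * m)"
  let ?F = "\<lambda>z t. ennreal (?q z) * ennreal (indicator {(norm z)\<^sup>2..} t * (t - (norm z)\<^sup>2) powr \<kappa> * exp (- t))"
  have "ennreal (Gamma (\<kappa> + 1)) * ?J = (\<integral>\<^sup>+z. ennreal (?q z) * ennreal (exp (- (norm z)\<^sup>2) * Gamma (\<kappa> + 1)) \<partial>lborel)"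
    using \<kappa> by (subst nn_integral_cmult[symmetric])
      (auto intro!: nn_integral_cong simp: ennreal_mult[symmetric] Gamma_real_pos mult_ac)
  also have "\<dots> = (\<integral>\<^sup>+z. (\<integral>\<^sup>+t. ?F z t \<partial>lborel) \<partial>lborel)"
    by (intro nn_integral_cong) (simp add: nn_integral_cmult nn_integral_Gamma_shift[OF \<kappa>])
  also have "\<dots> = (\<integral>\<^sup>+t. (\<integral>\<^sup>+z. ?F z t \<partial>lborel) \<partial>lborel)"
  proof (rule lborel_pair.Fubini')
    have "(\<lambda>(t, z). ennreal (?q z) * ennreal ((if (norm z)\<^sup>2 \<le> t then 1 else 0) * (t - (norm z)\<^sup>2) powr \<kappa> * exp (- t)))
       \<in> borel_measurable (lborel \<Otimes>\<^sub>M lborel)"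
      by measurable
    moreover have "indicator {(norm z)\<^sup>2..} t = (if (norm z)\<^sup>2 \<le> t then 1 else (0::real))" for z :: "complex^'n" and t
      by (simp add: indicator_def)
    ultimately show "(\<lambda>(t, z). ?F z t) \<in> borel_measurable (lborel \<Otimes>\<^sub>M lborel)"
      by simp
  qed
  also have "\<dots> = (\<integral>\<^sup>+t. ennreal (indicator {0..} t * t powr (CARD('n) + \<kappa> + 1 + real m - 1) / exp t) * ?I \<partial>lborel)"
  proof (rule nn_integral_cong)
    fix t :: real
    show "(\<integral>\<^sup>+z. ?F z t \<partial>lborel) = ennreal (indicator {0..} t * t powr (CARD('n) + \<kappa> + 1 + real m - 1) / exp t) * ?I"
    proof (cases "t > 0")
      case False
      have F0: "?F z t = 0" for z
      proof (cases "t < 0")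
        case True
        then have "\<not> (norm z)\<^sup>2 \<le> t" by (meson not_less order_trans zero_le_power2 less_le_trans)
        then show ?thesis by (simp add: indicator_def)
      qed (use False in \<open>auto simp: indicator_def\<close>)
      show ?thesis unfolding F0 using False by (auto simp: indicator_def)
    next
      case True
      have [measurable]: "(\<lambda>z. ?F z t) \<in> borel_measurable borel"
      proof -
        have "indicator {(norm z)\<^sup>2..} t = (if (norm z)\<^sup>2 \<le> t then 1 else (0::real))" for z :: "complex^'n"
          by (simp add: indicator_def)
        then show ?thesis by simp
      qed
      have m2: "(\<lambda>z. ?F (sqrt t *\<^sub>R z) t) \<in> borel_measurable borel"
        by (rule measurable_compose[of "\<lambda>z. sqrt t *\<^sub>R z" borel borel "\<lambda>z. ?F z t"]) auto
      have "(\<integral>\<^sup>+z. ?F z t \<partial>lborel) = ennreal (sqrt t ^ DIM(complex^'n)) * (\<integral>\<^sup>+z. ?F (sqrt t *\<^sub>R z) t \<partial>lborel)"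
        using True by (intro nn_integral_lborel_scale) auto
      also have "\<dots> = (\<integral>\<^sup>+z. ennreal (sqrt t ^ DIM(complex^'n)) * ?F (sqrt t *\<^sub>R z) t \<partial>lborel)"
        using m2 by (intro nn_integral_cmult[symmetric]) simp
      also have "\<dots> = (\<integral>\<^sup>+z. ennreal (t powr (CARD('n) + \<kappa> + 1 + real m - 1) / exp t) *
          ennreal (indicator {..<1} (norm z) * (1 - (norm z)\<^sup>2) powr \<kappa> * norm (cip z u) ^ (2 * m)) \<partial>lborel)"
      proof (rule nn_integral_cong)
        fix z :: "complex^'n"
        have a: "t * (norm z)\<^sup>2 \<le> t \<longleftrightarrow> norm z \<le> 1"
          using True abs_square_le_1[of "norm z"] by (simp add: mult_le_cancel_left2)
        have b: "(sqrt t * norm (cip z u)) ^ (2 * m) = t ^ m * norm (cip z u) ^ (2*m)"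
          using True by (simp add: power_mult_distrib power_mult)
        have c: "t powr (CARD('n) + \<kappa> + 1 + real m - 1) = t ^ CARD('n) * t ^ m * t powr \<kappa>"
          using True by (simp add: powr_add powr_realpow)
        have d: "sqrt t ^ DIM(complex^'n) = t ^ CARD('n)"
          using True by (simp add: mult.commute[of _ 2] power_mult)
        have e: "(t - t * (norm z)\<^sup>2) powr \<kappa> = t powr \<kappa> * (1 - (norm z)\<^sup>2) powr \<kappa>" if "norm z \<le> 1"
          using True that abs_square_le_1[of "norm z"] by (simp add: powr_mult[symmetric] right_diff_distrib)
        \<comment> \<open>The closed condition on the left and the open indicator on the right
          differ only on the unit sphere. There the base is 0, and \<open>0 powr \<kappa>\<close> is
          0 also for negative \<kappa>, so the integrands agree everywhere.\<close>
        have f: "norm z < 1 \<or> norm z = 1" if "norm z \<le> 1" using that by auto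
        have g: "sqrt t ^ (m * 2) = t ^ m"
          using True by (simp add: mult.commute[of m] power_mult)
        show "ennreal (sqrt t ^ DIM(complex^'n)) * ?F (sqrt t *\<^sub>R z) t =
           ennreal (t powr (CARD('n) + \<kappa> + 1 + real m - 1) / exp t) *
          ennreal (indicator {..<1} (norm z) * (1 - (norm z)\<^sup>2) powr \<kappa> * norm (cip z u) ^ (2 * m))"
          unfolding d c using True f
          by (auto simp: indicator_def ennreal_mult[symmetric] norm_mult power_mult_distrib a b[unfolded power_mult_distrib] e g
               exp_minus field_simps)
      qed
      also have "\<dots> = ennreal (t powr (CARD('n) + \<kappa> + 1 + real m - 1) / exp t) * ?I"
        by (subst nn_integral_cmult) auto
      finally show ?thesis using True by simp
    qed
  qed
  also have "\<dots> = ennreal ?G * ?I"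
    using \<kappa> by (subst nn_integral_multc) (auto simp: Gamma_conv_nn_integral_real)
  finally show ?thesis by simp
qed

abbreviation gaussian_measure :: "(complex ^ 'n) measure" where
  "gaussian_measure \<equiv> radial_measure (\<lambda>r. exp (- r\<^sup>2))"

text \<open>Unnormalized and with a real exponent: Schur's test integrates against weights whose
  exponents are slightly below the integer k.\<close>

definition ball_measure :: "real \<Rightarrow> (complex ^ 'n) measure" where
  "ball_measure \<kappa> = radial_measure (\<lambda>r. indicator {..<1} r * (1 - r\<^sup>2) powr \<kappa>)"

lemma sets_ball_measure [measurable_cong, simp]: "sets (ball_measure \<kappa>) = sets borel"
  and space_ball_measure [simp]: "space (ball_measure \<kappa>) = UNIV"
  by (simp_all add: ball_measure_def)

text \<open>The ball moment identity read backwards: at exponent 0 it expresses the Gaussian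
  integral by an integral of a bounded function over the unit ball.\<close>

lemma gaussian_moment_finite:
  fixes u :: "complex ^ 'n"
  shows "(\<integral>\<^sup>+z. ennreal (exp (- (norm z)\<^sup>2) * norm (cip z u) ^ (2 * m)) \<partial>lborel) < \<infinity>"
proof -
  have "(\<integral>\<^sup>+z. ennreal (indicator {..<1} (norm z) * (1 - (norm z)\<^sup>2) powr 0 * norm (cip z u) ^ (2 * m)) \<partial>lborel)
    \<le> (\<integral>\<^sup>+z. ennreal (norm u ^ (2 * m)) * indicator (ball (0::complex^'n) 1) z \<partial>lborel)"
  proof (rule nn_integral_mono)
    fix z :: "complex ^ 'n"
    have "norm (cip z u) ^ (2 * m) \<le> norm u ^ (2 * m)" if "norm z < 1"
    proof (rule power_mono)
      show "norm (cip z u) \<le> norm u"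
        using norm_cip_le[of z u] mult_right_mono[of "norm z" 1 "norm u"] that by simp
    qed simp
    then show "ennreal (indicator {..<1} (norm z) * (1 - (norm z)\<^sup>2) powr 0 * norm (cip z u) ^ (2 * m))
      \<le> ennreal (norm u ^ (2 * m)) * indicator (ball 0 1) z"
      by (auto simp: indicator_def intro!: ennreal_leI)
  qed
  also have "\<dots> < \<infinity>"
    using emeasure_bounded_finite[of "ball (0::complex^'n) 1"]
    by (subst nn_integral_cmult_indicator) (auto simp: ennreal_mult_less_top)
  finally have "ennreal (Gamma (0 + 1)) * (\<integral>\<^sup>+z. ennreal (exp (- (norm z)\<^sup>2) * norm (cip z u) ^ (2 * m)) \<partial>lborel) < \<infinity>"
    by (subst nn_integral_ball_moment[symmetric]) (auto simp: ennreal_mult_less_top)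
  then show ?thesis by simp
qed

lemma integrable_radial_measure_nonneg:
  fixes g :: "complex ^ 'n \<Rightarrow> real"
  assumes [measurable]: "\<rho> \<in> borel_measurable borel" "g \<in> borel_measurable borel"
    and "\<And>z::complex^'n. 0 \<le> \<rho> (norm z)" "\<And>z. 0 \<le> g z"
  shows "integrable (radial_measure \<rho>) g \<longleftrightarrow> (\<integral>\<^sup>+z. ennreal (\<rho> (norm z) * g z) \<partial>lborel) < \<infinity>"
    "(LINT z|radial_measure \<rho>. g z) = enn2real (\<integral>\<^sup>+z. ennreal (\<rho> (norm z) * g z) \<partial>lborel)"
proof -
  have eq: "(\<integral>\<^sup>+z. ennreal (g z) \<partial>radial_measure \<rho>) = (\<integral>\<^sup>+z. ennreal (\<rho> (norm z) * g z) \<partial>lborel)"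
    unfolding radial_measure_def
    by (subst nn_integral_density) (auto intro!: nn_integral_cong simp: ennreal_mult assms(3,4))
  show "integrable (radial_measure \<rho>) g \<longleftrightarrow> (\<integral>\<^sup>+z. ennreal (\<rho> (norm z) * g z) \<partial>lborel) < \<infinity>"
    unfolding eq[symmetric] integrable_iff_bounded
    using assms(4) by (simp cong: measurable_cong_sets)
  show "(LINT z|radial_measure \<rho>. g z) = enn2real (\<integral>\<^sup>+z. ennreal (\<rho> (norm z) * g z) \<partial>lborel)"
    unfolding eq[symmetric] by (rule integral_eq_nn_integral) (auto simp: assms)
qed

lemma integrable_gaussian_moment: "integrable gaussian_measure (\<lambda>z. norm (cip z u) ^ (2 * m))"
  by (subst integrable_radial_measure_nonneg) (use gaussian_moment_finite in auto)

lemma integral_radial_density: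
  fixes g :: "complex ^ 'n \<Rightarrow> 'b::{banach, second_countable_topology}"
  assumes [measurable]: "\<rho> \<in> borel_measurable borel" "g \<in> borel_measurable borel"
    and "\<And>z::complex^'n. 0 \<le> \<rho> (norm z)"
  shows "integrable (radial_measure \<rho>) g \<longleftrightarrow> integrable lborel (\<lambda>z. \<rho> (norm z) *\<^sub>R g z)"
    and "(LINT z|radial_measure \<rho>. g z) = (LINT z|lborel. \<rho> (norm z) *\<^sub>R g z)"
proof -
  show "integrable (radial_measure \<rho>) g \<longleftrightarrow> integrable lborel (\<lambda>z. \<rho> (norm z) *\<^sub>R g z)"
    unfolding radial_measure_def by (subst integrable_density) (auto simp: assms(3))
  show "(LINT z|radial_measure \<rho>. g z) = (LINT z|lborel. \<rho> (norm z) *\<^sub>R g z)"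
    unfolding radial_measure_def by (subst integral_density) (auto simp: assms(3))
qed

text \<open>Generating function of the moments. The integral of the squared modulus of exp (t <z,
  u>) is found by completing the square, which shifts the Gaussian by t u and produces
  \<open>exp (t\<^sup>2)\<close>. On the other hand, averaging over scalar rotations and Parseval
  turn the integrand into a power series in \<open>norm (cip z u)\<close> with nonnegative
  terms.\<close>

lemma gaussian_moment_series:
  fixes u :: "complex ^ 'n"
  assumes "norm u = 1"
  shows "(\<lambda>m. (LINT z|gaussian_measure. norm (cip z u) ^ (2 * m)) / (fact m)\<^sup>2 * t ^ (2 * m))
    sums (exp (t\<^sup>2) * (LINT z::complex^'n|gaussian_measure. 1))"
proof -
  let ?c = "\<lambda>m. of_real (t ^ m / fact m) :: complex"
  let ?g = "\<lambda>z. of_real (exp (2 * t * Re (cip z u))) :: complex"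
  let ?h = "\<lambda>z. \<Sum>m. (t ^ m / fact m)\<^sup>2 * norm (cip z u) ^ (2 * m)"
  have shift: "exp (- (norm z)\<^sup>2) * exp (2 * t * Re (cip z u)) = exp (t\<^sup>2) * exp (- (norm (z - t *\<^sub>R u))\<^sup>2)" for z
    using assms by (simp add: norm_diff_sq exp_add[symmetric] exp_diff[symmetric] power_mult_distrib algebra_simps)
  have g1: "integrable lborel (\<lambda>z::complex^'n. exp (- (norm z)\<^sup>2))"
    using integrable_gaussian_moment[of "0 :: complex ^ 'n" 0] by (subst (asm) integral_radial_density) auto
  have affine: "lborel = distr lborel borel (\<lambda>z. z - t *\<^sub>R u)"
  proof -
    have "(+) (- (t *\<^sub>R u)) = (\<lambda>z. z - t *\<^sub>R u)" by auto
    then show ?thesis using lborel_distr_plus[of "- (t *\<^sub>R u)"] by metis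
  qed
  have g2: "integrable lborel (\<lambda>z::complex^'n. exp (- (norm (z - t *\<^sub>R u))\<^sup>2))"
    using g1 by (subst (asm) affine) (auto simp: integrable_distr_eq)
  have g3: "(LINT z|lborel. exp (- (norm (z - t *\<^sub>R u))\<^sup>2)) = (LINT z::complex^'n|lborel. exp (- (norm z)\<^sup>2))"
    by (subst (2) affine) (auto simp: integral_distr)
  have int_g: "integrable gaussian_measure (\<lambda>z. exp (2 * t * Re (cip z u)))"
    by (subst integral_radial_density) (auto simp: shift g2)
  have LINT_g: "(LINT z|gaussian_measure. exp (2 * t * Re (cip z u))) = exp (t\<^sup>2) * (LINT z::complex^'n|gaussian_measure. 1)"
    by (subst (1 2) integral_radial_density) (auto simp: shift g3)
  have csum: "summable (\<lambda>m. norm (?c m) * x ^ m)" for x :: real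
  proof -
    have "norm (?c m) = \<bar>t\<bar> ^ m / fact m" for m
      by (simp only: norm_of_real) (simp add: power_abs)
    then show ?thesis
      using summable_exp[of "\<bar>t\<bar> * x"] by (simp add: power_mult_distrib divide_inverse mult_ac)
  qed
  have avg: "(\<lambda>m. of_real ((t ^ m / fact m)\<^sup>2 * norm (cip z u) ^ (2 * m))) sums (LINT s|circle_measure. ?g (axis_rotation 0 s z))" for z
  proof -
    have e: "(\<Sum>m. ?c m * (cip z u * cis s) ^ m) = exp (of_real t * (cip z u * cis s))" for s
      by (simp add: exp_def power_mult_distrib scaleR_conv_of_real field_simps)
    have "(\<lambda>s. (\<Sum>m. ?c m * (cip z u * cis s) ^ m) * cnj (\<Sum>m. ?c m * (cip z u * cis s) ^ m)) = (\<lambda>s. ?g (axis_rotation 0 s z))"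
      unfolding e
      by (intro ext) (simp add: complex_norm_square[symmetric] mult_ac power2_eq_square exp_add[symmetric] right_diff_distrib flip: of_real_mult)
    then show ?thesis
      using circle_parseval[OF csum csum, of "cip z u"] by (simp add: power2_eq_square)
  qed
  have hsum: "(\<lambda>m. (t ^ m / fact m)\<^sup>2 * norm (cip z u) ^ (2 * m)) sums ?h z"
    and avg': "(LINT s|circle_measure. ?g (axis_rotation 0 s z)) = of_real (?h z)" for z
  proof -
    have "summable (\<lambda>m. of_real ((t ^ m / fact m)\<^sup>2 * norm (cip z u) ^ (2 * m)) :: complex)"
      using avg sums_summable by blast
    then have s: "summable (\<lambda>m. (t ^ m / fact m)\<^sup>2 * norm (cip z u) ^ (2 * m))"
      by (simp only: summable_of_real_iff)
    then show "(\<lambda>m. (t ^ m / fact m)\<^sup>2 * norm (cip z u) ^ (2 * m)) sums ?h z" by (rule summable_sums)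
    then show "(LINT s|circle_measure. ?g (axis_rotation 0 s z)) = of_real (?h z)"
      using sums_unique2[OF avg[of z]] by (simp only: sums_of_real_iff)
  qed
  have "integrable gaussian_measure ?g"
    using int_g by simp
  note * = integral_radial_average[OF _ this avg']
  have int_h: "integrable gaussian_measure ?h"
    using *(1) by (simp only: complex_of_real_integrable_eq borel_measurable_exp) auto
  have LINT_h: "(LINT z|gaussian_measure. ?h z) = exp (t\<^sup>2) * (LINT z::complex^'n|gaussian_measure. 1)"
  proof -
    have "of_real (LINT z|gaussian_measure. ?h z) = (of_real (LINT z|gaussian_measure. exp (2 * t * Re (cip z u))) :: complex)"
      using *(2) by simp
    then show ?thesis using LINT_g by (simp only: of_real_eq_iff)
  qed
  have "(\<lambda>N. LINT z|gaussian_measure. (\<Sum>m<N. (t ^ m / fact m)\<^sup>2 * norm (cip z u) ^ (2 * m))) \<longlonglongrightarrow> (LINT z|gaussian_measure. ?h z)"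
  proof (rule integral_dominated_convergence[OF _ _ int_h])
    show "AE z in gaussian_measure. (\<lambda>N. \<Sum>m<N. (t ^ m / fact m)\<^sup>2 * norm (cip z u) ^ (2 * m)) \<longlonglongrightarrow> ?h z"
      using hsum by (auto simp: sums_def)
    show "AE z in gaussian_measure. norm (\<Sum>m<N. (t ^ m / fact m)\<^sup>2 * norm (cip z u) ^ (2 * m)) \<le> ?h z" for N
      using sum_le_suminf[OF sums_summable[OF hsum]] by (auto simp: sum_nonneg)
  qed measurable
  also have "(\<lambda>N. LINT z|gaussian_measure. (\<Sum>m<N. (t ^ m / fact m)\<^sup>2 * norm (cip z u) ^ (2 * m)))
    = (\<lambda>N. \<Sum>m<N. (LINT z|gaussian_measure. norm (cip z u) ^ (2 * m)) / (fact m)\<^sup>2 * t ^ (2 * m))"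
  proof
    fix N
    have "(LINT z|gaussian_measure. (\<Sum>m<N. (t ^ m / fact m)\<^sup>2 * norm (cip z u) ^ (2 * m)))
      = (\<Sum>m<N. (t ^ m / fact m)\<^sup>2 * (LINT z|gaussian_measure. norm (cip z u) ^ (2 * m)))"
      by (subst Bochner_Integration.integral_sum)
         (simp_all only: integral_mult_right_zero integrable_mult_right[OF integrable_gaussian_moment])
    also have "\<dots> = (\<Sum>m<N. (LINT z|gaussian_measure. norm (cip z u) ^ (2 * m)) / (fact m)\<^sup>2 * t ^ (2 * m))"
      by (simp add: power_divide power_mult[symmetric] mult_ac)
    finally show "(LINT z|gaussian_measure. (\<Sum>m<N. (t ^ m / fact m)\<^sup>2 * norm (cip z u) ^ (2 * m)))
      = (\<Sum>m<N. (LINT z|gaussian_measure. norm (cip z u) ^ (2 * m)) / (fact m)\<^sup>2 * t ^ (2 * m))" .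
  qed
  finally show ?thesis unfolding sums_def LINT_h .
qed

lemma pred_ball [measurable]: "Measurable.pred borel (\<lambda>x. x \<in> ball c r)"
proof -
  have "{x \<in> space borel. x \<in> ball c r} = ball c r" by auto
  then show ?thesis unfolding pred_def by (metis borel_open open_ball)
qed

lemma gaussian_moment:
  fixes u :: "complex ^ 'n"
  assumes "norm u = 1"
  shows "(LINT z|gaussian_measure. norm (cip z u) ^ (2 * m)) = fact m * (LINT z::complex^'n|gaussian_measure. 1)"
proof -
  let ?J = "\<lambda>m. LINT z|gaussian_measure. norm (cip z u) ^ (2 * m)"
  let ?G = "LINT z::complex^'n|gaussian_measure. (1::real)"
  define a where "a m = ?J m / (fact m)\<^sup>2 - ?G / fact m" for m
  have a_sums: "(\<lambda>m. a m * x ^ m) sums 0" if "0 \<le> x" for x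
  proof -
    have "(\<lambda>m. ?G * (x ^ m /\<^sub>R fact m)) sums (?G * exp x)"
      by (intro sums_mult exp_converges)
    moreover have "(\<lambda>m. ?J m / (fact m)\<^sup>2 * x ^ m) sums (exp x * ?G)"
      using gaussian_moment_series[OF assms, of "sqrt x"] that by (simp add: power_mult)
    ultimately have "(\<lambda>m. ?J m / (fact m)\<^sup>2 * x ^ m - ?G * (x ^ m /\<^sub>R fact m)) sums (exp x * ?G - ?G * exp x)"
      by (intro sums_diff)
    then show ?thesis by (simp add: a_def algebra_simps divide_inverse)
  qed
  \<comment> \<open>The identity is known only for nonnegative x, the squares of real t. That is
    enough, since the zeros of a nonzero power series are isolated; the constant coefficient
    vanishes by definition, which supplies the zero at 0.\<close>
  have "a m = 0"
  proof (rule ccontr)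
    assume am: "a m \<noteq> 0"
    then have "m > 0" by (cases m) (auto simp: a_def)
    have "summable (\<lambda>m. a m * 1 ^ m)" using a_sums[of 1] sums_summable by simp
    then have "(\<lambda>m. a m * (x - 0) ^ m) sums (\<Sum>m. a m * x ^ m)" if "norm (x - 0) < 1" for x
      using powser_inside[of a 1 x] that by (simp add: summable_sums)
    moreover have "(\<Sum>m. a m * 0 ^ m) = 0" using a_sums[of 0] by (simp add: sums_iff)
    ultimately obtain s where "0 < s" "\<And>x. x \<in> cball 0 s - {0} \<Longrightarrow> (\<Sum>m. a m * x ^ m) \<noteq> 0"
      using powser_0_nonzero[of 1 0 a "\<lambda>x. \<Sum>m. a m * x ^ m" m] am \<open>m > 0\<close> by auto
    then show False using a_sums[of s] by (auto simp: sums_iff)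
  qed
  then show ?thesis by (simp add: a_def power2_eq_square field_simps)
qed

definition ball_mass :: "'n::finite itself \<Rightarrow> real \<Rightarrow> real" where
  "ball_mass _ \<kappa> = (LINT z::complex^'n|ball_measure \<kappa>. 1)"

lemma ball_density_measurable: "(\<lambda>r. indicator {..<1} r * (1 - r\<^sup>2) powr \<kappa> :: real) \<in> borel_measurable borel"
  by measurable

lemma ball_measure_moments:
  fixes u :: "complex ^ 'n" and \<kappa> :: real
  assumes \<kappa>: "-1 < \<kappa>"
  shows "integrable (ball_measure \<kappa>) (\<lambda>z. norm (cip z u) ^ (2 * m))"
    and "Gamma (CARD('n) + \<kappa> + 1 + real m) * (LINT z|ball_measure \<kappa>. norm (cip z u) ^ (2 * m))
      = Gamma (\<kappa> + 1) * (LINT z|gaussian_measure. norm (cip z u) ^ (2 * m))"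
proof -
  let ?I = "\<integral>\<^sup>+z. ennreal (indicator {..<1} (norm z) * (1 - (norm z)\<^sup>2) powr \<kappa> * norm (cip z u) ^ (2 * m)) \<partial>lborel"
  have G: "0 < Gamma (CARD('n) + \<kappa> + 1 + real m)" "0 < Gamma (\<kappa> + 1)"
    using \<kappa> by (auto intro!: Gamma_real_pos)
  have "ennreal (Gamma (CARD('n) + \<kappa> + 1 + real m)) * ?I < \<infinity>"
    unfolding nn_integral_ball_moment[OF \<kappa>]
    using gaussian_moment_finite[of u m] by (auto simp: ennreal_mult_less_top)
  then have fin: "?I < \<infinity>"
    using G by (auto simp: ennreal_mult_less_top)
  then show "integrable (ball_measure \<kappa>) (\<lambda>z. norm (cip z u) ^ (2 * m))"
    unfolding ball_measure_def by (subst integrable_radial_measure_nonneg) auto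
  have "Gamma (CARD('n) + \<kappa> + 1 + real m) * (LINT z|ball_measure \<kappa>. norm (cip z u) ^ (2 * m))
    = enn2real (ennreal (Gamma (CARD('n) + \<kappa> + 1 + real m)) * ?I)"
    unfolding ball_measure_def using G by (subst integrable_radial_measure_nonneg(2)) (auto simp: enn2real_mult)
  also have "\<dots> = Gamma (\<kappa> + 1) * (LINT z|gaussian_measure. norm (cip z u) ^ (2 * m))"
    unfolding nn_integral_ball_moment[OF \<kappa>]
    using G by (subst integrable_radial_measure_nonneg(2)) (auto simp: enn2real_mult)
  finally show "Gamma (CARD('n) + \<kappa> + 1 + real m) * (LINT z|ball_measure \<kappa>. norm (cip z u) ^ (2 * m))
      = Gamma (\<kappa> + 1) * (LINT z|gaussian_measure. norm (cip z u) ^ (2 * m))" .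
qed

lemma finite_ball_measure:
  assumes "-1 < \<kappa>"
  shows "finite_measure (ball_measure \<kappa> :: (complex ^ 'n) measure)"
proof (rule finite_measureI)
  have "integrable (ball_measure \<kappa>) (\<lambda>z::complex^'n. 1 :: real)"
    using ball_measure_moments(1)[OF assms, where u="0 :: complex ^ 'n" and m=0] by simp
  then show "emeasure (ball_measure \<kappa> :: (complex ^ 'n) measure) (space (ball_measure \<kappa>)) \<noteq> \<infinity>"
    by (auto simp: integrable_iff_bounded)
qed

lemma AE_ball_measure: "AE z in ball_measure \<kappa>. z \<in> ball 0 1"
  unfolding ball_measure_def radial_measure_def
  by (subst AE_density) (auto simp: indicator_def)

text \<open>At exponent 0 the mass is the volume of the unit ball. The Gamma identity carries
  positivity from there to the Gaussian mass, and from the Gaussian mass to every exponent.\<close>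

lemma ball_mass_pos:
  assumes "-1 < \<kappa>"
  shows "0 < ball_mass TYPE('n::finite) \<kappa>"
proof -
  let ?G = "LINT z::complex^'n|gaussian_measure. (1::real)"
  have *: "Gamma (CARD('n) + \<kappa> + 1) * ball_mass TYPE('n) \<kappa> = Gamma (\<kappa> + 1) * ?G" if "-1 < \<kappa>" for \<kappa> :: real
    using ball_measure_moments(2)[OF that, where u="0 :: complex ^ 'n" and m=0] by (simp add: ball_mass_def)
  have nz: "norm z \<noteq> - 1" for z :: "complex ^ 'n" by (smt (verit) norm_ge_zero)
  have "(LINT z::complex^'n|ball_measure 0. (1::real)) = enn2real (emeasure lborel (ball (0::complex^'n) 1))"
    unfolding ball_measure_def
    by (subst integrable_radial_measure_nonneg(2))
       (auto simp: nn_integral_indicator[symmetric] indicator_def power2_eq_1_iff nz intro!: arg_cong[where f=enn2real] nn_integral_cong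
         simp del: nn_integral_indicator)
  also have "\<dots> > 0"
    by (simp add: emeasure_ball)
  finally have "ball_mass TYPE('n) 0 > 0" unfolding ball_mass_def .
  then have "Gamma (CARD('n) + 0 + 1) * ball_mass TYPE('n) 0 > 0"
    by (intro mult_pos_pos Gamma_real_pos) auto
  then have "Gamma (0 + 1) * ?G > 0"
    by (subst *[symmetric]) (simp_all add: add.commute)
  then have "?G > 0" by simp
  then have "Gamma (CARD('n) + \<kappa> + 1) * ball_mass TYPE('n) \<kappa> > 0"
    unfolding *[OF assms] using assms by (auto intro!: mult_pos_pos Gamma_real_pos)
  moreover have "Gamma (CARD('n) + \<kappa> + 1) > 0" using assms by (auto intro!: Gamma_real_pos)
  ultimately show ?thesis by (simp add: zero_less_mult_iff)
qed

lemma ball_moment: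
  fixes a :: "complex ^ 'n" and \<kappa> :: real
  assumes \<kappa>: "-1 < \<kappa>"
  shows "(LINT z|ball_measure \<kappa>. norm (cip z a) ^ (2 * m)) =
    norm a ^ (2 * m) * (ball_mass TYPE('n) \<kappa> * fact m / pochhammer (CARD('n) + \<kappa> + 1) m)"
proof (cases "a = 0")
  case True
  then show ?thesis by (cases m) (auto simp: ball_mass_def)
next
  case False
  define u where "u = (1 / norm a) *\<^sub>R a"
  have u: "norm u = 1" and au: "a = norm a *\<^sub>R u" using False by (auto simp: u_def)
  let ?G = "LINT z::complex^'n|gaussian_measure. (1::real)"
  let ?\<beta> = "CARD('n) + \<kappa> + 1"
  have G: "0 < Gamma (?\<beta> + real m)" "0 < Gamma ?\<beta>"
    using \<kappa> by (auto intro!: Gamma_real_pos)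
  have \<beta>: "?\<beta> > 0" using \<kappa> by simp
  have p: "pochhammer ?\<beta> m = Gamma (?\<beta> + real m) / Gamma ?\<beta>"
    using \<beta> by (subst pochhammer_Gamma) (auto elim!: nonpos_Ints_cases)
  have "Gamma (?\<beta> + real m) * (LINT z|ball_measure \<kappa>. norm (cip z u) ^ (2 * m)) = Gamma (\<kappa> + 1) * (fact m * ?G)"
    by (simp only: ball_measure_moments(2)[OF \<kappa>] gaussian_moment[OF u])
  moreover have "Gamma ?\<beta> * ball_mass TYPE('n) \<kappa> = Gamma (\<kappa> + 1) * ?G"
    using ball_measure_moments(2)[OF \<kappa>, where u=u and m=0] by (simp add: ball_mass_def)
  ultimately have *: "(LINT z|ball_measure \<kappa>. norm (cip z u) ^ (2 * m)) = ball_mass TYPE('n) \<kappa> * fact m / pochhammer ?\<beta> m"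
    using G unfolding p by (simp add: field_simps)
  have "(LINT z|ball_measure \<kappa>. norm (cip z a) ^ (2 * m)) = (LINT z|ball_measure \<kappa>. norm a ^ (2 * m) * norm (cip z u) ^ (2 * m))"
    by (subst au) (simp add: norm_mult power_mult_distrib)
  also have "\<dots> = norm a ^ (2 * m) * (ball_mass TYPE('n) \<kappa> * fact m / pochhammer ?\<beta> m)"
    unfolding integral_mult_right_zero * ..
  finally show ?thesis .
qed

lemma norm_cip_ball:
  assumes "z \<in> ball 0 1"
  shows "norm (cip z a) < norm a \<or> cip z a = 0"
proof (cases "a = 0")
  case False
  then have "norm z * norm a < 1 * norm a"
    by (intro mult_strict_right_mono) (use assms in auto)
  then show ?thesis using norm_cip_le[of z a] by linarith
qed simp

text \<open>Averaging over scalar rotations of z leaves only the diagonal terms, and these are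
  moments of \<open>cip z a\<close>. Convergence for radii below \<open>norm a\<close> suffices
  because \<open>norm (cip z a)\<close> stays below that value inside the ball. Integrability of the
  product justifies the averaging, and the last hypothesis justifies integrating term by
  term.\<close>

lemma integral_ball_series:
  fixes a :: "complex ^ 'n" and \<kappa> :: real and c d :: "nat \<Rightarrow> complex"
  assumes \<kappa>: "-1 < \<kappa>"
    and c: "\<And>x. 0 \<le> x \<Longrightarrow> x < norm a \<Longrightarrow> summable (\<lambda>m. norm (c m) * x ^ m)"
    and d: "\<And>x. 0 \<le> x \<Longrightarrow> x < norm a \<Longrightarrow> summable (\<lambda>m. norm (d m) * x ^ m)"
    and int: "integrable (ball_measure \<kappa>)
       (\<lambda>z. if z \<in> ball 0 1 then (\<Sum>m. c m * cip z a ^ m) * cnj (\<Sum>m. d m * cip z a ^ m) else 0)"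
    and S: "summable (\<lambda>m. norm (c m) * norm (d m) * (norm a ^ (2 * m) * (fact m / pochhammer (CARD('n) + \<kappa> + 1) m)))"
  shows "(\<lambda>m. c m * cnj (d m) * of_real (norm a ^ (2 * m) * (ball_mass TYPE('n) \<kappa> * fact m / pochhammer (CARD('n) + \<kappa> + 1) m)))
     sums (LINT z|ball_measure \<kappa>. (if z \<in> ball 0 1 then (\<Sum>m. c m * cip z a ^ m) * cnj (\<Sum>m. d m * cip z a ^ m) else 0))"
proof -
  let ?g = "\<lambda>z. if z \<in> ball 0 1 then (\<Sum>m. c m * cip z a ^ m) * cnj (\<Sum>m. d m * cip z a ^ m) else 0"
  let ?f = "\<lambda>m z. c m * cnj (d m) * of_real (norm (cip z a) ^ (2 * m))"
  let ?M = "\<lambda>m. norm a ^ (2 * m) * (ball_mass TYPE('n) \<kappa> * fact m / pochhammer (CARD('n) + \<kappa> + 1) m)"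
  let ?h = "\<lambda>z. if z \<in> ball 0 1 then (\<Sum>m. ?f m z) else 0"
  have sc: "summable (\<lambda>m. norm (c m) * norm (cip z a) ^ m)" and sd: "summable (\<lambda>m. norm (d m) * norm (cip z a) ^ m)"
    if "z \<in> ball 0 1" for z
    using norm_cip_ball[OF that, of a] c[of "norm (cip z a)"] d[of "norm (cip z a)"] by auto
  have avg: "(LINT t|circle_measure. ?g (axis_rotation 0 t z)) = ?h z" for z
  proof (cases "z \<in> ball 0 1")
    case True
    have "(LINT t|circle_measure. ?g (axis_rotation 0 t z)) =
      (LINT t|circle_measure. (\<Sum>m. c m * (cip z a * cis t) ^ m) * cnj (\<Sum>m. d m * (cip z a * cis t) ^ m))"
      using True by (simp add: mult.commute[of "cis _"])
    also have "\<dots> = (\<Sum>m. ?f m z)"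
      by (rule sums_unique[OF circle_parseval[OF sc sd]]) fact+
    finally show ?thesis using True by simp
  qed simp
  note * = integral_radial_average[OF ball_density_measurable int[unfolded ball_measure_def] avg, folded ball_measure_def]
  have ff: "(LINT z|ball_measure \<kappa>. ?f m z) = c m * cnj (d m) * of_real (?M m)" for m
    by (simp only: integral_mult_right_zero integral_complex_of_real ball_moment[OF \<kappa>])
  have fi: "integrable (ball_measure \<kappa>) (?f m)" for m
    by (intro integrable_mult_right) (simp only: complex_of_real_integrable_eq ball_measure_moments(1)[OF \<kappa>])
  have "(\<lambda>m. LINT z|ball_measure \<kappa>. ?f m z) sums (LINT z|ball_measure \<kappa>. (\<Sum>m. ?f m z))"
  proof (rule sums_integral[OF fi])
    show "AE z in ball_measure \<kappa>. summable (\<lambda>m. norm (?f m z))"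
      using AE_ball_measure
    proof eventually_elim
      case (elim z)
      \<comment> \<open>Parseval for the coefficients replaced by their absolute values yields
        absolute convergence of the diagonal series.\<close>
      have "(\<lambda>m. of_real (norm (c m)) * cnj (of_real (norm (d m))) * of_real (norm (cip z a) ^ (2 * m)))
         sums (LINT t|circle_measure. (\<Sum>m. of_real (norm (c m)) * (cip z a * cis t) ^ m) * cnj (\<Sum>m. of_real (norm (d m)) * (cip z a * cis t) ^ m))"
        by (rule circle_parseval) (use sc[OF elim] sd[OF elim] in simp_all)
      then have "summable (\<lambda>m. of_real (norm (?f m z)) :: complex)"
        by (simp add: sums_summable norm_mult norm_power)
      then show ?case by (simp only: summable_of_real_iff)
    qed
    have "(LINT z|ball_measure \<kappa>. norm (?f m z)) = ball_mass TYPE('n) \<kappa> * (norm (c m) * norm (d m) * (norm a ^ (2 * m) * (fact m / pochhammer (CARD('n) + \<kappa> + 1) m)))" for m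
      by (simp add: norm_mult norm_power ball_moment[OF \<kappa>])
    then show "summable (\<lambda>m. LINT z|ball_measure \<kappa>. norm (?f m z))"
      using summable_mult[OF S, of "ball_mass TYPE('n) \<kappa>"] by simp
  qed
  also have "(LINT z|ball_measure \<kappa>. (\<Sum>m. ?f m z)) = (LINT z|ball_measure \<kappa>. ?h z)"
  proof (rule integral_cong_AE)
    show "AE z in ball_measure \<kappa>. (\<Sum>m. ?f m z) = ?h z"
      using AE_ball_measure by eventually_elim simp
  qed measurable
  finally show ?thesis unfolding ff *(2) .
qed

section \<open>The Forelli-Rudin estimate\<close>

text \<open>By the limit formula for Gamma, \<open>pochhammer x (Suc m)\<close> behaves like m! m^x
  / Gamma x. The factorials and, because of 2 s = \<beta> + \<eta>, the powers of m cancel in the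
  quotient, which therefore converges and is bounded.\<close>

lemma pochhammer_ratio_bounded:
  fixes s \<beta> \<eta> :: real
  assumes "0 < \<beta>" "0 < \<eta>" and s: "2 * s = \<beta> + \<eta>"
  obtains C where "0 < C" "\<And>m. (pochhammer s m)\<^sup>2 \<le> C * (pochhammer \<beta> m * pochhammer \<eta> m)"
proof -
  have "0 < s" using assms by simp
  have pp: "0 < pochhammer x m" if "0 < x" for x :: real and m
    using that by (rule pochhammer_pos)
  define R where "R m = (pochhammer s m)\<^sup>2 / (pochhammer \<beta> m * pochhammer \<eta> m)" for m
  have "(\<lambda>m. Gamma_series \<beta> m * Gamma_series \<eta> m / (Gamma_series s m)\<^sup>2) \<longlonglongrightarrow> Gamma \<beta> * Gamma \<eta> / (Gamma s)\<^sup>2"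
    using Gamma_real_pos[OF \<open>0 < s\<close>] by (intro tendsto_intros Gamma_series_LIMSEQ) auto
  moreover have "Gamma_series \<beta> m * Gamma_series \<eta> m / (Gamma_series s m)\<^sup>2 = R (Suc m)" for m
  proof -
    have e: "exp (\<beta> * ln m) * exp (\<eta> * ln m) = (exp (s * ln (real m)))\<^sup>2"
      by (simp add: power2_eq_square exp_add[symmetric] s[symmetric] distrib_right[symmetric])
    have "Gamma_series \<beta> m * Gamma_series \<eta> m / (Gamma_series s m)\<^sup>2
      = (exp (\<beta> * ln m) * exp (\<eta> * ln m)) * (pochhammer s (Suc m))\<^sup>2 / ((exp (s * ln (real m)))\<^sup>2 * (pochhammer \<beta> (Suc m) * pochhammer \<eta> (Suc m)))"
      by (simp add: Gamma_series_def power_divide power_mult_distrib power2_eq_square mult_ac)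
    then show ?thesis unfolding e R_def by simp
  qed
  ultimately have "(\<lambda>m. R (Suc m)) \<longlonglongrightarrow> Gamma \<beta> * Gamma \<eta> / (Gamma s)\<^sup>2" by simp
  then have "Bseq (\<lambda>m. R (Suc m))" by (intro convergent_imp_Bseq convergentI)
  then have "Bseq R" by (simp only: Bseq_Suc_iff)
  then obtain C where C: "0 < C" "\<And>m. norm (R m) \<le> C" by (auto simp: Bseq_def)
  show ?thesis
  proof
    fix m
    have "0 < pochhammer \<beta> m * pochhammer \<eta> m" using pp assms by simp
    then show "(pochhammer s m)\<^sup>2 \<le> C * (pochhammer \<beta> m * pochhammer \<eta> m)"
      using C(2)[of m] by (auto simp: R_def pos_divide_le_eq abs_le_iff)
  qed fact
qed

lemma binomial_series_negative:
  fixes z :: complex and s :: real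
  assumes "norm z < 1"
  shows "(\<lambda>m. of_real (pochhammer s m / fact m) * z ^ m) sums ((1 - z) powr of_real (- s))"
proof -
  have "(\<lambda>m. (of_real (- s) gchoose m) * (- z) ^ m) sums ((1 + (- z)) powr of_real (- s))"
    by (rule gen_binomial_complex) (use assms in simp)
  also have "(\<lambda>m. (of_real (- s) gchoose m) * (- z) ^ m) = (\<lambda>m. of_real (pochhammer s m / fact m) * z ^ m)"
    by (intro ext) (simp add: gbinomial_pochhammer pochhammer_of_real power_minus[of z])
  finally show ?thesis by simp
qed

text \<open>With s half of the exponent, the integrand is the squared modulus of (1 - <z, a>)^(-s).
  Its binomial series has coefficients (s)_m / m!, and the moments contribute m! / (\<beta>)_m. By
  the bound on Pochhammer quotients the resulting series in |a|^2 is dominated by a constant times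
  the binomial series of (1 - |a|^2)^(-\<eta>).\<close>

lemma forelli_rudin:
  fixes \<kappa> \<eta> :: real
  assumes \<kappa>: "-1 < \<kappa>" and \<eta>: "0 < \<eta>"
  obtains C where "0 < C"
    "\<And>a::complex^'n. a \<in> ball 0 1 \<Longrightarrow>
       integrable (ball_measure \<kappa>) (\<lambda>z. norm (1 - cip z a) powr - (CARD('n) + 1 + \<kappa> + \<eta>))"
    "\<And>a::complex^'n. a \<in> ball 0 1 \<Longrightarrow>
       (LINT z|ball_measure \<kappa>. norm (1 - cip z a) powr - (CARD('n) + 1 + \<kappa> + \<eta>)) \<le> C * (1 - (norm a)\<^sup>2) powr - \<eta>"
proof -
  let ?\<beta> = "CARD('n) + \<kappa> + 1"
  define s where "s = (?\<beta> + \<eta>) / 2"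
  have \<beta>: "0 < ?\<beta>" using \<kappa> by simp
  obtain C where C: "0 < C" "\<And>m. (pochhammer s m)\<^sup>2 \<le> C * (pochhammer ?\<beta> m * pochhammer \<eta> m)"
    using pochhammer_ratio_bounded[OF \<beta> \<eta>, of s] by (auto simp: s_def)
  interpret finite_measure "ball_measure \<kappa> :: (complex^'n) measure" by (rule finite_ball_measure[OF \<kappa>])
  let ?E = "CARD('n) + 1 + \<kappa> + \<eta>"
  have E: "?E = 2 * s" by (simp add: s_def)
  let ?K = "\<lambda>z a. norm (1 - cip z a) powr - ?E"
  show ?thesis
  proof
    show "0 < ball_mass TYPE('n) \<kappa> * C" using ball_mass_pos[OF \<kappa>, where 'n='n] C by simp
    fix a :: "complex^'n" assume a: "a \<in> ball 0 1"
    have lt: "norm (cip z a) \<le> norm a" if "z \<in> ball 0 1" for z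
      using norm_cip_ball[OF that, of a] by auto
    show int: "integrable (ball_measure \<kappa>) (\<lambda>z. ?K z a)"
    proof (rule integrable_const_bound)
      show "AE z in ball_measure \<kappa>. norm (?K z a) \<le> (1 - norm a) powr - ?E"
        using AE_ball_measure
      proof eventually_elim
        case (elim z)
        have "1 - norm a \<le> norm (1 - cip z a)"
          using lt[OF elim] norm_triangle_ineq2[of 1 "cip z a"] by simp
        then show ?case using a \<kappa> \<eta> by (auto intro!: powr_mono2')
      qed
    qed measurable
    let ?c = "\<lambda>m. of_real (pochhammer s m / fact m) :: complex"
    let ?m = "\<lambda>m. fact m / pochhammer ?\<beta> m"
    have le: "(pochhammer s m / fact m) * (pochhammer s m / fact m) * (norm a ^ (2 * m) * ?m m) 
      \<le> C * (pochhammer \<eta> m / fact m * (norm a ^ 2) ^ m)" for m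
    proof -
      have "(pochhammer s m)\<^sup>2 / pochhammer ?\<beta> m \<le> C * pochhammer \<eta> m"
        using C(2)[of m] pochhammer_pos[OF \<beta>, of m] by (simp add: pos_divide_le_eq mult_ac)
      then have "(pochhammer s m)\<^sup>2 / pochhammer ?\<beta> m * ((norm a ^ 2) ^ m / fact m) \<le> C * pochhammer \<eta> m * ((norm a ^ 2) ^ m / fact m)"
        by (rule mult_right_mono) simp
      then show ?thesis by (simp add: power_mult power2_eq_square power_mult_distrib mult_ac)
    qed
    have s0: "0 < s" using \<beta> \<eta> by (simp add: s_def)
    have nn: "0 \<le> (pochhammer s m / fact m) * (pochhammer s m / fact m) * (norm a ^ (2 * m) * ?m m)" for m
      using pochhammer_pos[OF s0, of m] pochhammer_pos[OF \<beta>, of m] by simp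
    have a2: "norm a ^ 2 < 1" using a by (simp add: abs_square_less_1)
    have \<eta>s: "(\<lambda>m. pochhammer \<eta> m / fact m * (norm a ^ 2) ^ m) sums ((1 - norm a ^ 2) powr - \<eta>)"
    proof -
      have "(\<lambda>m. of_real (pochhammer \<eta> m / fact m) * (of_real (norm a ^ 2)) ^ m) sums ((1 - of_real (norm a ^ 2) :: complex) powr of_real (- \<eta>))"
        by (rule binomial_series_negative) (use a2 in \<open>simp only: norm_of_real\<close>, simp)
      also have "(1 - of_real (norm a ^ 2) :: complex) powr of_real (- \<eta>) = of_real ((1 - norm a ^ 2) powr - \<eta>)"
        using a2 by (simp add: powr_of_real[symmetric])
      finally have "(\<lambda>m. of_real (pochhammer \<eta> m / fact m * (norm a ^ 2) ^ m)) sums (of_real ((1 - norm a ^ 2) powr - \<eta>) :: complex)"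
        by (simp only: of_real_mult of_real_power)
      then show ?thesis by (simp only: sums_of_real_iff)
    qed
    have csum: "summable (\<lambda>m. norm (?c m) * x ^ m)" if "0 \<le> x" "x < norm a" for x
    proof -
      have "(\<lambda>m. ?c m * of_real x ^ m) sums ((1 - of_real x) powr of_real (- s))"
        by (rule binomial_series_negative) (use that a in simp)
      then have "summable (\<lambda>m. of_real (pochhammer s m / fact m * x ^ m) :: complex)"
        by (simp only: of_real_mult of_real_power sums_summable)
      then have "summable (\<lambda>m. pochhammer s m / fact m * x ^ m)"
        by (simp only: summable_of_real_iff)
      moreover have "norm (?c m) = pochhammer s m / fact m" for m
        using pochhammer_pos[OF s0, of m] by (simp only: norm_of_real) simp
      ultimately show ?thesis by simp
    qed
    have gK: "(if z \<in> ball 0 1 then (\<Sum>m. ?c m * cip z a ^ m) * cnj (\<Sum>m. ?c m * cip z a ^ m) else 0)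
       = (if z \<in> ball 0 1 then of_real (?K z a) else 0)" for z
    proof (cases "z \<in> ball 0 1")
      case True
      have n1: "norm (cip z a) < 1" using lt[OF True] a by simp
      have "(\<Sum>m. ?c m * cip z a ^ m) = (1 - cip z a) powr of_real (- s)"
        by (rule sums_unique[symmetric, OF binomial_series_negative[OF n1]])
      moreover have "norm ((1 - cip z a) powr of_real (- s)) = norm (1 - cip z a) powr (- s)"
        by (subst norm_powr_real_powr') auto
      moreover have "(norm (1 - cip z a) powr (- s))\<^sup>2 = ?K z a"
        unfolding E by (simp add: power2_eq_square powr_add[symmetric])
      ultimately show ?thesis using True
        by (simp only: if_True complex_norm_square[symmetric])
    qed simp
    have ncc: "norm (?c m) * norm (?c m) = (pochhammer s m / fact m) * (pochhammer s m / fact m)" for m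
      by (simp only: norm_of_real abs_mult_self_eq)
    have "(\<lambda>m. ?c m * cnj (?c m) * of_real (norm a ^ (2 * m) * (ball_mass TYPE('n) \<kappa> * fact m / pochhammer ?\<beta> m)))
      sums (LINT z|ball_measure \<kappa>. (if z \<in> ball 0 1 then (\<Sum>m. ?c m * cip z a ^ m) * cnj (\<Sum>m. ?c m * cip z a ^ m) else 0))"
    proof (rule integral_ball_series[OF \<kappa> csum csum])
      show "integrable (ball_measure \<kappa>) (\<lambda>z. if z \<in> ball 0 1 then (\<Sum>m. ?c m * cip z a ^ m) * cnj (\<Sum>m. ?c m * cip z a ^ m) else 0)"
        unfolding gK
      proof (rule Bochner_Integration.integrable_bound[OF int])
        show "AE z in ball_measure \<kappa>. norm (if z \<in> ball 0 1 then of_real (?K z a) else 0 :: complex) \<le> norm (?K z a)"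
          by (intro AE_I2) auto
      qed measurable
      show "summable (\<lambda>m. norm (?c m) * norm (?c m) * (norm a ^ (2 * m) * ?m m))"
        unfolding ncc
        by (rule summable_comparison_test'[OF summable_mult[OF sums_summable[OF \<eta>s], of C]])
           (use nn le in \<open>simp only: real_norm_def abs_of_nonneg\<close>)
    qed
    also have "(LINT z|ball_measure \<kappa>. (if z \<in> ball 0 1 then (\<Sum>m. ?c m * cip z a ^ m) * cnj (\<Sum>m. ?c m * cip z a ^ m) else 0))
      = (LINT z|ball_measure \<kappa>. of_real (?K z a))"
      unfolding gK
    proof (rule integral_cong_AE)
      show "AE z in ball_measure \<kappa>. (if z \<in> ball 0 1 then of_real (?K z a) else 0) = (of_real (?K z a) :: complex)"
        using AE_ball_measure by eventually_elim simp
    qed measurable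
    finally have "(\<lambda>m. of_real (ball_mass TYPE('n) \<kappa> * ((pochhammer s m / fact m) * (pochhammer s m / fact m) * (norm a ^ (2 * m) * ?m m))))
      sums (of_real (LINT z|ball_measure \<kappa>. ?K z a) :: complex)"
      by (simp add: mult_ac)
    then have sK: "(\<lambda>m. ball_mass TYPE('n) \<kappa> * ((pochhammer s m / fact m) * (pochhammer s m / fact m) * (norm a ^ (2 * m) * ?m m)))
      sums (LINT z|ball_measure \<kappa>. ?K z a)"
      by (simp only: sums_of_real_iff)
    have "(LINT z|ball_measure \<kappa>. ?K z a) \<le> ball_mass TYPE('n) \<kappa> * (C * ((1 - norm a ^ 2) powr - \<eta>))"
      by (rule sums_le[OF _ sK sums_mult[OF sums_mult[OF \<eta>s]]])
         (rule mult_left_mono[OF le less_imp_le[OF ball_mass_pos[OF \<kappa>]]])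
    then show "(LINT z|ball_measure \<kappa>. ?K z a) \<le> ball_mass TYPE('n) \<kappa> * C * (1 - (norm a)\<^sup>2) powr - \<eta>"
      by (simp add: mult.assoc)
  qed
qed

section \<open>The reproducing formula\<close>

lemma kernel_series:
  fixes z :: complex
  assumes "norm z < 1"
  shows "(\<lambda>m. of_real (pochhammer (real N) m / fact m) * z ^ m) sums inverse ((1 - z) ^ N)"
proof -
  have "1 - z \<noteq> 0" using assms by auto
  then have "(1 - z) powr of_real (- real N) = inverse ((1 - z) ^ N)"
    by (simp add: powr_minus)
  then show ?thesis using binomial_series_negative[OF assms, of "real N"] by simp
qed

lemma power_series_ball:
  assumes hol: "\<phi> holomorphic_on ball 0 R"
  obtains c where "\<And>w. norm w < R \<Longrightarrow> (\<lambda>m. c m * w ^ m) sums \<phi> w"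
    and "\<And>x. 0 \<le> x \<Longrightarrow> x < R \<Longrightarrow> summable (\<lambda>m. norm (c m) * x ^ m)"
proof
  let ?c = "\<lambda>m. (deriv ^^ m) \<phi> 0 / fact m"
  show s: "(\<lambda>m. ?c m * w ^ m) sums \<phi> w" if "norm w < R" for w
    using holomorphic_power_series[OF hol, of w] that by simp
  show "summable (\<lambda>m. norm (?c m) * x ^ m)" if "0 \<le> x" "x < R" for x
  proof -
    let ?y = "of_real ((x + R) / 2) :: complex"
    have "norm ?y < R" using that by (simp only: norm_of_real) simp
    then have "summable (\<lambda>m. ?c m * ?y ^ m)" using s sums_summable by blast
    moreover have "norm (of_real x :: complex) < norm ?y" using that by (simp only: norm_of_real) simp
    ultimately have "summable (\<lambda>m. norm (?c m * of_real x ^ m))" by (rule powser_insidea)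
    then show ?thesis using that by (simp add: norm_mult norm_power norm_divide)
  qed
qed

text \<open>The mean value property, power series and the Schwarz lemma are applied to functions on
  the ball only along complex lines, through this lemma.\<close>

lemma holomorphic_several_slice:
  fixes f :: "complex ^ 'n \<Rightarrow> complex"
  assumes f: "holomorphic_several_on f (ball 0 1)" and "open U"
    and U: "\<And>\<zeta>. \<zeta> \<in> U \<Longrightarrow> x + \<zeta> *s y \<in> ball 0 1"
  shows "(\<lambda>\<zeta>. f (x + \<zeta> *s y)) holomorphic_on U"
  unfolding holomorphic_on_open[OF \<open>open U\<close>]
proof
  fix \<zeta> assume "\<zeta> \<in> U"
  then obtain L where L: "(f has_derivative L) (at (x + \<zeta> *s y) within ball 0 1)" and lin: "\<And>c v. L (c *s v) = c * L v"
    using f U unfolding holomorphic_several_on_def by blast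
  have L': "(f has_derivative L) (at (x + \<zeta> *s y))"
    using L at_within_open[OF U[OF \<open>\<zeta> \<in> U\<close>] open_ball] by simp
  have "bounded_linear (\<lambda>h. h *s y)"
    by (rule linear_conv_bounded_linear[THEN iffD1], rule linearI)
       (simp_all add: vec_eq_iff algebra_simps)
  then have "((\<lambda>\<zeta>. x + \<zeta> *s y) has_derivative (\<lambda>h. h *s y)) (at \<zeta>)"
    by (auto intro!: derivative_eq_intros bounded_linear_imp_has_derivative)
  from diff_chain_at[OF this L'] have "((\<lambda>\<zeta>. f (x + \<zeta> *s y)) has_derivative (\<lambda>h. h * L y)) (at \<zeta>)"
    by (simp add: o_def lin)
  then show "\<exists>f'. ((\<lambda>\<zeta>. f (x + \<zeta> *s y)) has_field_derivative f') (at \<zeta>)"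
    unfolding has_field_derivative_def
    by (intro exI[of _ "L y"]) (simp add: mult.commute[of _ "L y"])
qed

section \<open>The Bergman measure as a normalized ball measure\<close>

lemma ball_density_nat:
  "indicator {..<1} (norm z) * (1 - (norm z)\<^sup>2) powr real k = indicator (ball 0 1) z * (1 - (norm z)\<^sup>2) ^ k"
proof (cases "z \<in> ball 0 1")
  case True
  then have "0 < 1 - (norm z)\<^sup>2" by (simp add: abs_square_less_1)
  then show ?thesis using True by (simp add: powr_realpow)
qed (simp add: indicator_def)

lemma ball_mass_nat:
  "(LINT w:ball 0 1|lborel. (1 - (norm (w :: complex ^ 'n))\<^sup>2) ^ k) = ball_mass TYPE('n) (real k)"
proof -
  have *: "\<And>z::complex^'n. 0 \<le> indicator {..<1} (norm z) * (1 - (norm z)\<^sup>2) powr real k" by simp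
  show ?thesis
  unfolding ball_mass_def ball_measure_def
  by (subst integral_radial_density(2)[OF ball_density_measurable _ *])
     (auto simp: set_lebesgue_integral_def ball_density_nat)
qed

lemma sets_bergman_measure [measurable_cong, simp]: "sets (bergman_measure k) = sets borel"
  and space_bergman_measure [simp]: "space (bergman_measure k) = UNIV"
  by (simp_all add: bergman_measure_def)

lemma ball_mass_nat_pos: "0 < ball_mass TYPE('n::finite) (real k)"
  by (rule ball_mass_pos) simp

lemma bergman_measure_eq:
  "(bergman_measure k :: (complex ^ 'n) measure) = density (ball_measure (real k)) (\<lambda>_. ennreal (1 / ball_mass TYPE('n) (real k)))"
  unfolding ball_measure_def radial_measure_def bergman_measure_def ball_mass_nat
  using ball_mass_nat_pos[where 'n = 'n, of k]
  by (subst density_density_eq)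
     (auto intro!: density_cong simp: ball_density_nat ennreal_mult[symmetric] indicator_def powr_realpow abs_square_less_1)

lemma bergman_integral:
  fixes g :: "complex ^ 'n \<Rightarrow> 'b::{banach, second_countable_topology}"
  assumes [measurable]: "g \<in> borel_measurable borel"
  shows "integrable (bergman_measure k) g \<longleftrightarrow> integrable (ball_measure (real k)) g"
    and "(LINT z|bergman_measure k. g z) = (LINT z|ball_measure (real k). g z) /\<^sub>R ball_mass TYPE('n) (real k)"
proof -
  have gm: "g \<in> borel_measurable (ball_measure (real k))" by (simp cong: measurable_cong_sets)
  note p = ball_mass_nat_pos[where 'n = 'n, of k]
  show "integrable (bergman_measure k) g \<longleftrightarrow> integrable (ball_measure (real k)) g"
  proof
    assume "integrable (ball_measure (real k)) g"
    then show "integrable (bergman_measure k) g"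
      unfolding bergman_measure_eq using p by (subst integrable_density[OF gm]) auto
  next
    assume "integrable (bergman_measure k) g"
    then have "integrable (ball_measure (real k)) (\<lambda>z. (1 / ball_mass TYPE('n) (real k)) *\<^sub>R g z)"
      unfolding bergman_measure_eq using p by (subst (asm) integrable_density[OF gm]) auto
    then have "integrable (ball_measure (real k)) (\<lambda>z. ball_mass TYPE('n) (real k) *\<^sub>R ((1 / ball_mass TYPE('n) (real k)) *\<^sub>R g z))"
      by (rule integrable_scaleR_right)
    then show "integrable (ball_measure (real k)) g" using p by simp
  qed
  show "(LINT z|bergman_measure k. g z) = (LINT z|ball_measure (real k). g z) /\<^sub>R ball_mass TYPE('n) (real k)"
    unfolding bergman_measure_eq using p
    by (subst integral_density[OF gm]) (auto simp: divide_inverse)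
qed

lemma prob_space_bergman_measure: "prob_space (bergman_measure k :: (complex ^ 'n) measure)"
proof -
  interpret finite_measure "ball_measure (real k) :: (complex ^ 'n) measure"
    by (rule finite_ball_measure) simp
  have m: "measure (ball_measure (real k) :: (complex ^ 'n) measure) UNIV = ball_mass TYPE('n) (real k)"
    by (simp add: ball_mass_def)
  show ?thesis
    using ball_mass_nat_pos[where 'n = 'n, of k]
    by (intro prob_spaceI)
       (simp add: bergman_measure_eq emeasure_density nn_integral_const emeasure_eq_measure m
          ennreal_mult[symmetric] flip: ennreal_1)
qed

lemma bergman_kernel_cip:
  "bergman_kernel k (a :: complex ^ 'n) z = (if z \<in> ball 0 1 then inverse ((1 - cip z a) ^ (CARD('n) + k + 1)) else 0)"
  by (simp add: bergman_kernel_def cip_def)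

lemma measurable_bergman_kernel [measurable]: "bergman_kernel k a \<in> borel_measurable borel"
  unfolding bergman_kernel_cip[abs_def] by measurable

lemma bergman_kernel_bound:
  fixes a :: "complex ^ 'n"
  assumes a: "a \<in> ball 0 1"
  shows "norm (bergman_kernel k a z) \<le> inverse ((1 - norm a) ^ (CARD('n) + k + 1))"
proof (cases "z \<in> ball 0 1")
  case True
  have "1 - norm a \<le> norm (1 - cip z a)"
    using norm_cip_ball[OF True, of a] norm_triangle_ineq2[of 1 "cip z a"] by auto
  then have "(1 - norm a) ^ (CARD('n) + k + 1) \<le> norm (1 - cip z a) ^ (CARD('n) + k + 1)"
    using a by (intro power_mono) auto
  then show ?thesis using True a
    unfolding bergman_kernel_cip by (simp add: norm_inverse norm_power le_imp_inverse_le del: power_Suc)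
qed (use a in \<open>simp add: bergman_kernel_cip\<close>)

text \<open>Rotations about the axis a leave the kernel unchanged, and the mean value property
  replaces f z by its value at the projection \<open>P z\<close> onto the line of a. What remains is
  a power series in \<open>cip z a\<close> paired with the kernel series, whose coefficients (N)_m /
  m! cancel the moments m! / (\<beta>)_m exactly, since N = \<beta> for the weight k. The sum is
  then the power series of f along the line of a, evaluated at the point a itself.\<close>

lemma reproducing:
  fixes f :: "complex ^ 'n \<Rightarrow> complex"
  assumes hol: "holomorphic_several_on f (ball 0 1)" and off: "\<And>z. z \<notin> ball 0 1 \<Longrightarrow> f z = 0"
    and int: "integrable (bergman_measure k) f" and a: "a \<in> ball 0 1"
  shows "(LINT z|bergman_measure k. f z * cnj (bergman_kernel k a z)) = f a"
proof -
  let ?N = "CARD('n) + k + 1"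
  let ?V = "ball_mass TYPE('n) (real k)"
  define P where "P z = (cip z a / of_real ((norm a)\<^sup>2)) *s a" for z
  have [measurable]: "f \<in> borel_measurable borel"
    using borel_measurable_integrable[OF int] by (simp cong: measurable_cong_sets)
  have int': "integrable (ball_measure (real k)) f"
    using int by (simp add: bergman_integral)
  let ?g = "\<lambda>z. f z * cnj (bergman_kernel k a z)"
  \<comment> \<open>For fixed a the kernel is bounded, so integrability of f alone suffices and the
    formula serves all exponents from 1 on.\<close>
  have int_g: "integrable (ball_measure (real k)) ?g"
  proof (rule Bochner_Integration.integrable_bound)
    show "integrable (ball_measure (real k)) (\<lambda>z. inverse ((1 - norm a) ^ ?N) * norm (f z))"
      using int' by (intro integrable_mult_right integrable_norm)
    show "AE z in ball_measure (real k). norm (?g z) \<le> norm (inverse ((1 - norm a) ^ ?N) * norm (f z))"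
    proof (rule AE_I2)
      fix z
      show "norm (?g z) \<le> norm (inverse ((1 - norm a) ^ ?N) * norm (f z))"
        using mult_right_mono[OF bergman_kernel_bound[OF a, of k z], of "norm (f z)"] a
        by (simp add: norm_mult mult.commute abs_mult)
    qed
  qed measurable
  let ?h = "\<lambda>z. if z \<in> ball 0 1 then f (P z) * cnj (inverse ((1 - cip z a) ^ ?N)) else 0"
  have avg: "(LINT t|circle_measure. ?g (axis_rotation a t z)) = ?h z" for z
  proof (cases "z \<in> ball 0 1")
    case True
    have cr: "cip (axis_rotation a t z) a = cip z a" for t
      by (cases "a = 0") (auto simp: cip_axis_rotation)
    let ?\<phi> = "\<lambda>\<zeta>. f (P z + \<zeta> *s (z - P z))"
    have n: "(norm (P z + \<zeta> *s (z - P z)))\<^sup>2 = (norm (P z))\<^sup>2 + (norm \<zeta>)\<^sup>2 * (norm (z - P z))\<^sup>2" for \<zeta>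
      unfolding P_def by (rule norm_axis_slice)
    have n1: "(norm z)\<^sup>2 = (norm (P z))\<^sup>2 + (norm (z - P z))\<^sup>2" using n[of 1] by simp
    have z1: "(norm z)\<^sup>2 < 1" using True by (simp add: abs_square_less_1)
    \<comment> \<open>The mean value over the unit circle needs holomorphy on a larger disc. For
      |\<zeta>|^2 < 2 - |z|^2 the squared norm of the slice point exceeds |z|^2 by at most (1 -
      |z|^2) |z|^2, which is less than 1 - |z|^2.\<close>
    define R where "R = sqrt (2 - (norm z)\<^sup>2)"
    have R: "1 < R" "R\<^sup>2 = 2 - (norm z)\<^sup>2" using z1 by (auto simp: R_def)
    have "P z + \<zeta> *s (z - P z) \<in> ball 0 1" if "\<zeta> \<in> ball 0 R" for \<zeta>
    proof -
      have "(norm \<zeta>)\<^sup>2 < R\<^sup>2" using that by (intro power_strict_mono) auto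
      then have "((norm \<zeta>)\<^sup>2 - 1) * (norm (z - P z))\<^sup>2 \<le> (1 - (norm z)\<^sup>2) * (norm (z - P z))\<^sup>2"
        using R by (intro mult_right_mono) auto
      also have "\<dots> \<le> (1 - (norm z)\<^sup>2) * (norm z)\<^sup>2"
        using n1 z1 by (intro mult_left_mono) auto
      also have "\<dots> < (1 - (norm z)\<^sup>2) * 1"
        using z1 by (intro mult_strict_left_mono) auto
      finally have "(norm (P z + \<zeta> *s (z - P z)))\<^sup>2 < 1"
        using n[of \<zeta>] n1 by (simp add: algebra_simps)
      then show ?thesis by (simp add: abs_square_less_1)
    qed
    then have "?\<phi> holomorphic_on ball 0 R"
      by (intro holomorphic_several_slice[OF hol]) auto
    then obtain c where c: "\<And>w. norm w < R \<Longrightarrow> (\<lambda>m. c m * w ^ m) sums ?\<phi> w"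
       "\<And>x. 0 \<le> x \<Longrightarrow> x < R \<Longrightarrow> summable (\<lambda>m. norm (c m) * x ^ m)"
      by (rule power_series_ball) blast
    have "f (P z) = c 0"
      using c(1)[of 0] R powser_sums_zero_iff[of c "f (P z)"] by simp
    have "f (axis_rotation a t z) = (\<Sum>m. c m * (1 * cis t) ^ m)" for t
      using c(1)[of "cis t"] R by (simp add: sums_iff axis_rotation_def P_def)
    then have "(LINT t|circle_measure. f (axis_rotation a t z)) = f (P z)"
      using circle_coefficient[of c 1 0] c(2)[of 1] R \<open>f (P z) = c 0\<close> by simp
    then show ?thesis using True
      by (simp add: bergman_kernel_cip cr)
  qed (simp add: off)
  note st1 = integral_radial_average[OF ball_density_measurable int_g[unfolded ball_measure_def] avg, folded ball_measure_def]
  have main: "(LINT z|ball_measure (real k). ?h z) = of_real ?V * f a"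
  proof (cases "a = 0")
    case True
    have P0: "P z = 0" for z using True by (simp add: P_def)
    have "(LINT z|ball_measure (real k). ?h z) = (LINT z::complex^'n|ball_measure (real k). f 0)"
    proof (rule integral_cong_AE)
      show "AE z in ball_measure (real k). ?h z = f 0"
        using AE_ball_measure by eventually_elim (simp add: True P0)
    qed (unfold P0, measurable)
    then show ?thesis using True by (simp add: ball_mass_def scaleR_conv_of_real)
  next
    case False
    then have a0: "0 < norm a" by simp
    let ?\<phi> = "\<lambda>w. f (0 + w *s ((1 / of_real ((norm a)\<^sup>2)) *s a))"
    have "0 + w *s ((1 / of_real ((norm a)\<^sup>2)) *s a) \<in> ball 0 1" if "w \<in> ball 0 (norm a)" for w
      using that a0 by (simp add: norm_divide norm_mult norm_power power2_eq_square divide_simps)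
    then have "?\<phi> holomorphic_on ball 0 (norm a)"
      by (intro holomorphic_several_slice[OF hol]) auto
    then obtain c where c: "\<And>w. norm w < norm a \<Longrightarrow> (\<lambda>m. c m * w ^ m) sums ?\<phi> w"
       "\<And>x. 0 \<le> x \<Longrightarrow> x < norm a \<Longrightarrow> summable (\<lambda>m. norm (c m) * x ^ m)"
      by (rule power_series_ball) blast
    let ?d = "\<lambda>m. of_real (pochhammer (real ?N) m / fact m) :: complex"
    let ?\<beta> = "real CARD('n) + real k + 1"
    have \<beta>: "real ?N = ?\<beta>" by simp
    have pp: "pochhammer ?\<beta> m > 0" for m by (rule pochhammer_pos) simp
    have nd: "norm (?d m) = pochhammer ?\<beta> m / fact m" for m
      using pp[of m] by (simp only: norm_of_real \<beta>) simp
    have dsum: "summable (\<lambda>m. norm (?d m) * x ^ m)" if "0 \<le> x" "x < 1" for x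
    proof -
      have "(\<lambda>m. ?d m * of_real x ^ m) sums inverse ((1 - of_real x) ^ ?N)"
        by (rule kernel_series) (use that in simp)
      then have "summable (\<lambda>m. of_real (pochhammer (real ?N) m / fact m * x ^ m) :: complex)"
        by (simp only: of_real_mult of_real_power sums_summable)
      then have "summable (\<lambda>m. pochhammer (real ?N) m / fact m * x ^ m)"
        by (simp only: summable_of_real_iff)
      then have "summable (\<lambda>m. pochhammer ?\<beta> m / fact m * x ^ m)" unfolding \<beta> .
      then show ?thesis by (simp only: nd)
    qed
    have hs: "?h z = (if z \<in> ball 0 1 then (\<Sum>m. c m * cip z a ^ m) * cnj (\<Sum>m. ?d m * cip z a ^ m) else 0)" for z
    proof (cases "z \<in> ball 0 1")
      case True
      have lt: "norm (cip z a) < norm a" using norm_cip_ball[OF True, of a] a0 by auto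
      then have "(\<Sum>m. c m * cip z a ^ m) = f (P z)"
        using c(1)[OF lt] by (simp add: sums_iff P_def vec_eq_iff)
      moreover have "(\<Sum>m. ?d m * cip z a ^ m) = inverse ((1 - cip z a) ^ ?N)"
        by (rule sums_unique[symmetric, OF kernel_series]) (use lt a in auto)
      ultimately show ?thesis using True by (simp only: if_True)
    qed simp
    \<comment> \<open>The parameter w = |a|^2 corresponds to the point a on the line and lies inside
      the disc of radius |a| where the series converges.\<close>
    have a2: "norm (of_real ((norm a)\<^sup>2) :: complex) < norm a"
      using a a0 by (simp only: norm_of_real) (simp add: power2_eq_square)
    have a2': "(norm a)\<^sup>2 < norm a" using a a0 by (simp add: power2_eq_square)
    have "(\<lambda>m. c m * cnj (?d m) * of_real (norm a ^ (2 * m) * (ball_mass TYPE('n) (real k) * fact m / pochhammer ?\<beta> m)))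
      sums (LINT z|ball_measure (real k). (if z \<in> ball 0 1 then (\<Sum>m. c m * cip z a ^ m) * cnj (\<Sum>m. ?d m * cip z a ^ m) else 0))"
    proof (rule integral_ball_series)
      show "integrable (ball_measure (real k)) (\<lambda>z. if z \<in> ball 0 1 then (\<Sum>m. c m * cip z a ^ m) * cnj (\<Sum>m. ?d m * cip z a ^ m) else 0)"
        using st1(1) unfolding hs .
      have "norm (c m) * norm (?d m) * (norm a ^ (2 * m) * (fact m / pochhammer ?\<beta> m)) = norm (c m) * ((norm a)\<^sup>2) ^ m" for m
        unfolding nd using pp[of m] by (simp add: power_mult)
      then show "summable (\<lambda>m. norm (c m) * norm (?d m) * (norm a ^ (2 * m) * (fact m / pochhammer ?\<beta> m)))"
        using c(2)[OF _ a2'] by (simp only:) simp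
      show "summable (\<lambda>m. norm (c m) * x ^ m)" if "0 \<le> x" "x < norm a" for x
        using c(2) that by blast
      show "summable (\<lambda>m. norm (?d m) * x ^ m)" if "0 \<le> x" "x < norm a" for x
        using dsum that a by simp
    qed simp
    also have "(\<lambda>m. c m * cnj (?d m) * of_real (norm a ^ (2 * m) * (ball_mass TYPE('n) (real k) * fact m / pochhammer ?\<beta> m)))
      = (\<lambda>m. of_real ?V * (c m * of_real ((norm a)\<^sup>2) ^ m))"
    proof
      fix m
      have "pochhammer ?\<beta> m / fact m * (norm a ^ (2 * m) * (ball_mass TYPE('n) (real k) * fact m / pochhammer ?\<beta> m)) = ?V * ((norm a)\<^sup>2) ^ m"
        using pp[of m] by (simp add: power_mult)
      then have "(of_real (pochhammer ?\<beta> m / fact m) * of_real (norm a ^ (2 * m) * (ball_mass TYPE('n) (real k) * fact m / pochhammer ?\<beta> m)) :: complex) = of_real ?V * of_real ((norm a)\<^sup>2) ^ m"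
        by (metis of_real_mult of_real_power)
      then show "c m * cnj (?d m) * of_real (norm a ^ (2 * m) * (ball_mass TYPE('n) (real k) * fact m / pochhammer ?\<beta> m)) = of_real ?V * (c m * of_real ((norm a)\<^sup>2) ^ m)"
        unfolding \<beta> complex_cnj_complex_of_real by (simp only: mult.assoc) (simp only: mult.left_commute)
    qed
    finally have "(\<lambda>m. of_real ?V * (c m * of_real ((norm a)\<^sup>2) ^ m)) sums (LINT z|ball_measure (real k). ?h z)"
      unfolding hs .
    moreover have "(\<lambda>m. of_real ?V * (c m * of_real ((norm a)\<^sup>2) ^ m)) sums (of_real ?V * f a)"
    proof -
      have "0 + of_real ((norm a)\<^sup>2) *s ((1 / of_real ((norm a)\<^sup>2)) *s a) = a"
        using a0 by (simp add: vec_eq_iff)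
      then show ?thesis using sums_mult[OF c(1)[OF a2], of "of_real ?V"] by simp
    qed
    ultimately show ?thesis by (rule sums_unique2)
  qed
  have "(LINT z|bergman_measure k. ?g z) = (LINT z|ball_measure (real k). ?g z) /\<^sub>R ?V"
    by (rule bergman_integral) measurable
  also have "\<dots> = f a"
    unfolding st1(2) main using ball_mass_nat_pos[where 'n = 'n, of k] by (simp add: scaleR_conv_of_real)
  finally show ?thesis .
qed

section \<open>Bergman spaces and kernel norms\<close>

lemma Holder_integral:
  fixes f g :: "'a \<Rightarrow> real"
  assumes p: "1 < p" "1 < q" "1 / p + 1 / q = 1"
    and [measurable]: "f \<in> borel_measurable M" "g \<in> borel_measurable M"
    and nn: "\<And>x. 0 \<le> f x" "\<And>x. 0 \<le> g x"
    and f: "integrable M (\<lambda>x. f x powr p)" and g: "integrable M (\<lambda>x. g x powr q)"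
  shows "integrable M (\<lambda>x. f x * g x)"
    and "(LINT x|M. f x * g x) \<le> (LINT x|M. f x powr p) powr (1 / p) * (LINT x|M. g x powr q) powr (1 / q)"
proof -
  have young: "a * b \<le> a powr p / p + b powr q / q" if "0 \<le> a" "0 \<le> b" for a b :: real
    using Youngs_inequality[of p q a b] p that by simp
  show int: "integrable M (\<lambda>x. f x * g x)"
  proof (rule Bochner_Integration.integrable_bound)
    show "integrable M (\<lambda>x. f x powr p / p + g x powr q / q)" using f g by simp
    show "AE x in M. norm (f x * g x) \<le> norm (f x powr p / p + g x powr q / q)"
      using young nn p by (intro AE_I2) (simp add: abs_of_nonneg)
  qed simp
  define F where "F = (LINT x|M. f x powr p)"
  define G where "G = (LINT x|M. g x powr q)"
  have F0: "0 \<le> F" and G0: "0 \<le> G" by (auto simp: F_def G_def)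
  show "(LINT x|M. f x * g x) \<le> (LINT x|M. f x powr p) powr (1 / p) * (LINT x|M. g x powr q) powr (1 / q)"
    unfolding F_def[symmetric] G_def[symmetric]
  proof (cases "F = 0 \<or> G = 0")
    case True
    have "AE x in M. f x powr p = 0" if "F = 0"
      using that integral_nonneg_eq_0_iff_AE[OF f] by (simp add: F_def)
    moreover have "AE x in M. g x powr q = 0" if "G = 0"
      using that integral_nonneg_eq_0_iff_AE[OF g] by (simp add: G_def)
    ultimately have "AE x in M. f x * g x = 0" using True by auto
    then have "(LINT x|M. f x * g x) = 0" by (rule integral_eq_zero_AE)
    then show "(LINT x|M. f x * g x) \<le> F powr (1 / p) * G powr (1 / q)" by simp
  next
    case False
    then have pos: "0 < F" "0 < G" using F0 G0 by auto
    let ?a = "F powr (1 / p)" let ?b = "G powr (1 / q)"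
    have ab: "0 < ?a" "0 < ?b" using pos by auto
    have "(LINT x|M. f x * g x) / (?a * ?b) = (LINT x|M. (f x / ?a) * (g x / ?b))"
      by simp
    also have "\<dots> \<le> (LINT x|M. f x powr p / F / p + g x powr q / G / q)"
    proof (rule integral_mono)
      show "integrable M (\<lambda>x. (f x / ?a) * (g x / ?b))" using int by simp
      show "integrable M (\<lambda>x. f x powr p / F / p + g x powr q / G / q)" using f g by simp
      fix x
      have "(f x / ?a) powr p = f x powr p / F" "(g x / ?b) powr q = g x powr q / G"
        using nn pos p by (auto simp: powr_divide powr_powr)
      then show "(f x / ?a) * (g x / ?b) \<le> f x powr p / F / p + g x powr q / G / q"
        using young[of "f x / ?a" "g x / ?b"] nn ab by simp
    qed
    also have "\<dots> = 1 / p + 1 / q"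
      using f g pos by (simp add: F_def[symmetric] G_def[symmetric])
    finally show "(LINT x|M. f x * g x) \<le> ?a * ?b"
      using ab p(3) by (simp add: pos_divide_le_eq)
  qed
qed

lemma Holder_sum:
  fixes f g :: "'a \<Rightarrow> real"
  assumes p: "1 < p" "1 < q" "1 / p + 1 / q = 1" and "finite A"
    and nn: "\<And>x. 0 \<le> f x" "\<And>x. 0 \<le> g x"
  shows "(\<Sum>x\<in>A. f x * g x) \<le> (\<Sum>x\<in>A. f x powr p) powr (1 / p) * (\<Sum>x\<in>A. g x powr q) powr (1 / q)"
  using Holder_integral(2)[OF p, of f "count_space A" g] \<open>finite A\<close> nn
  by (simp add: lebesgue_integral_count_space_finite integrable_count_space)

section \<open>Holomorphic functions on the ball and their integrability\<close>

lemma holomorphic_several_continuous: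
  assumes "holomorphic_several_on f U"
  shows "continuous_on U f"
  using assms unfolding holomorphic_several_on_def
  by (meson continuous_on_eq_continuous_within has_derivative_continuous)

lemma holomorphic_several_measurable:
  fixes f :: "complex ^ 'n \<Rightarrow> complex"
  assumes "holomorphic_several_on f (ball 0 1)" "\<And>z. z \<notin> ball 0 1 \<Longrightarrow> f z = 0"
  shows "f \<in> borel_measurable borel"
proof -
  have "(\<lambda>x. indicator (ball 0 1) x *\<^sub>R f x) \<in> borel_measurable borel"
    by (intro borel_measurable_continuous_on_indicator holomorphic_several_continuous assms) simp
  also have "(\<lambda>x. indicator (ball 0 1) x *\<^sub>R f x) = f"
    using assms(2) by (auto simp: indicator_def)
  finally show ?thesis .
qed

lemma holomorphic_several_mult:
  assumes "holomorphic_several_on f U" "holomorphic_several_on g U"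
  shows "holomorphic_several_on (\<lambda>z. f z * g z) U"
  unfolding holomorphic_several_on_def
proof
  fix z assume "z \<in> U"
  then obtain F G where F: "(f has_derivative F) (at z within U)" "\<And>c v. F (c *s v) = c * F v"
    and G: "(g has_derivative G) (at z within U)" "\<And>c v. G (c *s v) = c * G v"
    using assms unfolding holomorphic_several_on_def by blast
  show "\<exists>L. ((\<lambda>z. f z * g z) has_derivative L) (at z within U) \<and> (\<forall>c v. L (c *s v) = c * L v)"
    by (rule exI, rule conjI, rule has_derivative_mult[OF F(1) G(1)])
       (simp add: F G algebra_simps)
qed

lemma holomorphic_several_const: "holomorphic_several_on (\<lambda>z. c) U"
  unfolding holomorphic_several_on_def
  by (auto intro!: exI[of _ "\<lambda>_. 0"] derivative_eq_intros)

lemma holomorphic_several_add: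
  assumes "holomorphic_several_on f U" "holomorphic_several_on g U"
  shows "holomorphic_several_on (\<lambda>z. f z + g z) U"
  unfolding holomorphic_several_on_def
proof
  fix z assume "z \<in> U"
  then obtain F G where F: "(f has_derivative F) (at z within U)" "\<And>c v. F (c *s v) = c * F v"
    and G: "(g has_derivative G) (at z within U)" "\<And>c v. G (c *s v) = c * G v"
    using assms unfolding holomorphic_several_on_def by blast
  show "\<exists>L. ((\<lambda>z. f z + g z) has_derivative L) (at z within U) \<and> (\<forall>c v. L (c *s v) = c * L v)"
    by (rule exI, rule conjI, rule has_derivative_add[OF F(1) G(1)])
       (simp add: F G algebra_simps)
qed

lemma holomorphic_several_sum:
  assumes "\<And>i. i \<in> A \<Longrightarrow> holomorphic_several_on (f i) U"
  shows "holomorphic_several_on (\<lambda>z. \<Sum>i\<in>A. f i z) U"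
  using assms
  by (induction A rule: infinite_finite_induct) (auto intro: holomorphic_several_const holomorphic_several_add)

lemma holomorphic_bergman_kernel:
  fixes a :: "complex ^ 'n"
  assumes a: "a \<in> ball 0 1"
  shows "holomorphic_several_on (bergman_kernel k a) (ball 0 1)"
  unfolding holomorphic_several_on_def
proof
  fix z :: "complex ^ 'n" assume z: "z \<in> ball 0 1"
  let ?N = "CARD('n) + k + 1"
  have n0: "1 - cip z a \<noteq> 0"
    using norm_cip_ball[OF z, of a] a by auto
  have "(\<lambda>w. inverse ((1 - w) ^ ?N)) field_differentiable at (cip z a)"
    using n0 by (intro derivative_intros field_differentiable_inverse field_differentiable_power) auto
  then obtain d where d: "((\<lambda>w. inverse ((1 - w) ^ ?N)) has_field_derivative d) (at (cip z a))"
    unfolding field_differentiable_def by blast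
  have "bounded_linear (\<lambda>h. cip h a)"
    by (rule linear_conv_bounded_linear[THEN iffD1], rule linearI) (simp_all add: cip_add_left scaleR_conv_of_real[where 'a=complex])
  then have "((\<lambda>z. cip z a) has_derivative (\<lambda>h. cip h a)) (at z)"
    by (rule bounded_linear_imp_has_derivative)
  from diff_chain_at[OF this d[unfolded has_field_derivative_def]]
  have "((\<lambda>z. inverse ((1 - cip z a) ^ ?N)) has_derivative (\<lambda>h. d * cip h a)) (at z within ball 0 1)"
    by (simp add: o_def has_derivative_at_withinI)
  then have "(bergman_kernel k a has_derivative (\<lambda>h. d * cip h a)) (at z within ball 0 1)"
    by (rule has_derivative_transform[rotated 2]) (use z in \<open>auto simp: bergman_kernel_cip\<close>)
  then show "\<exists>L. (bergman_kernel k a has_derivative L) (at z within ball 0 1) \<and> (\<forall>c v. L (c *s v) = c * L v)"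
    by (intro exI[of _ "\<lambda>h. d * cip h a"]) simp
qed

lemma integrable_bergman_bounded:
  fixes f :: "complex ^ 'n \<Rightarrow> 'b::{banach, second_countable_topology}"
  assumes "f \<in> borel_measurable borel" "\<And>z. norm (f z) \<le> B"
  shows "integrable (bergman_measure k) f"
proof -
  interpret prob_space "bergman_measure k :: (complex ^ 'n) measure" by (rule prob_space_bergman_measure)
  show ?thesis by (rule integrable_const_bound[of _ B]) (use assms in \<open>auto cong: measurable_cong_sets\<close>)
qed

definition hol_ball :: "(complex ^ 'n \<Rightarrow> complex) \<Rightarrow> bool" where
  "hol_ball f \<longleftrightarrow> holomorphic_several_on f (ball 0 1) \<and> (\<forall>z. z \<notin> ball 0 1 \<longrightarrow> f z = 0)"

lemma bergman_space_iff:
  "f \<in> bergman_space k p \<longleftrightarrow> hol_ball f \<and> integrable (bergman_measure k) (\<lambda>z. norm (f z) powr p)"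
  by (auto simp: bergman_space_def hol_ball_def)

lemma hol_ball_measurable: "hol_ball f \<Longrightarrow> f \<in> borel_measurable borel"
  unfolding hol_ball_def by (intro holomorphic_several_measurable) auto

lemma hol_ball_mult: "hol_ball f \<Longrightarrow> hol_ball g \<Longrightarrow> hol_ball (\<lambda>z. f z * g z)"
  unfolding hol_ball_def by (auto intro: holomorphic_several_mult)

lemma hol_ball_cmult: "hol_ball f \<Longrightarrow> hol_ball (\<lambda>z. c * f z)"
  unfolding hol_ball_def by (auto intro: holomorphic_several_mult holomorphic_several_const)

lemma hol_ball_add: "hol_ball f \<Longrightarrow> hol_ball g \<Longrightarrow> hol_ball (\<lambda>z. f z + g z)"
  unfolding hol_ball_def by (auto intro: holomorphic_several_add)

lemma hol_ball_bergman_kernel: "a \<in> ball 0 1 \<Longrightarrow> hol_ball (bergman_kernel k a)"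
  unfolding hol_ball_def by (auto intro: holomorphic_bergman_kernel simp: bergman_kernel_cip)

lemma bergman_kernel_in_space:
  fixes a :: "complex ^ 'n"
  assumes "a \<in> ball 0 1" "0 < r"
  shows "bergman_kernel k a \<in> bergman_space k r"
  unfolding bergman_space_iff
proof
  show "integrable (bergman_measure k) (\<lambda>z. norm (bergman_kernel k a z) powr r)"
  proof (rule integrable_bergman_bounded)
    show "norm (norm (bergman_kernel k a z) powr r) \<le> inverse ((1 - norm a) ^ (CARD('n) + k + 1)) powr r" for z
      using powr_mono2[OF less_imp_le[OF assms(2)] _ bergman_kernel_bound[OF assms(1), of k z]] by simp
  qed measurable
qed (rule hol_ball_bergman_kernel[OF assms(1)])

lemma bergman_norm_nonneg: "0 \<le> bergman_norm k p f"
  by (simp add: bergman_norm_def)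

lemma integral_bergman_norm:
  assumes "0 < p"
  shows "(LINT z|bergman_measure k. norm (f z) powr p) = bergman_norm k p f powr p"
  using assms by (simp add: bergman_norm_def powr_powr integral_nonneg)

lemma bergman_Holder:
  fixes f g :: "complex ^ 'n \<Rightarrow> complex"
  assumes p: "1 < p" "1 < q" "1 / p + 1 / q = 1"
    and f: "f \<in> bergman_space k p" and g: "g \<in> bergman_space k q"
  shows "integrable (bergman_measure k) (\<lambda>z. f z * g z)"
    and "integrable (bergman_measure k) (\<lambda>z. f z * cnj (g z))"
    and "norm (LINT z|bergman_measure k. f z * cnj (g z)) \<le> bergman_norm k p f * bergman_norm k q g"
proof -
  have [measurable]: "f \<in> borel_measurable borel" "g \<in> borel_measurable borel"
    using f g by (auto simp: bergman_space_iff hol_ball_measurable)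
  have i: "integrable (bergman_measure k) (\<lambda>z. norm (f z) * norm (g z))"
    and le: "(LINT z|bergman_measure k. norm (f z) * norm (g z)) \<le> bergman_norm k p f * bergman_norm k q g"
    using Holder_integral[OF p, of "\<lambda>z. norm (f z)" "bergman_measure k" "\<lambda>z. norm (g z)"] f g
    by (auto simp: bergman_space_iff bergman_norm_def)
  show "integrable (bergman_measure k) (\<lambda>z. f z * g z)"
    by (rule Bochner_Integration.integrable_bound[OF i]) (auto simp: norm_mult)
  show "integrable (bergman_measure k) (\<lambda>z. f z * cnj (g z))"
    by (rule Bochner_Integration.integrable_bound[OF i]) (auto simp: norm_mult)
  have "norm (LINT z|bergman_measure k. f z * cnj (g z)) \<le> (LINT z|bergman_measure k. norm (f z * cnj (g z)))"
    by (rule integral_norm_bound)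
  then show "norm (LINT z|bergman_measure k. f z * cnj (g z)) \<le> bergman_norm k p f * bergman_norm k q g"
    using le by (simp add: norm_mult)
qed

lemma bergman_space_integrable:
  fixes f :: "complex ^ 'n \<Rightarrow> complex"
  assumes "1 \<le> p" "f \<in> bergman_space k p"
  shows "integrable (bergman_measure k) f"
proof -
  interpret prob_space "bergman_measure k :: (complex ^ 'n) measure" by (rule prob_space_bergman_measure)
  have [measurable]: "f \<in> borel_measurable borel"
    using assms by (auto simp: bergman_space_iff hol_ball_measurable)
  show ?thesis
  proof (rule Bochner_Integration.integrable_bound)
    show "integrable (bergman_measure k) (\<lambda>z. 1 + norm (f z) powr p)"
      using assms by (auto simp: bergman_space_iff)
    have "norm (f z) \<le> 1 + norm (f z) powr p" for z
    proof (cases "norm (f z) \<le> 1")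
      case False
      then have "norm (f z) powr 1 \<le> norm (f z) powr p" using assms by (intro powr_mono) auto
      then show ?thesis using False by simp
    qed (simp add: add_increasing2)
    then show "AE z in bergman_measure k. norm (f z) \<le> norm (1 + norm (f z) powr p)"
      by (intro AE_I2) (simp add: abs_of_nonneg)
  qed (auto cong: measurable_cong_sets)
qed

lemma bergman_reproducing:
  assumes "1 \<le> p" "f \<in> bergman_space k p" "a \<in> ball 0 1"
  shows "bergman_pairing k f (bergman_kernel k a) = f a"
  unfolding bergman_pairing_def
  using assms bergman_space_integrable[OF assms(1,2)]
  by (intro reproducing) (auto simp: bergman_space_iff hol_ball_def)

text \<open>The upper bound is the Forelli-Rudin estimate with \<eta> = N r - N. The lower bound
  follows from it by duality: k_a(a) = <k_a, k_a> is at most the product of the norms with exponents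
  r and r', and the second factor is already bounded above.\<close>

lemma bergman_kernel_norm_estimate:
  fixes r :: real
  assumes r: "1 < r"
  obtains c C where "0 < c" "0 < C"
    "\<And>a::complex ^ 'n. a \<in> ball 0 1 \<Longrightarrow>
       c * (1 - (norm a)\<^sup>2) powr - (real (CARD('n) + k + 1) * (1 - 1 / r)) \<le> bergman_norm k r (bergman_kernel k a)"
    "\<And>a::complex ^ 'n. a \<in> ball 0 1 \<Longrightarrow>
       bergman_norm k r (bergman_kernel k a) \<le> C * (1 - (norm a)\<^sup>2) powr - (real (CARD('n) + k + 1) * (1 - 1 / r))"
proof -
  let ?N = "real (CARD('n) + k + 1)"
  have upper: "\<exists>C>0. \<forall>a::complex ^ 'n. a \<in> ball 0 1 \<longrightarrow>
       bergman_norm k r (bergman_kernel k a) \<le> C * (1 - (norm a)\<^sup>2) powr - (?N * (1 - 1 / r))" if r: "1 < r" for r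
  proof -
    let ?V = "ball_mass TYPE('n) (real k)"
    have V: "0 < ?V" by (rule ball_mass_nat_pos)
    have \<eta>: "0 < ?N * r - ?N" using r by simp
    have k1: "-1 < real k" by simp
    obtain C where C: "0 < C"
      "\<And>a::complex^'n. a \<in> ball 0 1 \<Longrightarrow>
       (LINT z|ball_measure (real k). norm (1 - cip z a) powr - (CARD('n) + 1 + real k + (?N * r - ?N))) \<le> C * (1 - (norm a)\<^sup>2) powr - (?N * r - ?N)"
      by (rule forelli_rudin[OF k1 \<eta>, where 'n = 'n]) blast
    show ?thesis
    proof (intro exI conjI allI impI)
      show "0 < (C / ?V) powr (1 / r)" using C V by simp
      fix a :: "complex ^ 'n" assume a: "a \<in> ball 0 1"
      have w: "0 < 1 - (norm a)\<^sup>2" using a by (simp add: abs_square_less_1)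
      have "(LINT z|bergman_measure k. norm (bergman_kernel k a z) powr r) = (LINT z|ball_measure (real k). norm (bergman_kernel k a z) powr r) / ?V"
        by (subst bergman_integral) (auto simp: divide_inverse)
      also have "(LINT z|ball_measure (real k). norm (bergman_kernel k a z) powr r)
        = (LINT z|ball_measure (real k). norm (1 - cip z a) powr - (CARD('n) + 1 + real k + (?N * r - ?N)))"
      proof (rule integral_cong_AE)
        show "AE z in ball_measure (real k). norm (bergman_kernel k a z) powr r = norm (1 - cip z a) powr - (CARD('n) + 1 + real k + (?N * r - ?N))"
          using AE_ball_measure
        proof eventually_elim
          case (elim z)
          have "0 < norm (1 - cip z a)" using norm_cip_ball[OF elim, of a] a by auto
          moreover have "norm (bergman_kernel k a z) = inverse (norm (1 - cip z a) ^ (CARD('n) + k + 1))"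
            using elim by (simp add: bergman_kernel_cip norm_inverse norm_power norm_mult)
          ultimately have "norm (bergman_kernel k a z) = norm (1 - cip z a) powr (- ?N)"
            by (simp only: powr_realpow[symmetric] powr_minus[symmetric])
          then have "norm (bergman_kernel k a z) powr r = norm (1 - cip z a) powr (- ?N * r)"
            by (simp only: powr_powr)
          also have "- ?N * r = - (CARD('n) + 1 + real k + (?N * r - ?N))" by (simp add: algebra_simps)
          finally show ?case .
        qed
      qed measurable
      also have "\<dots> / ?V \<le> C * (1 - (norm a)\<^sup>2) powr - (?N * r - ?N) / ?V"
        using C(2)[OF a] V by (intro divide_right_mono) auto
      finally have "(LINT z|bergman_measure k. norm (bergman_kernel k a z) powr r) powr (1 / r) \<le> (C * (1 - (norm a)\<^sup>2) powr - (?N * r - ?N) / ?V) powr (1 / r)"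
        using r by (intro powr_mono2) auto
      also have "\<dots> = (C / ?V) powr (1 / r) * (1 - (norm a)\<^sup>2) powr (- (?N * r - ?N) * (1 / r))"
        using C V w by (simp add: powr_mult powr_divide powr_powr)
      also have "- (?N * r - ?N) * (1 / r) = - (?N * (1 - 1 / r))"
        using r by (simp add: field_simps)
      finally show "bergman_norm k r (bergman_kernel k a) \<le> (C / ?V) powr (1 / r) * (1 - (norm a)\<^sup>2) powr - (?N * (1 - 1 / r))"
        by (simp only: bergman_norm_def)
    qed
  qed
  define r' where "r' = r / (r - 1)"
  have r': "1 < r'" "1 / r + 1 / r' = 1" using r by (auto simp: r'_def field_simps)
  obtain C where C: "0 < C" "\<And>a::complex ^ 'n. a \<in> ball 0 1 \<Longrightarrow> bergman_norm k r (bergman_kernel k a) \<le> C * (1 - (norm a)\<^sup>2) powr - (?N * (1 - 1 / r))"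
    using upper[OF r] by blast
  obtain C' where C': "0 < C'" "\<And>a::complex ^ 'n. a \<in> ball 0 1 \<Longrightarrow> bergman_norm k r' (bergman_kernel k a) \<le> C' * (1 - (norm a)\<^sup>2) powr - (?N * (1 - 1 / r'))"
    using upper[OF r'(1)] by blast
  show ?thesis
  proof (rule that[of "1 / C'" C])
    fix a :: "complex ^ 'n" assume a: "a \<in> ball 0 1"
    have w: "0 < 1 - (norm a)\<^sup>2" using a by (simp add: abs_square_less_1)
    let ?K = "bergman_kernel k a"
    let ?w = "1 - (norm a)\<^sup>2"
    have K: "?K \<in> bergman_space k s" if "0 < s" for s using bergman_kernel_in_space[OF a that] .
    have "bergman_pairing k ?K ?K = ?K a"
      by (rule bergman_reproducing[OF _ _ a, of 1]) (auto intro: K)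
    moreover have "norm (bergman_pairing k ?K ?K) \<le> bergman_norm k r ?K * bergman_norm k r' ?K"
      unfolding bergman_pairing_def
      by (rule bergman_Holder(3)) (use r r' K in auto)
    moreover have "norm (?K a) = ?w powr - ?N"
    proof -
      have "1 - cip a a = of_real ?w" by (simp add: cip_self)
      then have "norm (1 - cip a a) = ?w" using w by (simp only: norm_of_real)
      then have "norm (?K a) = inverse (?w ^ (CARD('n) + k + 1))"
        using a by (simp add: bergman_kernel_cip norm_inverse norm_power norm_mult)
      then show ?thesis using w by (simp only: powr_realpow[symmetric] powr_minus[symmetric])
    qed
    ultimately have "?w powr - ?N \<le> bergman_norm k r ?K * bergman_norm k r' ?K" by simp
    also have "\<dots> \<le> bergman_norm k r ?K * (C' * ?w powr - (?N * (1 - 1 / r')))"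
      by (intro mult_left_mono C' a bergman_norm_nonneg)
    finally have "?w powr - ?N * ?w powr (?N * (1 - 1 / r')) \<le> bergman_norm k r ?K * (C' * ?w powr - (?N * (1 - 1 / r'))) * ?w powr (?N * (1 - 1 / r'))"
      by (rule mult_right_mono) simp
    moreover have "?w powr - (?N * (1 - 1 / r')) * ?w powr (?N * (1 - 1 / r')) = 1"
      using w by (simp add: powr_add[symmetric])
    moreover have "?w powr - ?N * ?w powr (?N * (1 - 1 / r')) = ?w powr - (?N * (1 - 1 / r))"
    proof -
      have e: "1 - 1 / r' = 1 / r" using r'(2) by simp
      show ?thesis unfolding e powr_add[symmetric] by (simp add: algebra_simps)
    qed
    ultimately have "?w powr - (?N * (1 - 1 / r)) \<le> C' * bergman_norm k r ?K"
      by (simp add: mult_ac)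
    then show "1 / C' * ?w powr - (?N * (1 - 1 / r)) \<le> bergman_norm k r ?K"
      using C'(1) by (simp add: field_simps)
  qed (use C C' in auto)
qed

section \<open>Nonisotropic boxes and separation\<close>

abbreviation wt :: "complex ^ 'n \<Rightarrow> real" where
  "wt a \<equiv> 1 - (norm a)\<^sup>2"

lemma wt_pos: "a \<in> ball 0 1 \<Longrightarrow> 0 < wt a"
  by (simp add: abs_square_less_1)

lemma borel_measurable_smult [measurable (raw)]:
  fixes g :: "_ \<Rightarrow> complex ^ 'n"
  assumes "f \<in> borel_measurable M" "g \<in> borel_measurable M"
  shows "(\<lambda>x. f x *s g x) \<in> borel_measurable M"
proof -
  have "(\<lambda>p. fst p *s snd p) \<in> borel_measurable (borel :: (complex \<times> (complex ^ 'n)) measure)"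
    by (intro borel_measurable_continuous_onI continuous_intros)
  from borel_measurable_Pair[OF assms, THEN measurable_compose, OF this]
  show ?thesis by simp
qed

text \<open>A set of displacements, not of points: of size \<open>sqrt (wt a)\<close> overall, but
  only \<open>wt a\<close> in the direction of a. Translated to a, it stands in for a small ball of
  the Bergman metric, described by inequalities that need no automorphism of the ball.\<close>

definition kbox :: "real \<Rightarrow> complex ^ 'n \<Rightarrow> (complex ^ 'n) set" where
  "kbox \<delta> a = {v. norm v < \<delta> * sqrt (wt a) \<and> norm (cip v a) < \<delta> * wt a}"

lemma kbox_measurable [measurable]: "Measurable.pred borel (\<lambda>v. v \<in> kbox \<delta> a)"
  unfolding kbox_def mem_Collect_eq by measurable

lemma kbox_mono: "\<delta> \<le> \<epsilon> \<Longrightarrow> a \<in> ball 0 1 \<Longrightarrow> kbox \<delta> a \<subseteq> kbox \<epsilon> a"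
  using wt_pos[of a] unfolding kbox_def
  by (auto intro: less_le_trans mult_right_mono)

lemma kbox_norm_sq:
  assumes "a \<in> ball 0 1" "v \<in> kbox \<delta> a"
  shows "(norm v)\<^sup>2 \<le> \<delta>\<^sup>2 * wt a"
proof -
  have "(norm v)\<^sup>2 \<le> (\<delta> * sqrt (wt a))\<^sup>2"
    using assms by (intro power_mono) (auto simp: kbox_def)
  then show ?thesis using wt_pos[OF assms(1)] by (simp add: power_mult_distrib)
qed

text \<open>\<open>wt (a + v)\<close> differs from \<open>wt a\<close> by 2 Re <a, v> + |v|^2, and
  for \<delta> \<le> 1/8 the two terms together are at most (1/4 + 1/64) \<open>wt a\<close> in
  modulus.\<close>

lemma kbox_wt:
  assumes a: "a \<in> ball 0 1" and \<delta>: "0 < \<delta>" "\<delta> \<le> 1 / 8" and v: "v \<in> kbox \<delta> a"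
  shows "wt a / 2 \<le> wt (a + v)" "wt (a + v) \<le> 2 * wt a" "a + v \<in> ball 0 1"
proof -
  note w = wt_pos[OF a]
  have "\<bar>Re (cip a v)\<bar> \<le> norm (cip v a)" 
    using abs_Re_le_cmod[of "cip a v"] by (simp add: norm_cip_commute)
  also have "\<dots> \<le> \<delta> * wt a" using v by (simp add: kbox_def)
  also have "\<dots> \<le> 1 / 8 * wt a" using \<delta> w by (intro mult_right_mono) auto
  finally have 1: "\<bar>Re (cip a v)\<bar> \<le> wt a / 8" by simp
  have "\<delta>\<^sup>2 \<le> (1 / 8)\<^sup>2" using \<delta> by (intro power_mono) auto
  then have "\<delta>\<^sup>2 * wt a \<le> 1 / 64 * wt a" using w by (intro mult_right_mono) (auto simp: power2_eq_square)
  then have 2: "(norm v)\<^sup>2 \<le> wt a / 64" using kbox_norm_sq[OF a v] by simp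
  show 3: "wt a / 2 \<le> wt (a + v)" and "wt (a + v) \<le> 2 * wt a"
    using 1 2 w zero_le_power2[of "norm v"] unfolding norm_add_sq abs_le_iff by argo+
  then have "(norm (a + v))\<^sup>2 < 1" using w by simp
  then show "a + v \<in> ball 0 1" by (simp add: abs_square_less_1)
qed

lemma wt_le_kernel:
  assumes a: "a \<in> ball 0 1" and z: "z \<in> ball 0 1"
  shows "wt a \<le> 2 * norm (1 - cip a z)" "(norm (z - a))\<^sup>2 \<le> 2 * norm (1 - cip a z)"
proof -
  have "norm (cip a z) \<le> norm a * norm z" by (rule norm_cip_le)
  also have "\<dots> \<le> norm a * 1" using z by (intro mult_left_mono) auto
  finally have "1 - norm a \<le> norm (1 - cip a z)"
    using norm_triangle_ineq2[of 1 "cip a z"] by simp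
  moreover have "wt a \<le> 2 * (1 - norm a)"
    using zero_le_power2[of "1 - norm a"] by (simp add: power2_eq_square algebra_simps)
  ultimately show "wt a \<le> 2 * norm (1 - cip a z)" by argo
  have "(norm (z - a))\<^sup>2 = (norm z)\<^sup>2 - 2 * Re (cip z a) + (norm a)\<^sup>2"
    by (rule norm_diff_sq)
  also have "\<dots> \<le> 1 - 2 * Re (cip z a) + 1"
    using wt_pos[OF a] wt_pos[OF z] by simp
  also have "Re (cip z a) = Re (cip a z)" by (metis cnj_cip cnj.sel(1))
  also have "1 - 2 * Re (cip a z) + 1 = 2 * Re (1 - cip a z)" by simp
  also have "\<dots> \<le> 2 * norm (1 - cip a z)" using complex_Re_le_cmod[of "1 - cip a z"] by simp
  finally show "(norm (z - a))\<^sup>2 \<le> 2 * norm (1 - cip a z)" .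
qed

text \<open>The two conditions defining the box are made for this: <v, z> = <v, a> + <v, z - a>,
  where the first term is bounded by the condition in the direction of a. The second is bounded by
  the product of \<open>sqrt (wt a)\<close> and |z - a|, and both of these are at most the square
  root of twice |1 - <a, z>|.\<close>

lemma kbox_kernel:
  assumes a: "a \<in> ball 0 1" and z: "z \<in> ball 0 1" and \<delta>: "0 < \<delta>" "\<delta> \<le> 1 / 8" and v: "v \<in> kbox \<delta> a"
  shows "norm (1 - cip (a + v) z) \<le> 2 * norm (1 - cip a z)"
proof -
  let ?X = "norm (1 - cip a z)"
  note w = wt_pos[OF a] and X = wt_le_kernel[OF a z]
  have "norm (cip v (z - a)) \<le> norm v * norm (z - a)" by (rule norm_cip_le)
  also have "\<dots> \<le> (\<delta> * sqrt (wt a)) * norm (z - a)"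
    using v by (intro mult_right_mono) (auto simp: kbox_def)
  also have "\<dots> \<le> (\<delta> * sqrt (2 * ?X)) * sqrt (2 * ?X)"
    using X \<delta> w by (intro mult_mono) (auto intro: real_le_rsqrt)
  also have "\<dots> = \<delta> * (2 * ?X)" by (simp add: mult.assoc)
  finally have 1: "norm (cip v (z - a)) \<le> \<delta> * (2 * ?X)" .
  have "norm (cip v a) \<le> \<delta> * wt a" using v by (simp add: kbox_def)
  also have "\<dots> \<le> \<delta> * (2 * ?X)" using X \<delta> by (intro mult_left_mono) auto
  finally have 2: "norm (cip v a) \<le> \<delta> * (2 * ?X)" .
  have "1 - cip (a + v) z = (1 - cip a z) - (cip v a + cip v (z - a))"
    by (simp add: cip_add_left cip_diff_right)
  then have "norm (1 - cip (a + v) z) \<le> ?X + norm (cip v a + cip v (z - a))"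
    by (simp only: norm_triangle_ineq4)
  also have "\<dots> \<le> ?X + (norm (cip v a) + norm (cip v (z - a)))"
    by (intro add_left_mono norm_triangle_ineq)
  also have "\<dots> \<le> ?X + (1 / 8 * (2 * ?X) + 1 / 8 * (2 * ?X))"
  proof -
    have "\<delta> * (2 * ?X) \<le> 1 / 8 * (2 * ?X)" using \<delta> by (intro mult_right_mono) auto
    then show ?thesis using 1 2 by linarith
  qed
  finally show ?thesis using norm_ge_zero[of "1 - cip a z"] by linarith
qed

text \<open>Quasi-triangle inequality. The common point y makes \<open>wt b\<close> at most 4
  \<open>wt a\<close>. Pairing y - b with a instead of b costs <y - b, b - a>, which is of second
  order in \<delta>. The contributions 1 + 4 + 3/4 in the direction of a explain the factor
  6.\<close>

lemma kbox_overlap: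
  assumes a: "a \<in> ball 0 1" and b: "b \<in> ball 0 1" and \<delta>: "0 < \<delta>" "\<delta> \<le> 1 / 8"
    and v: "y - a \<in> kbox \<delta> a" and v': "y - b \<in> kbox \<delta> b"
  shows "b - a \<in> kbox (6 * \<delta>) a"
proof -
  note w = wt_pos[OF a]
  have wy: "wt b / 2 \<le> wt y" "wt y \<le> 2 * wt a"
    using kbox_wt(1)[OF b \<delta> v'] kbox_wt(2)[OF a \<delta> v] by auto
  then have wb: "wt b \<le> 4 * wt a" by argo
  then have swb: "sqrt (wt b) \<le> 2 * sqrt (wt a)"
  proof -
    have "sqrt (wt b) \<le> sqrt (4 * wt a)" using wb by (rule real_sqrt_le_mono)
    also have "\<dots> = 2 * sqrt (wt a)" by (simp only: real_sqrt_mult real_sqrt_four)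
    finally show ?thesis .
  qed
  have nv': "norm (y - b) < \<delta> * (2 * sqrt (wt a))"
  proof -
    have "norm (y - b) < \<delta> * sqrt (wt b)" using v' by (simp add: kbox_def)
    also have "\<dots> \<le> \<delta> * (2 * sqrt (wt a))" using swb \<delta> by (intro mult_left_mono) auto
    finally show ?thesis .
  qed
  have ba: "b - a = (y - a) - (y - b)" by simp
  have "norm (b - a) \<le> norm (y - a) + norm (y - b)"
    by (subst ba) (rule norm_triangle_ineq4)
  also have "\<dots> < \<delta> * sqrt (wt a) + \<delta> * (2 * sqrt (wt a))"
    using nv' v by (intro add_strict_mono) (auto simp: kbox_def)
  finally have nba: "norm (b - a) < 3 * \<delta> * sqrt (wt a)" by simp
  have "norm (cip (y - b) (b - a)) \<le> norm (y - b) * norm (b - a)" by (rule norm_cip_le)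
  also have "\<dots> \<le> (\<delta> * (2 * sqrt (wt a))) * (3 * \<delta> * sqrt (wt a))"
    using nv' nba \<delta> w by (intro mult_mono) auto
  also have "\<dots> = 6 * \<delta> * \<delta> * wt a" using w by simp
  also have "\<dots> \<le> 6 * (1 / 8) * \<delta> * wt a" using \<delta> w by (intro mult_right_mono) auto
  finally have 1: "norm (cip (y - b) (b - a)) \<le> 3 / 4 * (\<delta> * wt a)" by simp
  have 2: "norm (cip (y - b) b) \<le> 4 * (\<delta> * wt a)"
  proof -
    have "norm (cip (y - b) b) \<le> \<delta> * wt b" using v' by (simp add: kbox_def)
    also have "\<dots> \<le> \<delta> * (4 * wt a)" using wb \<delta> by (intro mult_left_mono) auto
    finally show ?thesis by (simp only: mult.left_commute)
  qed
  have 3: "norm (cip (y - a) a) \<le> \<delta> * wt a" using v by (simp add: kbox_def)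
  have "cip (b - a) a = cip (y - a) a - (cip (y - b) b - cip (y - b) (b - a))"
    by (simp add: cip_diff_left cip_diff_right)
  then have "norm (cip (b - a) a) \<le> norm (cip (y - a) a) + norm (cip (y - b) b - cip (y - b) (b - a))"
    by (simp only: norm_triangle_ineq4)
  also have "\<dots> \<le> norm (cip (y - a) a) + (norm (cip (y - b) b) + norm (cip (y - b) (b - a)))"
    by (intro add_left_mono norm_triangle_ineq4)
  also have "\<dots> < 6 * (\<delta> * wt a)"
  proof -
    have "0 < \<delta> * wt a" using \<delta> w by simp
    then show ?thesis using 1 2 3 by linarith
  qed
  finally have "norm (cip (b - a) a) < 6 * \<delta> * wt a" by simp
  moreover have "norm (b - a) < 6 * \<delta> * sqrt (wt a)"
  proof -
    have "3 * \<delta> * sqrt (wt a) \<le> 6 * \<delta> * sqrt (wt a)" using \<delta> w by (intro mult_right_mono) auto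
    then show ?thesis using nba by linarith
  qed
  ultimately show ?thesis by (simp add: kbox_def)
qed

text \<open>
  Averaging the translates of the box along the complex line through \<open>u\<close> over the unit disc,
  instead of computing its volume.
\<close>

lemma slab_volume:
  fixes u :: "complex ^ 'n"
  assumes u: "norm u = 1" and R: "0 < R" and s: "0 < s" "s \<le> 1 / 2"
  shows "ennreal (s\<^sup>2) * emeasure lborel (ball (0 :: complex ^ 'n) (R / 2))
    \<le> emeasure lborel {v. norm v < R \<and> norm (cip v u) < R * s}"
proof -
  let ?D = "{v. norm v < R \<and> norm (cip v u) < R * s}"
  let ?b = "emeasure lborel (ball (0::complex) 1)"
  let ?B = "ball (0::complex) 1"
  have Dm: "Measurable.pred borel (\<lambda>v. v \<in> ?D)" unfolding mem_Collect_eq by measurable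
  have Ds: "?D \<in> sets borel" using Dm unfolding pred_def by simp
  have be: "emeasure lborel (ball c s) = ennreal (s\<^sup>2) * ?b" for c :: complex
    using s by (simp add: emeasure_ball ennreal_mult[symmetric] unit_ball_vol_nonneg mult.commute)
  have b0: "?b \<noteq> 0" "?b \<noteq> \<infinity>"
    using less_imp_neq[OF unit_ball_vol_pos[of "real DIM(complex)"], symmetric] by (auto simp: emeasure_ball)
  have "?b * (ennreal (s\<^sup>2) * emeasure lborel (ball (0 :: complex ^ 'n) (R / 2)))
      = (\<integral>\<^sup>+v. (ennreal (s\<^sup>2) * ?b) * indicator (ball (0::complex^'n) (R / 2)) v \<partial>lborel)"
    by (subst nn_integral_cmult_indicator) (auto simp: mult_ac)
  also have "\<dots> \<le> (\<integral>\<^sup>+v. (\<integral>\<^sup>+t. indicator ?B t * indicator ?D (v - (t * of_real R) *s u) \<partial>lborel) \<partial>lborel)"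
  proof (rule nn_integral_mono)
    fix v :: "complex ^ 'n"
    show "(ennreal (s\<^sup>2) * ?b) * indicator (ball (0::complex^'n) (R / 2)) v
       \<le> (\<integral>\<^sup>+t. indicator ?B t * indicator ?D (v - (t * of_real R) *s u) \<partial>lborel)"
    proof (cases "v \<in> ball 0 (R / 2)")
      case True
      \<comment> \<open>Every t in this disc of radius s moves v into the slab: the component along
        u becomes shorter than R s, and the orthogonal component is no longer than v. The area of
        the disc supplies the factor \<open>s\<^sup>2\<close>.\<close>
      have "indicator (ball (cip v u / of_real R) s) t \<le> (indicator ?B t * indicator ?D (v - (t * of_real R) *s u) :: ennreal)" for t
      proof (cases "t \<in> ball (cip v u / of_real R) s")
        case t: True
        have cu: "norm (cip v u) \<le> norm v" using norm_cip_le[of v u] u by simp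
        have ts: "norm (cip v u / of_real R - t) < s" using t by (simp add: dist_norm)
        have "norm (cip v u / of_real R) < 1 / 2"
          using cu True R by (simp add: norm_divide pos_divide_less_eq)
        then have t1: "norm t < 1" using ts s norm_triangle_ineq2[of t "cip v u / of_real R"]
          by (simp add: norm_minus_commute)
        have "cip v u - t * of_real R = of_real R * (cip v u / of_real R - t)"
          using R by (simp add: field_simps)
        then have rs: "norm (cip v u - t * of_real R) < R * s"
          using ts R by (simp only: norm_mult norm_of_real) simp
        have uu: "cip u u = 1" using u by (simp add: cip_self)
        have c2: "norm (cip (v - (t * of_real R) *s u) u) < R * s"
          using rs uu by (simp add: cip_diff_left)
        have "v - (t * of_real R) *s u = (v - cip v u *s u) + (cip v u - t * of_real R) *s u"
          by (simp add: vec_eq_iff algebra_simps)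
        then have "norm (v - (t * of_real R) *s u) \<le> norm (v - cip v u *s u) + norm ((cip v u - t * of_real R) *s u)"
          by (simp only: norm_triangle_ineq)
        also have "norm (v - cip v u *s u) \<le> norm v"
        proof -
          have "(norm v)\<^sup>2 = (norm (cip v u *s u))\<^sup>2 + (norm (v - cip v u *s u))\<^sup>2"
            using norm_axis_slice[of v u 1] u by simp
          then have "(norm (v - cip v u *s u))\<^sup>2 \<le> (norm v)\<^sup>2" by simp
          then show ?thesis by (rule power2_le_imp_le) simp
        qed
        also have "norm v + norm ((cip v u - t * of_real R) *s u) < R"
        proof -
          have "R * s \<le> R * (1 / 2)" using s R by (intro mult_left_mono) auto
          moreover have "norm v < R / 2" using True by simp
          ultimately show ?thesis using rs u unfolding norm_smult by simp
        qed
        finally have "v - (t * of_real R) *s u \<in> ?D" using c2 by simp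
        then show ?thesis using t1 by (simp add: indicator_def)
      qed simp
      then have "(\<integral>\<^sup>+t. indicator (ball (cip v u / of_real R) s) t \<partial>lborel)
         \<le> (\<integral>\<^sup>+t. indicator ?B t * indicator ?D (v - (t * of_real R) *s u) \<partial>lborel)"
        by (intro nn_integral_mono)
      then show ?thesis using True by (simp add: be)
    qed simp
  qed
  also have "\<dots> = (\<integral>\<^sup>+t. (\<integral>\<^sup>+v. indicator ?B t * indicator ?D (v - (t * of_real R) *s u) \<partial>lborel) \<partial>lborel)"
  proof (rule lborel_pair.Fubini')
    have "(\<lambda>(t, v). (if t \<in> ?B then 1 else 0) * (if norm (v - (t * of_real R) *s u) < R \<and> norm (cip (v - (t * of_real R) *s u) u) < R * s then 1 else 0) :: ennreal)
      \<in> borel_measurable (borel \<Otimes>\<^sub>M borel)" by measurable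
    then show "(\<lambda>(t, v). indicator ?B t * indicator ?D (v - (t * of_real R) *s u) :: ennreal) \<in> borel_measurable (lborel \<Otimes>\<^sub>M lborel)"
      by (simp add: indicator_def of_bool_def cong: measurable_cong_sets sets_pair_measure_cong)
  qed
  also have "\<dots> = (\<integral>\<^sup>+t. emeasure lborel ?D * indicator ?B t \<partial>lborel)"
  proof (rule nn_integral_cong)
    fix t :: complex
    have ind: "indicator ?D \<in> borel_measurable (borel :: (complex ^ 'n) measure)" using Ds by simp
    have m: "(\<lambda>v. indicator ?D (v - (t * of_real R) *s u) :: ennreal) \<in> borel_measurable borel"
      by (rule measurable_compose[of "\<lambda>v. v - (t * of_real R) *s u" borel borel, OF _ ind]) measurable
    have "(\<integral>\<^sup>+v. indicator ?D (v - (t * of_real R) *s u) \<partial>lborel) = (\<integral>\<^sup>+v. indicator ?D ((t * of_real R) *s u + v - (t * of_real R) *s u) \<partial>lborel)"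
      by (rule nn_integral_lborel_shift[OF m, symmetric])
    also have "\<dots> = emeasure lborel ?D"
      using Ds by simp
    finally show "(\<integral>\<^sup>+v. indicator ?B t * indicator ?D (v - (t * of_real R) *s u) \<partial>lborel) = emeasure lborel ?D * indicator ?B t"
      using m by (subst nn_integral_cmult) (auto simp: mult.commute)
  qed
  also have "\<dots> = ?b * emeasure lborel ?D"
    by (subst nn_integral_cmult_indicator) (auto simp: mult.commute)
  finally show ?thesis
    using b0 by (simp add: ennreal_mult_le_mult_iff)
qed

lemma kbox_volume:
  assumes "0 < \<delta>"
  obtains c where "0 < c"
    "\<And>a::complex ^ 'n. a \<in> ball 0 1 \<Longrightarrow> ennreal (c * wt a ^ (CARD('n) + 1)) \<le> emeasure lborel (kbox \<delta> a)"
proof (rule that[of "(\<delta> / 2) ^ (2 * CARD('n)) * unit_ball_vol (real (2 * CARD('n))) / 4"])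
  show "0 < (\<delta> / 2) ^ (2 * CARD('n)) * unit_ball_vol (real (2 * CARD('n))) / 4"
    using assms by simp
  fix a :: "complex ^ 'n" assume a: "a \<in> ball 0 1"
  note w = wt_pos[OF a]
  define u where "u = (if a = 0 then axis undefined 1 else (1 / norm a) *\<^sub>R a)"
  have u: "norm u = 1" 
  proof (cases "a = 0")
    case True
    then show ?thesis
      by (auto simp: u_def norm_vec_def axis_def L2_set_def if_distrib[of norm] if_distrib[of "\<lambda>x. x\<^sup>2"] cong: if_cong)
  qed (simp add: u_def)
  have au: "a = norm a *\<^sub>R u" by (auto simp: u_def)
  \<comment> \<open>R and s are chosen so that R s is half of the width
    \<open>\<delta> * wt a\<close> while s stays below 1/2; then \<open>s\<^sup>2\<close> times
    R^(2n) is of order \<open>wt a\<close> to the power n + 1.\<close>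
  define R where "R = \<delta> * sqrt (wt a)"
  define s where "s = sqrt (wt a) / 2"
  have R: "0 < R" using w assms by (simp add: R_def)
  have s: "0 < s" "s \<le> 1 / 2" using w by (auto simp: s_def)
  have "{v. norm v < R \<and> norm (cip v u) < R * s} \<subseteq> kbox \<delta> a"
  proof (clarsimp simp: kbox_def R_def)
    fix v assume v: "norm (cip v u) < \<delta> * sqrt (wt a) * s"
    have "norm (cip v a) = norm a * norm (cip v u)"
      by (subst au) (simp add: norm_mult)
    also have "\<dots> \<le> 1 * norm (cip v u)" using a by (intro mult_right_mono) auto
    also have "\<dots> < \<delta> * sqrt (wt a) * s" using v by simp
    also have "\<dots> = \<delta> * wt a / 2" using w by (simp add: s_def)
    also have "\<dots> \<le> \<delta> * wt a" using w assms by simp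
    finally show "norm (cip v a) < \<delta> * wt a" .
  qed
  moreover have "kbox \<delta> a \<in> sets lborel" using kbox_measurable[of \<delta> a] unfolding pred_def by simp
  ultimately have "emeasure lborel {v. norm v < R \<and> norm (cip v u) < R * s} \<le> emeasure lborel (kbox \<delta> a)"
    by (rule emeasure_mono)
  with slab_volume[OF u R s] have "ennreal (s\<^sup>2) * emeasure lborel (ball (0 :: complex ^ 'n) (R / 2)) \<le> emeasure lborel (kbox \<delta> a)"
    by (rule order_trans)
  also have "ennreal (s\<^sup>2) * emeasure lborel (ball (0 :: complex ^ 'n) (R / 2)) = ennreal (s\<^sup>2 * (unit_ball_vol (real (2 * CARD('n))) * (R / 2) ^ (2 * CARD('n))))"
    using R by (simp add: emeasure_ball ennreal_mult[symmetric] unit_ball_vol_nonneg mult.commute)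
  also have "s\<^sup>2 * (unit_ball_vol (real (2 * CARD('n))) * (R / 2) ^ (2 * CARD('n)))
    = (\<delta> / 2) ^ (2 * CARD('n)) * unit_ball_vol (real (2 * CARD('n))) / 4 * wt a ^ (CARD('n) + 1)"
  proof -
    have "(sqrt (wt a) ^ 2) ^ CARD('n) = wt a ^ CARD('n)" using w by simp
    then have "(R / 2) ^ (2 * CARD('n)) = (\<delta> / 2) ^ (2 * CARD('n)) * wt a ^ CARD('n)"
      unfolding R_def times_divide_eq_left[symmetric] power_mult_distrib by (simp only: power_mult)
    moreover have "s\<^sup>2 = wt a / 4" using w by (simp add: s_def power_divide)
    ultimately show ?thesis by simp
  qed
  finally show "ennreal ((\<delta> / 2) ^ (2 * CARD('n)) * unit_ball_vol (real (2 * CARD('n))) / 4 * wt a ^ (CARD('n) + 1)) \<le> emeasure lborel (kbox \<delta> a)" .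
qed

section \<open>Separated sequences and Schur's test\<close>

definition box_separated :: "real \<Rightarrow> (complex ^ 'n) set \<Rightarrow> bool" where
  "box_separated \<delta> S \<longleftrightarrow> (\<forall>a\<in>S. \<forall>b\<in>S. a \<noteq> b \<longrightarrow> b - a \<notin> kbox \<delta> a)"

lemma powr_comparable:
  fixes x y \<kappa> :: real
  assumes "0 < x" "x / 2 \<le> y" "y \<le> 2 * x"
  shows "2 powr - \<bar>\<kappa>\<bar> * x powr \<kappa> \<le> y powr \<kappa>"
proof (cases "0 \<le> \<kappa>")
  case True
  have "2 powr - \<bar>\<kappa>\<bar> * x powr \<kappa> = (x / 2) powr \<kappa>"
    using True by (simp add: powr_divide powr_minus_divide)
  also have "\<dots> \<le> y powr \<kappa>" using True assms by (intro powr_mono2) auto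
  finally show ?thesis .
next
  case False
  have "2 powr - \<bar>\<kappa>\<bar> * x powr \<kappa> = (2 * x) powr \<kappa>"
    using False assms by (simp add: powr_mult)
  also have "\<dots> \<le> y powr \<kappa>" using False assms by (intro powr_mono2') auto
  finally show ?thesis .
qed

lemma integral_ball_measure_nonneg:
  fixes g :: "complex ^ 'n \<Rightarrow> real"
  assumes [measurable]: "g \<in> borel_measurable borel" and "\<And>z. 0 \<le> g z"
  shows "(LINT z|ball_measure \<kappa>. g z) = enn2real (\<integral>\<^sup>+z. ennreal (indicator (ball 0 1) z * wt z powr \<kappa> * g z) \<partial>lborel)"
    and "integrable (ball_measure \<kappa>) g \<longleftrightarrow> (\<integral>\<^sup>+z. ennreal (indicator (ball 0 1) z * wt z powr \<kappa> * g z) \<partial>lborel) < \<infinity>"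
proof -
  have i: "indicator {..<1} (norm z) = (indicator (ball 0 1) z :: real)" for z :: "complex ^ 'n"
    by (simp add: indicator_def)
  show "(LINT z|ball_measure \<kappa>. g z) = enn2real (\<integral>\<^sup>+z. ennreal (indicator (ball 0 1) z * wt z powr \<kappa> * g z) \<partial>lborel)"
    and "integrable (ball_measure \<kappa>) g \<longleftrightarrow> (\<integral>\<^sup>+z. ennreal (indicator (ball 0 1) z * wt z powr \<kappa> * g z) \<partial>lborel) < \<infinity>"
    using integrable_radial_measure_nonneg[OF ball_density_measurable assms(1) _ assms(2), of \<kappa>]
    unfolding ball_measure_def i by auto
qed

text \<open>Discrete counterpart of the Forelli-Rudin estimate. The factor
  \<open>wt a powr (CARD('n) + 1 + \<kappa>)\<close> is at most a constant times the weighted volume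
  of the box at a, and on that box the kernel is bounded below by a multiple of its value at a. Each
  term is thus dominated by an integral over a box, and the boxes are disjoint.\<close>

lemma discrete_kernel_sum:
  fixes S :: "(complex ^ 'n) set" and \<kappa> \<eta> :: real
  assumes S: "S \<subseteq> ball 0 1" and \<epsilon>: "0 < \<epsilon>" "box_separated \<epsilon> S"
    and \<kappa>: "-1 < \<kappa>" and \<eta>: "0 < \<eta>"
  obtains C where "0 < C"
    "\<And>A z. finite A \<Longrightarrow> A \<subseteq> S \<Longrightarrow> z \<in> ball 0 1 \<Longrightarrow>
      (\<Sum>a\<in>A. wt a powr (CARD('n) + 1 + \<kappa>) * norm (1 - cip z a) powr - (CARD('n) + 1 + \<kappa> + \<eta>)) \<le> C * wt z powr - \<eta>"
proof -
  let ?E = "CARD('n) + 1 + \<kappa> + \<eta>"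
  have E: "0 < ?E" using \<kappa> \<eta> by simp
  \<comment> \<open>Boxes of size \<delta> that meet would put one centre into the box of size 6
    \<delta> about the other, contradicting separation with \<epsilon>; the bound 1/8 is the range
    of the comparison lemmas.\<close>
  define \<delta> where "\<delta> = min (\<epsilon> / 6) (1 / 8)"
  have \<delta>: "0 < \<delta>" "\<delta> \<le> 1 / 8" "6 * \<delta> \<le> \<epsilon>" using \<epsilon> by (auto simp: \<delta>_def)
  let ?D = "\<lambda>a. {y. y - a \<in> kbox \<delta> a}"
  let ?F = "\<lambda>y z. norm (1 - cip y z) powr - ?E"
  obtain C1 where C1: "0 < C1"
    "\<And>a::complex^'n. a \<in> ball 0 1 \<Longrightarrow> integrable (ball_measure \<kappa>) (\<lambda>z. ?F z a)"
    "\<And>a::complex^'n. a \<in> ball 0 1 \<Longrightarrow> (LINT z|ball_measure \<kappa>. ?F z a) \<le> C1 * wt a powr - \<eta>"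
    by (rule forelli_rudin[OF \<kappa> \<eta>, where 'n = 'n]) blast
  obtain c where c: "0 < c"
    "\<And>a::complex ^ 'n. a \<in> ball 0 1 \<Longrightarrow> ennreal (c * wt a ^ (CARD('n) + 1)) \<le> emeasure lborel (kbox \<delta> a)"
    by (rule kbox_volume[OF \<delta>(1), where 'n = 'n]) blast
  let ?k = "2 powr - \<bar>\<kappa>\<bar>"
  have Dm[measurable]: "Measurable.pred borel (\<lambda>y. y \<in> ?D a)" for a :: "complex ^ 'n"
    unfolding mem_Collect_eq by (rule measurable_compose[OF _ kbox_measurable]) measurable
  have Ds: "?D a \<in> sets borel" for a :: "complex ^ 'n"
    using Dm[of a] unfolding pred_def by simp
  have vol: "ennreal (c * wt a ^ (CARD('n) + 1)) \<le> emeasure lborel (?D a)" if "a \<in> ball 0 1" for a :: "complex ^ 'n"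
  proof -
    have "emeasure lborel (?D a) = (\<integral>\<^sup>+y. indicator (?D a) (a + y) \<partial>lborel)"
      using Ds by (subst nn_integral_lborel_shift) auto
    also have "\<dots> = (\<integral>\<^sup>+y. indicator (kbox \<delta> a) y \<partial>lborel)"
      by (simp add: indicator_def)
    also have "\<dots> = emeasure lborel (kbox \<delta> a)"
      using kbox_measurable[of \<delta> a] unfolding pred_def by simp
    finally show ?thesis using c(2)[OF that] by simp
  qed
  define c2 where "c2 = ?k * c * 2 powr - ?E"
  have c2: "0 < c2" using c by (simp add: c2_def)
  have int1: "integrable (ball_measure \<kappa>) (\<lambda>y. indicator (?D a) y * ?F y z)" if "z \<in> ball 0 1" for a z :: "complex ^ 'n"
  proof (rule Bochner_Integration.integrable_bound[OF C1(2)[OF that]])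
    show "AE y in ball_measure \<kappa>. norm (indicator (?D a) y * ?F y z) \<le> norm (?F y z)"
      by (intro AE_I2) (auto simp: indicator_def)
    show "(\<lambda>y. indicator (?D a) y * ?F y z) \<in> borel_measurable (ball_measure \<kappa>)"
      using Ds[of a] by measurable
  qed
  have local: "c2 * (wt a powr (CARD('n) + 1 + \<kappa>) * norm (1 - cip z a) powr - ?E) \<le> (LINT y|ball_measure \<kappa>. indicator (?D a) y * ?F y z)"
    if a: "a \<in> ball 0 1" and z: "z \<in> ball 0 1" for a z :: "complex ^ 'n"
  proof -
    note w = wt_pos[OF a]
    let ?X = "norm (1 - cip a z)"
    have X: "0 < ?X" using wt_le_kernel(1)[OF a z] w by linarith
    let ?T = "?k * wt a powr \<kappa> * (2 * ?X) powr - ?E"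
    have "ennreal (?T * (c * wt a ^ (CARD('n) + 1))) \<le> ennreal ?T * emeasure lborel (?D a)"
      using vol[OF a] by (simp add: ennreal_mult' mult_left_mono)
    also have "\<dots> = (\<integral>\<^sup>+y. ennreal ?T * indicator (?D a) y \<partial>lborel)"
      using Ds[of a] by (subst nn_integral_cmult_indicator) auto
    also have "\<dots> \<le> (\<integral>\<^sup>+y. ennreal (indicator (ball 0 1) y * wt y powr \<kappa> * (indicator (?D a) y * ?F y z)) \<partial>lborel)"
    proof (rule nn_integral_mono)
      fix y
      show "ennreal ?T * indicator (?D a) y \<le> ennreal (indicator (ball 0 1) y * wt y powr \<kappa> * (indicator (?D a) y * ?F y z))"
      proof (cases "y \<in> ?D a")
        case True
        then have v: "y - a \<in> kbox \<delta> a" by simp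
        have y: "wt a / 2 \<le> wt y" "wt y \<le> 2 * wt a" "y \<in> ball 0 1"
          using kbox_wt[OF a \<delta>(1,2) v] by simp_all
        have "?k * wt a powr \<kappa> \<le> wt y powr \<kappa>"
          by (rule powr_comparable[OF w y(1,2)])
        moreover have "(2 * ?X) powr - ?E \<le> ?F y z"
        proof (rule powr_mono2')
          show "norm (1 - cip y z) \<le> 2 * ?X" using kbox_kernel[OF a z \<delta>(1,2) v] by simp
          show "0 < norm (1 - cip y z)" using wt_le_kernel(1)[OF y(3) z] wt_pos[OF y(3)] by linarith
        qed (use E in simp)
        ultimately have "?T \<le> wt y powr \<kappa> * ?F y z" by (intro mult_mono) auto
        then show ?thesis using True y(3) by (simp add: ennreal_leI)
      qed simp
    qed
    also have "\<dots> = ennreal (LINT y|ball_measure \<kappa>. indicator (?D a) y * ?F y z)"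
    proof -
      have m: "(\<lambda>y. indicator (?D a) y * ?F y z) \<in> borel_measurable borel" using Ds[of a] by measurable
      have "(\<integral>\<^sup>+y. ennreal (indicator (ball 0 1) y * wt y powr \<kappa> * (indicator (?D a) y * ?F y z)) \<partial>lborel) < \<infinity>"
        using int1[OF z, of a] by (subst (asm) integral_ball_measure_nonneg(2)[OF m]) auto
      then show ?thesis by (subst integral_ball_measure_nonneg(1)[OF m]) auto
    qed
    finally have "?T * (c * wt a ^ (CARD('n) + 1)) \<le> (LINT y|ball_measure \<kappa>. indicator (?D a) y * ?F y z)"
      by (subst (asm) ennreal_le_iff) (auto intro!: Bochner_Integration.integral_nonneg)
    moreover have "?T * (c * wt a ^ (CARD('n) + 1)) = c2 * (wt a powr (CARD('n) + 1 + \<kappa>) * norm (1 - cip z a) powr - ?E)"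
    proof -
      have "(2 * ?X) powr - ?E = 2 powr - ?E * ?X powr - ?E" by (rule powr_mult)
      moreover have "wt a powr (CARD('n) + 1 + \<kappa>) = wt a ^ (CARD('n) + 1) * wt a powr \<kappa>"
        using w by (simp only: powr_add powr_realpow[symmetric])
      moreover have "norm (1 - cip z a) = ?X"
        by (metis cnj_cip complex_cnj_diff complex_cnj_one complex_mod_cnj)
      ultimately show ?thesis by (simp only: c2_def mult_ac)
    qed
    ultimately show ?thesis by simp
  qed
  show ?thesis
  proof (rule that[of "C1 / c2"])
    show "0 < C1 / c2" using C1 c2 by simp
    fix A z assume A: "finite A" "A \<subseteq> S" and z: "z \<in> ball (0::complex^'n) 1"
    have sum_le: "(\<Sum>a\<in>A. indicator (?D a) y) \<le> (1::real)" for y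
    proof (cases "\<exists>a\<in>A. y \<in> ?D a")
      case True
      then obtain a where a: "a \<in> A" "y \<in> ?D a" by blast
      have "y \<notin> ?D b" if "b \<in> A" "b \<noteq> a" for b
      proof
        assume "y \<in> ?D b"
        moreover have ab: "a \<in> ball 0 1" "b \<in> ball 0 1" using a that A(2) S by blast+
        ultimately have "b - a \<in> kbox (6 * \<delta>) a"
          using kbox_overlap[OF ab \<delta>(1,2), of y] a by simp
        then have "b - a \<in> kbox \<epsilon> a" using kbox_mono[OF \<delta>(3) ab(1)] by blast
        moreover have "a \<in> S" "b \<in> S" using a(1) that(1) A(2) by auto
        ultimately show False
          using \<epsilon>(2)[unfolded box_separated_def, rule_format, of a b] that(2) by simp
      qed
      then have "(\<Sum>b\<in>A. indicator (?D b) y) = (\<Sum>b\<in>A. if b = a then 1 else (0::real))"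
        using a by (intro sum.cong) (auto simp: indicator_def)
      then show ?thesis using A a by simp
    next
      case False
      then have "(\<Sum>a\<in>A. indicator (?D a) y) = (0::real)" by (intro sum.neutral) (auto simp: indicator_def)
      then show ?thesis by simp
    qed
    have "c2 * (\<Sum>a\<in>A. wt a powr (CARD('n) + 1 + \<kappa>) * norm (1 - cip z a) powr - ?E)
      \<le> (\<Sum>a\<in>A. LINT y|ball_measure \<kappa>. indicator (?D a) y * ?F y z)"
      unfolding sum_distrib_left by (intro sum_mono local z) (use A S in auto)
    also have "\<dots> = (LINT y|ball_measure \<kappa>. (\<Sum>a\<in>A. indicator (?D a) y * ?F y z))"
      by (rule Bochner_Integration.integral_sum[symmetric]) (rule int1[OF z])
    also have "\<dots> \<le> (LINT y|ball_measure \<kappa>. ?F y z)"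
    proof (rule integral_mono)
      show "integrable (ball_measure \<kappa>) (\<lambda>y. \<Sum>a\<in>A. indicator (?D a) y * ?F y z)"
        by (intro Bochner_Integration.integrable_sum int1 z)
      show "(\<Sum>a\<in>A. indicator (?D a) y * ?F y z) \<le> ?F y z" for y
        using mult_right_mono[OF sum_le[of y], of "?F y z"] by (simp add: sum_distrib_right)
    qed (rule C1(2)[OF z])
    also have "\<dots> \<le> C1 * wt z powr - \<eta>" by (rule C1(3)[OF z])
    finally show "(\<Sum>a\<in>A. wt a powr (CARD('n) + 1 + \<kappa>) * norm (1 - cip z a) powr - ?E) \<le> C1 / c2 * wt z powr - \<eta>"
      using c2 by (simp add: pos_le_divide_eq mult.commute)
  qed
qed

text \<open>Schur's test with powers of \<open>wt\<close> as test functions. Hoelder's inequality in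
  the sum over a uses the discrete estimate with weight exponent k - s r'; integration in z then
  uses the Forelli-Rudin estimate with k - s r. In both the kernel appears with the exponent N, and
  all powers of \<open>wt a\<close> cancel in the end.\<close>

lemma kernel_synthesis_bounded:
  fixes S :: "(complex ^ 'n) set"
  assumes S: "S \<subseteq> ball 0 1" and \<epsilon>: "0 < \<epsilon>" "box_separated \<epsilon> S" and r: "1 < r"
  obtains C where "0 < C"
    "\<And>A x. finite A \<Longrightarrow> A \<subseteq> S \<Longrightarrow>
      bergman_norm k r (\<lambda>z. \<Sum>a\<in>A. x a * normalized_kernel k r a z) \<le> C * (\<Sum>a\<in>A. norm (x a) powr r) powr (1 / r)"
proof -
  let ?N = "real (CARD('n) + k + 1)"
  define r' where "r' = r / (r - 1)"
  have r': "1 < r'" "1 / r + 1 / r' = 1" using r by (auto simp: r'_def field_simps)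
  \<comment> \<open>Any s > 0 with s r < 1 and s r' < 1 would do: both shifted weight exponents then
    exceed -1, also for k = 0.\<close>
  define s where "s = 1 / (2 * (r + r'))"
  have s: "0 < s" "0 < s * r" "s * r < 1" "0 < s * r'" "s * r' < 1"
    using r r' by (auto simp: s_def divide_simps)
  let ?V = "ball_mass TYPE('n) (real k)"
  have V: "0 < ?V" by (rule ball_mass_nat_pos)
  have N1: "CARD('n) + 1 + (real k - s * r) + s * r = ?N" "CARD('n) + 1 + (real k - s * r') + s * r' = ?N" by simp_all
  obtain C1 where C1: "0 < C1"
    "\<And>A z. finite A \<Longrightarrow> A \<subseteq> S \<Longrightarrow> z \<in> ball 0 1 \<Longrightarrow>
      (\<Sum>a\<in>A. wt a powr (CARD('n) + 1 + (real k - s * r')) * norm (1 - cip z a) powr - ?N) \<le> C1 * wt z powr - (s * r')"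
  proof -
    have "-1 < real k - s * r'" using s by (simp add: add_strict_increasing2)
    from discrete_kernel_sum[OF S \<epsilon> this s(4)] show ?thesis
      unfolding N1 using that by blast
  qed
  obtain C2 where C2: "0 < C2"
    "\<And>a::complex^'n. a \<in> ball 0 1 \<Longrightarrow> integrable (ball_measure (real k - s * r)) (\<lambda>z. norm (1 - cip z a) powr - ?N)"
    "\<And>a::complex^'n. a \<in> ball 0 1 \<Longrightarrow> (LINT z|ball_measure (real k - s * r). norm (1 - cip z a) powr - ?N) \<le> C2 * wt a powr - (s * r)"
  proof -
    have "-1 < real k - s * r" using s by (simp add: add_strict_increasing2)
    from forelli_rudin[OF this s(2), where 'n = 'n] show ?thesis
      unfolding N1 using that by blast
  qed
  obtain c where c: "0 < c" "\<And>a::complex ^ 'n. a \<in> ball 0 1 \<Longrightarrow>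
       c * wt a powr - (?N * (1 - 1 / r)) \<le> bergman_norm k r (bergman_kernel k a)"
    by (rule bergman_kernel_norm_estimate[OF r, of k, where 'n = 'n]) blast
  have e': "1 - 1 / r = 1 / r'" using r' by simp
  have nk: "norm (normalized_kernel k r a z) \<le> 1 / c * (wt a powr (?N / r') * norm (1 - cip z a) powr - ?N)"
    if a: "a \<in> ball 0 1" and z: "z \<in> ball 0 1" for a z :: "complex ^ 'n"
  proof -
    note w = wt_pos[OF a]
    have X: "0 < norm (1 - cip z a)" using wt_le_kernel(1)[OF z a] wt_pos[OF z] by linarith
    have "norm (bergman_kernel k a z) = inverse (norm (1 - cip z a) ^ (CARD('n) + k + 1))"
      using z by (simp add: bergman_kernel_cip norm_inverse norm_power norm_mult)
    then have b: "norm (bergman_kernel k a z) = norm (1 - cip z a) powr - ?N"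
      using X by (simp only: powr_realpow[symmetric] powr_minus[symmetric])
    have p: "0 < c * wt a powr - (?N / r')" using c w by simp
    have ca: "c * wt a powr - (?N / r') \<le> bergman_norm k r (bergman_kernel k a)"
      using c(2)[OF a] unfolding e' by simp
    have "norm (normalized_kernel k r a z) = norm (1 - cip z a) powr - ?N / bergman_norm k r (bergman_kernel k a)"
      using bergman_norm_nonneg[of k r "bergman_kernel k a"] by (simp only: normalized_kernel_def norm_divide b norm_of_real abs_of_nonneg)
    also have "\<dots> \<le> norm (1 - cip z a) powr - ?N / (c * wt a powr - (?N / r'))"
      by (rule divide_left_mono[OF ca _ mult_pos_pos[OF less_le_trans[OF p ca] p]]) simp
    also have "\<dots> = 1 / c * (wt a powr (?N / r') * norm (1 - cip z a) powr - ?N)"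
      unfolding powr_minus[of "wt a"] by (simp add: divide_inverse)
    finally show ?thesis .
  qed
  let ?K = "\<lambda>z a. norm (1 - cip z a) powr - ?N"
  define C3 where "C3 = (1 / c) powr r * C1 powr (r / r')"
  have C3: "0 < C3" using c C1 by (simp add: C3_def)
  have point: "norm (\<Sum>a\<in>A. x a * normalized_kernel k r a z) powr r \<le>
      C3 * (\<Sum>a\<in>A. norm (x a) powr r * wt a powr (s * r) * (wt z powr - (s * r) * ?K z a))"
    if A: "finite A" "A \<subseteq> S" and z: "z \<in> ball 0 1" for A x z
  proof -
    note w = wt_pos[OF z]
    \<comment> \<open>The Schur splitting: \<open>wt a powr s\<close> goes with the coefficient, its
      reciprocal with the factor that is summed over a, and the kernel is divided in the ratio 1/r
      to 1/r'.\<close>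
    let ?f = "\<lambda>a. if a \<in> A then norm (x a) * wt a powr s * ?K z a powr (1 / r) else 0"
    let ?g = "\<lambda>a. if a \<in> A then wt a powr (?N / r' - s) * ?K z a powr (1 / r') else 0"
    have aw: "0 < wt a" "a \<in> ball 0 1" if "a \<in> A" for a
      using that A(2) S wt_pos[of a] by blast+
    have "norm (\<Sum>a\<in>A. x a * normalized_kernel k r a z) \<le> (\<Sum>a\<in>A. norm (x a) * (1 / c * (wt a powr (?N / r') * ?K z a)))"
    proof (rule sum_norm_le)
      fix a assume "a \<in> A"
      then show "norm (x a * normalized_kernel k r a z) \<le> norm (x a) * (1 / c * (wt a powr (?N / r') * ?K z a))"
        unfolding norm_mult by (intro mult_left_mono nk aw z) auto
    qed
    also have "\<dots> = 1 / c * (\<Sum>a\<in>A. ?f a * ?g a)"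
      unfolding sum_distrib_left
    proof (rule sum.cong[OF refl])
      fix a assume a: "a \<in> A"
      have e1: "wt a powr s * wt a powr (?N / r' - s) = wt a powr (?N / r')"
        by (simp add: powr_add[symmetric])
      have e2: "?K z a powr (1 / r) * ?K z a powr (1 / r') = ?K z a"
        unfolding powr_add[symmetric] r'(2) by simp
      have "?f a * ?g a = norm (x a) * ((wt a powr s * wt a powr (?N / r' - s)) * (?K z a powr (1 / r) * ?K z a powr (1 / r')))"
        using a by (simp only: if_True mult_ac)
      then show "norm (x a) * (1 / c * (wt a powr (?N / r') * ?K z a)) = 1 / c * (?f a * ?g a)"
        unfolding e1 e2 by (simp only: mult.left_commute)
    qed
    also have "\<dots> \<le> 1 / c * ((\<Sum>a\<in>A. ?f a powr r) powr (1 / r) * (\<Sum>a\<in>A. ?g a powr r') powr (1 / r'))"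
      using c by (intro mult_left_mono Holder_sum r r' A) auto
    finally have "norm (\<Sum>a\<in>A. x a * normalized_kernel k r a z) powr r
      \<le> (1 / c * ((\<Sum>a\<in>A. ?f a powr r) powr (1 / r) * (\<Sum>a\<in>A. ?g a powr r') powr (1 / r'))) powr r"
      using r by (intro powr_mono2) auto
    also have "\<dots> = (1 / c) powr r * ((\<Sum>a\<in>A. ?f a powr r) * (\<Sum>a\<in>A. ?g a powr r') powr (r / r'))"
    proof -
      have "(1 / c * (F powr (1 / r) * G powr (1 / r'))) powr r = (1 / c) powr r * (F * G powr (r / r'))" if "0 \<le> F" for F G
        using r that by (simp add: powr_mult powr_powr powr_divide)
      note * = this
      show ?thesis by (rule *, rule sum_nonneg, rule powr_ge_zero)
    qed
    also have "\<dots> \<le> (1 / c) powr r * ((\<Sum>a\<in>A. ?f a powr r) * (C1 * wt z powr - (s * r')) powr (r / r'))"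
    proof (intro mult_left_mono powr_mono2 sum_nonneg)
      have "(\<Sum>a\<in>A. ?g a powr r') = (\<Sum>a\<in>A. wt a powr (CARD('n) + 1 + (real k - s * r')) * ?K z a)"
      proof (rule sum.cong[OF refl])
        fix a assume a: "a \<in> A"
        have "(?N / r' - s) * r' = CARD('n) + 1 + (real k - s * r')"
          using r' by (simp add: field_simps)
        moreover have "1 / r' * r' = 1" using r' by simp
        ultimately show "?g a powr r' = wt a powr (CARD('n) + 1 + (real k - s * r')) * ?K z a"
          using a by (simp only: if_True powr_mult powr_powr mult.assoc mult_1_right)
      qed
      also have "\<dots> \<le> C1 * wt z powr - (s * r')" by (rule C1(2)[OF A z])
      finally show "(\<Sum>a\<in>A. ?g a powr r') \<le> C1 * wt z powr - (s * r')" .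
      show "0 \<le> r / r'" using r r'(1) by simp
    qed (rule powr_ge_zero)+
    also have "(C1 * wt z powr - (s * r')) powr (r / r') = C1 powr (r / r') * wt z powr - (s * r)"
      using C1 r' by (simp add: powr_mult powr_powr)
    also have "(\<Sum>a\<in>A. ?f a powr r) = (\<Sum>a\<in>A. norm (x a) powr r * wt a powr (s * r) * ?K z a)"
    proof (rule sum.cong[OF refl])
      fix a assume a: "a \<in> A"
      have "1 / r * r = 1" using r by simp
      then show "?f a powr r = norm (x a) powr r * wt a powr (s * r) * ?K z a"
        using a by (simp only: if_True powr_mult powr_powr mult.assoc mult_1_right)
    qed
    also have "(1 / c) powr r * ((\<Sum>a\<in>A. norm (x a) powr r * wt a powr (s * r) * ?K z a) * (C1 powr (r / r') * wt z powr - (s * r)))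
      = C3 * (\<Sum>a\<in>A. norm (x a) powr r * wt a powr (s * r) * (wt z powr - (s * r) * ?K z a))"
      by (simp add: C3_def sum_distrib_left sum_distrib_right mult_ac)
    finally show ?thesis .
  qed
  \<comment> \<open>The factor \<open>wt z powr - (s * r)\<close> left by the sum over a is absorbed
    into the measure, lowering its exponent from k to k - s r.\<close>
  have trade: "integrable (ball_measure (real k)) (\<lambda>z. wt z powr - (s * r) * ?K z a)"
    "(LINT z|ball_measure (real k). wt z powr - (s * r) * ?K z a) \<le> C2 * wt a powr - (s * r)"
    if a: "a \<in> ball 0 1" for a :: "complex ^ 'n"
  proof -
    have eq: "indicator (ball 0 1) z * wt z powr real k * (wt z powr - (s * r) * ?K z a)
      = indicator (ball 0 1) z * wt z powr (real k - s * r) * ?K z a" for z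
      by (simp add: powr_diff powr_minus divide_inverse)
    have m: "(\<lambda>z. wt z powr - (s * r) * ?K z a) \<in> borel_measurable borel"
      "(\<lambda>z. ?K z a) \<in> borel_measurable borel" by measurable
    show "integrable (ball_measure (real k)) (\<lambda>z. wt z powr - (s * r) * ?K z a)"
      using C2(2)[OF a] unfolding integral_ball_measure_nonneg(2)[OF m(2) powr_ge_zero]
      by (subst integral_ball_measure_nonneg(2)[OF m(1)]) (auto simp only: eq mult_nonneg_nonneg powr_ge_zero)
    have "(LINT z|ball_measure (real k). wt z powr - (s * r) * ?K z a) = (LINT z|ball_measure (real k - s * r). ?K z a)"
      unfolding integral_ball_measure_nonneg(1)[OF m(2) powr_ge_zero]
      by (subst integral_ball_measure_nonneg(1)[OF m(1)]) (auto simp only: eq mult_nonneg_nonneg powr_ge_zero)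
    then show "(LINT z|ball_measure (real k). wt z powr - (s * r) * ?K z a) \<le> C2 * wt a powr - (s * r)"
      using C2(3)[OF a] by simp
  qed
  show ?thesis
  proof (rule that[of "(C3 * C2 / ?V) powr (1 / r)"])
    show "0 < (C3 * C2 / ?V) powr (1 / r)" using C3 C2 V by simp
    fix A x assume A: "finite A" "A \<subseteq> S"
    let ?f = "\<lambda>z. \<Sum>a\<in>A. x a * normalized_kernel k r a z"
    let ?G = "\<lambda>z. C3 * (\<Sum>a\<in>A. norm (x a) powr r * wt a powr (s * r) * (wt z powr - (s * r) * ?K z a))"
    have aw: "0 < wt a" "a \<in> ball 0 1" if "a \<in> A" for a
      using that A(2) S wt_pos[of a] by blast+
    have fm[measurable]: "?f \<in> borel_measurable borel"
      unfolding normalized_kernel_def by measurable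
    have intG: "integrable (ball_measure (real k)) ?G"
      by (intro integrable_mult_right Bochner_Integration.integrable_sum trade aw)
    have "(LINT z|ball_measure (real k). norm (?f z) powr r) \<le> (LINT z|ball_measure (real k). ?G z)"
    proof (rule integral_mono_AE')
      show "AE z in ball_measure (real k). norm (?f z) powr r \<le> ?G z"
        using AE_ball_measure by eventually_elim (rule point[OF A])
      show "AE z in ball_measure (real k). 0 \<le> ?G z"
        using C3 by (intro AE_I2 mult_nonneg_nonneg sum_nonneg) simp_all
    qed (rule intG)
    also have "\<dots> = C3 * (\<Sum>a\<in>A. norm (x a) powr r * wt a powr (s * r) * (LINT z|ball_measure (real k). wt z powr - (s * r) * ?K z a))"
    proof -
      have "(LINT z|ball_measure (real k). (\<Sum>a\<in>A. norm (x a) powr r * wt a powr (s * r) * (wt z powr - (s * r) * ?K z a)))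
        = (\<Sum>a\<in>A. LINT z|ball_measure (real k). norm (x a) powr r * wt a powr (s * r) * (wt z powr - (s * r) * ?K z a))"
        by (rule Bochner_Integration.integral_sum) (intro integrable_mult_right trade aw)
      then show ?thesis by (simp only: integral_mult_right_zero)
    qed
    also have "\<dots> \<le> C3 * (\<Sum>a\<in>A. norm (x a) powr r * wt a powr (s * r) * (C2 * wt a powr - (s * r)))"
      by (intro mult_left_mono sum_mono trade aw mult_nonneg_nonneg powr_ge_zero less_imp_le[OF C3])
    also have "\<dots> = C3 * C2 * (\<Sum>a\<in>A. norm (x a) powr r)"
    proof -
      have "norm (x a) powr r * wt a powr (s * r) * (C2 * wt a powr - (s * r)) = C2 * norm (x a) powr r" if "a \<in> A" for a
        using aw(1)[OF that] by (simp add: powr_minus)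
      then have "(\<Sum>a\<in>A. norm (x a) powr r * wt a powr (s * r) * (C2 * wt a powr - (s * r))) = (\<Sum>a\<in>A. C2 * norm (x a) powr r)"
        by (rule sum.cong[OF refl])
      then show ?thesis by (simp only: sum_distrib_left[symmetric] mult.assoc)
    qed
    finally have le: "(LINT z|ball_measure (real k). norm (?f z) powr r) / ?V \<le> C3 * C2 * (\<Sum>a\<in>A. norm (x a) powr r) / ?V"
      by (rule divide_right_mono) (rule less_imp_le[OF V])
    have fm2: "(\<lambda>z. norm (?f z) powr r) \<in> borel_measurable borel"
    proof (rule measurable_compose[OF fm])
      show "(\<lambda>w::complex. norm w powr r) \<in> borel_measurable borel" by measurable
    qed
    have eq: "(LINT z|bergman_measure k. norm (?f z) powr r) = (LINT z|ball_measure (real k). norm (?f z) powr r) / ?V"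
      unfolding bergman_integral(2)[OF fm2] by (simp only: real_scaleR_def divide_inverse mult.commute)
    have "bergman_norm k r ?f \<le> (C3 * C2 * (\<Sum>a\<in>A. norm (x a) powr r) / ?V) powr (1 / r)"
      unfolding bergman_norm_def eq
    proof (rule powr_mono2[OF _ _ le])
      show "0 \<le> 1 / r" using r by simp
      show "0 \<le> (LINT z|ball_measure (real k). norm (?f z) powr r) / ?V"
        by (intro divide_nonneg_nonneg Bochner_Integration.integral_nonneg powr_ge_zero less_imp_le[OF V])
    qed
    also have "\<dots> = (C3 * C2 / ?V) powr (1 / r) * (\<Sum>a\<in>A. norm (x a) powr r) powr (1 / r)"
      by (simp only: powr_mult[symmetric] times_divide_eq_left)
    finally show "bergman_norm k r ?f \<le> (C3 * C2 / ?V) powr (1 / r) * (\<Sum>a\<in>A. norm (x a) powr r) powr (1 / r)" .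
  qed
qed

section \<open>Duality and restriction to the sequence\<close>

lemma lp_norm_nonneg: "0 \<le> lp_norm q S x"
  by (simp add: lp_norm_def)

lemma lp_partial_sum_le:
  assumes "x \<in> lp_space q S" "finite F" "F \<subseteq> S" "0 < q"
  shows "(\<Sum>a\<in>F. norm (x a) powr q) powr (1 / q) \<le> lp_norm q S x"
  unfolding lp_norm_def
  using assms
  by (intro powr_mono2 finite_sum_le_infsum) (auto simp: lp_space_def sum_nonneg)

lemma lp_finite_support:
  assumes "finite F" "F \<subseteq> S" "\<And>a. a \<notin> F \<Longrightarrow> x a = 0" "0 < q"
  shows "x \<in> lp_space q S" "lp_norm q S x = (\<Sum>a\<in>F. norm (x a) powr q) powr (1 / q)"
proof -
  have "(\<lambda>a. norm (x a) powr q) summable_on F" using assms(1) by simp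
  then have "(\<lambda>a. norm (x a) powr q) summable_on S"
    by (rule summable_on_cong_neutral[THEN iffD1, rotated -1]) (use assms in auto)
  then show "x \<in> lp_space q S" using assms by (auto simp: lp_space_def)
  have "infsum (\<lambda>a. norm (x a) powr q) S = infsum (\<lambda>a. norm (x a) powr q) F"
    by (rule infsum_cong_neutral) (use assms in auto)
  then show "lp_norm q S x = (\<Sum>a\<in>F. norm (x a) powr q) powr (1 / q)"
    using assms(1) by (simp add: lp_norm_def)
qed

lemma lp_space_of_bounded_sums:
  assumes q: "0 < q" and off: "\<And>a. a \<notin> S \<Longrightarrow> x a = 0"
    and bd: "\<And>F. finite F \<Longrightarrow> F \<subseteq> S \<Longrightarrow> (\<Sum>a\<in>F. norm (x a) powr q) powr (1 / q) \<le> K"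
  shows "x \<in> lp_space q S" "lp_norm q S x \<le> K"
proof -
  have K: "0 \<le> K" using bd[of "{}"] by simp
  have le: "(\<Sum>a\<in>F. norm (x a) powr q) \<le> K powr q" if "finite F" "F \<subseteq> S" for F
  proof -
    have "((\<Sum>a\<in>F. norm (x a) powr q) powr (1 / q)) powr q \<le> K powr q"
      using bd[OF that] q by (intro powr_mono2) auto
    then show ?thesis using q by (simp add: powr_powr sum_nonneg)
  qed
  have s: "(\<lambda>a. norm (x a) powr q) summable_on S"
    by (rule nonneg_bdd_above_summable_on) (use le in \<open>auto intro!: bdd_aboveI\<close>)
  then show "x \<in> lp_space q S" using off by (auto simp: lp_space_def)
  have "infsum (\<lambda>a. norm (x a) powr q) S \<le> K powr q"
    by (rule infsum_le_finite_sums[OF s le])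
  then have "lp_norm q S x \<le> (K powr q) powr (1 / q)"
    unfolding lp_norm_def using q by (intro powr_mono2 infsum_nonneg) auto
  then show "lp_norm q S x \<le> K" using q K by (simp add: powr_powr)
qed

text \<open>Converse Hoelder inequality with the extremal y = sgn x |x|^(q-1) on F. Only families
  vanishing off F need to be tested, so the users may assume this of y.\<close>

lemma finite_lp_duality:
  fixes x :: "'a \<Rightarrow> complex"
  assumes q: "1 < q" "1 < q'" "1 / q + 1 / q' = 1" and F: "finite F" and K: "0 \<le> K"
    and bd: "\<And>y. (\<And>a. a \<notin> F \<Longrightarrow> y a = 0) \<Longrightarrow> norm (\<Sum>a\<in>F. x a * cnj (y a)) \<le> K * (\<Sum>a\<in>F. norm (y a) powr q') powr (1 / q')"
  shows "(\<Sum>a\<in>F. norm (x a) powr q) powr (1 / q) \<le> K"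
proof -
  define y where "y a = (if a \<in> F then sgn (x a) * of_real (norm (x a) powr (q - 1)) else 0)" for a
  define X where "X = (\<Sum>a\<in>F. norm (x a) powr q)"
  have X0: "0 \<le> X" by (auto simp: X_def intro: sum_nonneg)
  have xy: "x a * cnj (y a) = of_real (norm (x a) powr q)" if "a \<in> F" for a
  proof (cases "x a = 0")
    case False
    have "x a * cnj (sgn (x a)) = of_real (norm (x a))"
      using False by (simp add: sgn_eq complex_norm_square[symmetric] power2_eq_square)
    moreover have "norm (x a) * norm (x a) powr (q - 1) = norm (x a) powr q"
      using False by (simp add: powr_mult_base)
    ultimately show ?thesis using that by (simp add: y_def flip: mult.assoc of_real_mult)
  qed (use q in \<open>simp add: y_def\<close>)
  have ny: "norm (y a) powr q' = norm (x a) powr q" if "a \<in> F" for a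
  proof (cases "x a = 0")
    case False
    have "(q - 1) * q' = q" using q by (simp add: field_simps)
    then show ?thesis using False that by (simp add: y_def norm_mult norm_sgn powr_powr)
  qed (use q in \<open>simp add: y_def\<close>)
  have "(\<Sum>a\<in>F. x a * cnj (y a)) = of_real X" using xy by (simp add: X_def)
  then have nX: "norm (\<Sum>a\<in>F. x a * cnj (y a)) = X" using X0 by simp
  have sy: "(\<Sum>a\<in>F. norm (y a) powr q') = X" using ny by (simp add: X_def)
  have "X \<le> K * X powr (1 / q')"
    using bd[of y] unfolding nX sy by (simp add: y_def)
  show ?thesis
  proof (cases "X = 0")
    case False
    have "X = X powr (1 / q) * X powr (1 / q')" using X0 q by (simp add: powr_add[symmetric])
    then have "X powr (1 / q) * X powr (1 / q') \<le> K * X powr (1 / q')"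
      using \<open>X \<le> K * X powr (1 / q')\<close> by simp
    moreover have "0 < X powr (1 / q')" using False X0 by simp
    ultimately show ?thesis unfolding X_def[symmetric] by (rule mult_right_le_imp_le)
  qed (use K in \<open>simp add: X_def[symmetric]\<close>)
qed

lemma norm_has_sum_le:
  fixes f :: "'a \<Rightarrow> complex"
  assumes "(f has_sum s) S" "\<And>F. finite F \<Longrightarrow> F \<subseteq> S \<Longrightarrow> norm (sum f F) \<le> K"
  shows "norm s \<le> K"
proof (rule tendsto_upperbound)
  show "((\<lambda>F. norm (sum f F)) \<longlongrightarrow> norm s) (finite_subsets_at_top S)"
    using assms(1) unfolding has_sum_def by (rule tendsto_norm)
  show "\<forall>\<^sub>F F in finite_subsets_at_top S. norm (sum f F) \<le> K"
    using assms(2) by (auto intro: eventually_finite_subsets_at_top_weakI)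
qed simp

section \<open>Linear structure of the Bergman spaces\<close>

lemma norm_add_powr_le:
  fixes x y :: complex
  assumes "0 < p"
  shows "norm (x + y) powr p \<le> 2 powr p * (norm x powr p + norm y powr p)"
proof -
  have "norm (x + y) powr p \<le> (2 * max (norm x) (norm y)) powr p"
    using assms norm_triangle_ineq[of x y] by (intro powr_mono2) auto
  also have "\<dots> = 2 powr p * max (norm x) (norm y) powr p"
    by (rule powr_mult)
  also have "\<dots> \<le> 2 powr p * (norm x powr p + norm y powr p)"
    by (intro mult_left_mono) (auto simp: max_def)
  finally show ?thesis .
qed

lemma bergman_space_cmult: "f \<in> bergman_space k p \<Longrightarrow> (\<lambda>z. c * f z) \<in> bergman_space k p"
  by (auto simp: bergman_space_iff hol_ball_cmult norm_mult powr_mult)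

lemma bergman_space_add:
  fixes f g :: "complex ^ 'n \<Rightarrow> complex"
  assumes p: "0 < p" and f: "f \<in> bergman_space k p" and g: "g \<in> bergman_space k p"
  shows "(\<lambda>z. f z + g z) \<in> bergman_space k p"
proof -
  have h: "hol_ball (\<lambda>z. f z + g z)" using f g by (auto simp: bergman_space_iff intro: hol_ball_add)
  have fm: "(\<lambda>z. f z + g z) \<in> borel_measurable borel" by (rule hol_ball_measurable[OF h])
  have "integrable (bergman_measure k) (\<lambda>z. norm (f z + g z) powr p)"
  proof (rule Bochner_Integration.integrable_bound)
    show "integrable (bergman_measure k) (\<lambda>z. 2 powr p * (norm (f z) powr p + norm (g z) powr p))"
      using f g by (auto simp: bergman_space_iff)
    show "AE z in bergman_measure k. norm (norm (f z + g z) powr p) \<le> norm (2 powr p * (norm (f z) powr p + norm (g z) powr p))"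
      using norm_add_powr_le[OF p] by (intro AE_I2) (simp add: abs_of_nonneg)
    show "(\<lambda>z. norm (f z + g z) powr p) \<in> borel_measurable (bergman_measure k)"
      using measurable_compose[OF fm, of "\<lambda>w. norm w powr p" borel] by (simp cong: measurable_cong_sets)
  qed
  then show ?thesis using h by (simp add: bergman_space_iff)
qed

lemma bergman_space_zero: "(\<lambda>z. 0) \<in> bergman_space k p"
  by (auto simp: bergman_space_def holomorphic_several_const)

lemma bergman_space_sum:
  assumes "0 < p" "\<And>i. i \<in> A \<Longrightarrow> f i \<in> bergman_space k p"
  shows "(\<lambda>z. \<Sum>i\<in>A. f i z) \<in> bergman_space k p"
  using assms(2)
  by (induction A rule: infinite_finite_induct) (auto intro: bergman_space_zero bergman_space_add[OF assms(1)])

lemma bergman_space_diff: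
  assumes "0 < p" "f \<in> bergman_space k p" "g \<in> bergman_space k p"
  shows "(\<lambda>z. f z - g z) \<in> bergman_space k p"
  using bergman_space_add[OF assms(1,2) bergman_space_cmult[OF assms(3), of "-1"]] by simp

text \<open>A quasi-norm inequality from the elementary bound for powers of a sum is enough; the
  constant 4 only enlarges the final constant.\<close>

lemma bergman_norm_add_le:
  fixes f g :: "complex ^ 'n \<Rightarrow> complex"
  assumes p: "1 \<le> p" and f: "f \<in> bergman_space k p" and g: "g \<in> bergman_space k p"
  shows "bergman_norm k p (\<lambda>z. f z + g z) \<le> 4 * (bergman_norm k p f + bergman_norm k p g)"
proof -
  have p0: "0 < p" using p by simp
  let ?F = "bergman_norm k p f" and ?G = "bergman_norm k p g"
  have "(LINT z|bergman_measure k. norm (f z + g z) powr p) \<le> (LINT z|bergman_measure k. 2 powr p * (norm (f z) powr p + norm (g z) powr p))"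
    using bergman_space_add[OF p0 f g] f g norm_add_powr_le[OF p0]
    by (intro integral_mono) (auto simp: bergman_space_iff)
  also have "\<dots> = 2 powr p * (?F powr p + ?G powr p)"
    using f g by (simp add: bergman_space_iff integral_bergman_norm[OF p0])
  also have "\<dots> \<le> 2 powr p * (2 * (?F + ?G) powr p)"
  proof -
    have "?F powr p \<le> (?F + ?G) powr p" "?G powr p \<le> (?F + ?G) powr p"
      using p0 by (auto intro!: powr_mono2 bergman_norm_nonneg simp: bergman_norm_nonneg)
    then show ?thesis by (intro mult_left_mono) auto
  qed
  also have "\<dots> \<le> 2 powr p * (2 powr p * (?F + ?G) powr p)"
  proof -
    have "2 powr 1 \<le> 2 powr p" using p by (intro powr_mono) auto
    then show ?thesis by (intro mult_left_mono mult_right_mono) auto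
  qed
  also have "\<dots> = (4 * (?F + ?G)) powr p"
    by (simp add: powr_mult[symmetric])
  finally have "(LINT z|bergman_measure k. norm (f z + g z) powr p) powr (1 / p) \<le> ((4 * (?F + ?G)) powr p) powr (1 / p)"
    using p0 by (intro powr_mono2) auto
  then show ?thesis
    unfolding bergman_norm_def[of k p "\<lambda>z. f z + g z"] using p0 by (simp add: powr_powr bergman_norm_nonneg)
qed

section \<open>Normalized kernels as point evaluations\<close>

abbreviation ker_norm :: "nat \<Rightarrow> real \<Rightarrow> complex ^ 'n \<Rightarrow> real" where
  "ker_norm k r a \<equiv> bergman_norm k r (bergman_kernel k a)"

lemma ker_norm_pos:
  fixes a :: "complex ^ 'n"
  assumes "1 < r" "a \<in> ball 0 1"
  shows "0 < ker_norm k r a"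
proof -
  obtain c where "0 < c" "\<And>a::complex ^ 'n. a \<in> ball 0 1 \<Longrightarrow>
       c * wt a powr - (real (CARD('n) + k + 1) * (1 - 1 / r)) \<le> ker_norm k r a"
    by (rule bergman_kernel_norm_estimate[OF assms(1), of k, where 'n = 'n]) blast
  moreover have "0 < c * wt a powr - (real (CARD('n) + k + 1) * (1 - 1 / r))"
    using \<open>0 < c\<close> wt_pos[OF assms(2)] by simp
  ultimately show ?thesis using assms(2) by (meson less_le_trans)
qed

lemma normalized_kernel_in_space:
  assumes "a \<in> ball 0 1" "0 < s"
  shows "normalized_kernel k r a \<in> bergman_space k s"
  using bergman_space_cmult[OF bergman_kernel_in_space[OF assms], of "1 / of_real (ker_norm k r a)" k]
  by (simp add: normalized_kernel_def[abs_def])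

lemma pairing_normalized_kernel:
  assumes "1 \<le> p" "f \<in> bergman_space k p" "a \<in> ball 0 1"
  shows "bergman_pairing k f (normalized_kernel k r a) = f a / of_real (ker_norm k r a)"
proof -
  have "bergman_pairing k f (normalized_kernel k r a) = bergman_pairing k f (bergman_kernel k a) / of_real (ker_norm k r a)"
    by (simp add: bergman_pairing_def normalized_kernel_def flip: integral_divide_zero)
  then show ?thesis using bergman_reproducing[OF assms] by simp
qed

lemma bergman_pairing_cnj: "cnj (bergman_pairing k f g) = bergman_pairing k g f"
  unfolding bergman_pairing_def by (subst Bochner_Integration.integral_cnj[symmetric]) (simp add: mult.commute)

lemma bergman_pairing_sum_left:
  assumes "1 < p" "1 < p'" "1 / p + 1 / p' = 1"
    and f: "\<And>i. i \<in> A \<Longrightarrow> f i \<in> bergman_space k p" and g: "g \<in> bergman_space k p'"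
  shows "bergman_pairing k (\<lambda>z. \<Sum>i\<in>A. c i * f i z) g = (\<Sum>i\<in>A. c i * bergman_pairing k (f i) g)"
proof -
  have "bergman_pairing k (\<lambda>z. \<Sum>i\<in>A. c i * f i z) g = (LINT z|bergman_measure k. (\<Sum>i\<in>A. c i * (f i z * cnj (g z))))"
    by (simp add: bergman_pairing_def sum_distrib_right mult.assoc)
  also have "\<dots> = (\<Sum>i\<in>A. LINT z|bergman_measure k. c i * (f i z * cnj (g z)))"
    by (rule Bochner_Integration.integral_sum) (intro integrable_mult_right bergman_Holder(2)[OF assms(1-3)] f g)
  finally show ?thesis by (simp add: bergman_pairing_def)
qed

lemma bergman_point_bound:
  fixes f :: "complex ^ 'n \<Rightarrow> complex"
  assumes p: "1 < p" "1 < p'" "1 / p + 1 / p' = 1" and f: "f \<in> bergman_space k p" and z: "z \<in> ball 0 1"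
  shows "norm (f z) \<le> bergman_norm k p f * ker_norm k p' z"
proof -
  have "f z = bergman_pairing k f (bergman_kernel k z)"
    using bergman_reproducing[OF _ f z] p by simp
  also have "norm \<dots> \<le> bergman_norm k p f * ker_norm k p' z"
    unfolding bergman_pairing_def
    by (rule bergman_Holder(3)[OF p f]) (use bergman_kernel_in_space[OF z] p in auto)
  finally show ?thesis .
qed

text \<open>On the box of size 1/8 at a, the function \<open>\<rho> a\<close> is at most M, a
  constant multiple of its own value at a, since kernel norms are comparable there. A function that
  drops from that value to 0 at b must have room to do so: the Schwarz lemma on the complex line
  through a and b keeps b out of a smaller box.\<close>

lemma separated_of_dual_family:
  fixes S :: "(complex ^ 'n) set"
  assumes S: "S \<subseteq> ball 0 1" and p: "1 < p" "1 < p'" "1 / p + 1 / p' = 1" and B: "0 < B"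
    and \<rho>: "\<And>a. a \<in> S \<Longrightarrow> \<rho> a \<in> bergman_space k p" "\<And>a. a \<in> S \<Longrightarrow> bergman_norm k p (\<rho> a) \<le> B"
    and diag: "\<And>a. a \<in> S \<Longrightarrow> \<rho> a a = of_real (ker_norm k p' a)"
    and off: "\<And>a b. a \<in> S \<Longrightarrow> b \<in> S \<Longrightarrow> a \<noteq> b \<Longrightarrow> \<rho> a b = 0"
  obtains \<epsilon> where "0 < \<epsilon>" "box_separated \<epsilon> S"
proof -
  let ?e = "real (CARD('n) + k + 1) * (1 - 1 / p')"
  have e0: "0 \<le> ?e" using p by simp
  obtain c C where cC: "0 < c" "0 < C"
    "\<And>a::complex ^ 'n. a \<in> ball 0 1 \<Longrightarrow> c * wt a powr - ?e \<le> ker_norm k p' a"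
    "\<And>a::complex ^ 'n. a \<in> ball 0 1 \<Longrightarrow> ker_norm k p' a \<le> C * wt a powr - ?e"
    by (rule bergman_kernel_norm_estimate[OF p(2), of k, where 'n = 'n]) blast
  \<comment> \<open>At t = t0 the Schwarz bound 3 M t meets the lower estimate of the kernel norm at
    a. The powers of \<open>wt a\<close> cancel, so t0 does not depend on a.\<close>
  define t0 where "t0 = c / (3 * (B * C * 2 powr ?e))"
  define t where "t = min (1 / 2) (t0 / 2)"
  have t0: "0 < t0" using cC B by (simp add: t0_def)
  then have t: "0 < t" "t < 1" "t < t0" by (auto simp: t_def min_def)
  have "b - a \<notin> kbox (t / 8) a" if a: "a \<in> S" and b: "b \<in> S" and "a \<noteq> b" for a b
  proof
    assume ba: "b - a \<in> kbox (t / 8) a"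
    have aB: "a \<in> ball 0 1" using a S by blast
    note w = wt_pos[OF aB]
    \<comment> \<open>Rescaling makes b the point with parameter t on the disc a + \<zeta> v, whose
      image for |\<zeta>| < 1 stays in the larger box. The difference of two values there is at most
      2 M; dividing by 3 M gives the strict bound that the Schwarz lemma requires.\<close>
    define v where "v = (1 / t) *\<^sub>R (b - a)"
    have v: "v \<in> kbox (1 / 8) a"
      using ba t by (simp add: kbox_def v_def norm_mult norm_divide pos_divide_less_eq mult.commute)
    define M where "M = B * C * 2 powr ?e * wt a powr - ?e"
    have M: "0 < M" using B cC w by (simp add: M_def)
    have vz: "\<zeta> *s v \<in> kbox (1 / 8) a" if "norm \<zeta> < 1" for \<zeta>
      using v that mult_right_mono[of "norm \<zeta>" 1 "norm v"] mult_right_mono[of "norm \<zeta>" 1 "norm (cip v a)"]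
      by (auto simp: kbox_def norm_mult)
    have inB: "a + \<zeta> *s v \<in> ball 0 1" if "norm \<zeta> < 1" for \<zeta>
      using kbox_wt(3)[OF aB _ _ vz[OF that]] by simp
    have fM: "norm (\<rho> a (a + \<zeta> *s v)) \<le> M" if "norm \<zeta> < 1" for \<zeta>
    proof -
      let ?z = "a + \<zeta> *s v"
      have "norm (\<rho> a ?z) \<le> bergman_norm k p (\<rho> a) * ker_norm k p' ?z"
        by (rule bergman_point_bound[OF p \<rho>(1)[OF a] inB[OF that]])
      also have "\<dots> \<le> B * (C * wt ?z powr - ?e)"
        using B by (intro mult_mono \<rho>(2) a cC(4) inB that bergman_norm_nonneg) auto
      also have "wt ?z powr - ?e \<le> (wt a / 2) powr - ?e"
        using kbox_wt(1)[OF aB _ _ vz[OF that]] w e0 by (intro powr_mono2') auto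
      also have "(wt a / 2) powr - ?e = 2 powr ?e * wt a powr - ?e"
        by (simp add: powr_divide powr_minus_divide)
      finally show ?thesis using B cC by (simp add: M_def mult_ac)
    qed
    let ?g = "\<lambda>\<zeta>. (\<rho> a (a + \<zeta> *s v) - \<rho> a a) / of_real (3 * M)"
    have "norm (?g (of_real t)) \<le> norm (of_real t :: complex)"
    proof (rule Schwarz_Lemma(1))
      have "(\<lambda>\<zeta>. \<rho> a (a + \<zeta> *s v)) holomorphic_on ball 0 1"
        by (rule holomorphic_several_slice) (use \<rho>(1)[OF a] inB in \<open>auto simp: bergman_space_iff hol_ball_def\<close>)
      then show "?g holomorphic_on ball 0 1"
        by (intro holomorphic_intros) (use M in auto)
      show "?g 0 = 0" by simp
      fix \<zeta> :: complex assume \<zeta>: "norm \<zeta> < 1"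
      have "norm (\<rho> a (a + \<zeta> *s v) - \<rho> a a) \<le> M + M"
        using norm_triangle_ineq4[of "\<rho> a (a + \<zeta> *s v)" "\<rho> a a"] fM[OF \<zeta>] fM[of 0] by simp
      also have "\<dots> < 3 * M" using M by simp
      finally show "norm (?g \<zeta>) < 1" using M by (simp add: norm_divide norm_mult)
    qed (use t in simp)
    moreover have "a + of_real t *s v = b"
      using t by (simp add: v_def vec_eq_iff scaleR_conv_of_real[where 'a=complex])
    ultimately have "norm (\<rho> a b - \<rho> a a) \<le> t * (3 * M)"
      using t M by (simp add: norm_divide norm_mult pos_divide_le_eq)
    then have "ker_norm k p' a \<le> t * (3 * M)"
      using off[OF a b \<open>a \<noteq> b\<close>] diag[OF a] by (simp add: bergman_norm_nonneg)
    also have "\<dots> < t0 * (3 * M)" using t M by simp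
    also have "\<dots> = c * wt a powr - ?e" using B cC by (simp add: t0_def M_def)
    also have "\<dots> \<le> ker_norm k p' a" by (rule cC(3)[OF aB])
    finally show False by simp
  qed
  then have "box_separated (t / 8) S" unfolding box_separated_def by blast
  then show ?thesis using that[of "t / 8"] t by simp
qed

text \<open>The restriction map f |-> f(a) / ||k_a||_{p'} is the adjoint of the synthesis map with
  exponent p', so its boundedness is the synthesis bound read through the pairing; the norm form
  follows by the converse Hoelder inequality.\<close>

lemma carleson_embedding:
  fixes S :: "(complex ^ 'n) set"
  assumes S: "S \<subseteq> ball 0 1" and \<epsilon>: "0 < \<epsilon>" "box_separated \<epsilon> S"
    and p: "1 < p" "1 < p'" "1 / p + 1 / p' = 1"
  obtains C where "0 < C"
    "\<And>F x f. finite F \<Longrightarrow> F \<subseteq> S \<Longrightarrow> f \<in> bergman_space k p \<Longrightarrow>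
      norm (\<Sum>a\<in>F. x a * cnj (f a / of_real (ker_norm k p' a))) \<le> C * (\<Sum>a\<in>F. norm (x a) powr p') powr (1 / p') * bergman_norm k p f"
    "\<And>F f. finite F \<Longrightarrow> F \<subseteq> S \<Longrightarrow> f \<in> bergman_space k p \<Longrightarrow>
      (\<Sum>a\<in>F. norm (f a / of_real (ker_norm k p' a)) powr p) powr (1 / p) \<le> C * bergman_norm k p f"
proof -
  obtain C where C: "0 < C"
    "\<And>A x. finite A \<Longrightarrow> A \<subseteq> S \<Longrightarrow>
      bergman_norm k p' (\<lambda>z. \<Sum>a\<in>A. x a * normalized_kernel k p' a z) \<le> C * (\<Sum>a\<in>A. norm (x a) powr p') powr (1 / p')"
    by (rule kernel_synthesis_bounded[OF S \<epsilon> p(2)]) blast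
  have 1: "norm (\<Sum>a\<in>F. x a * cnj (f a / of_real (ker_norm k p' a))) \<le> C * (\<Sum>a\<in>F. norm (x a) powr p') powr (1 / p') * bergman_norm k p f"
    if F: "finite F" "F \<subseteq> S" and f: "f \<in> bergman_space k p" for F x f
  proof -
    let ?X = "\<lambda>z. \<Sum>a\<in>F. x a * normalized_kernel k p' a z"
    have nk: "normalized_kernel k p' a \<in> bergman_space k p'" if "a \<in> F" for a
      by (rule normalized_kernel_in_space) (use that F S p in auto)
    have X: "?X \<in> bergman_space k p'"
      using p by (intro bergman_space_sum bergman_space_cmult nk) auto
    have p': "1 / p' + 1 / p = 1" using p by simp
    have "bergman_pairing k ?X f = (\<Sum>a\<in>F. x a * bergman_pairing k (normalized_kernel k p' a) f)"
      by (rule bergman_pairing_sum_left[OF p(2,1) p' nk f])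
    also have "\<dots> = (\<Sum>a\<in>F. x a * cnj (f a / of_real (ker_norm k p' a)))"
    proof (rule sum.cong[OF refl])
      fix a assume "a \<in> F"
      then have "bergman_pairing k f (normalized_kernel k p' a) = f a / of_real (ker_norm k p' a)"
        using F S p by (intro pairing_normalized_kernel[OF _ f]) auto
      then show "x a * bergman_pairing k (normalized_kernel k p' a) f = x a * cnj (f a / of_real (ker_norm k p' a))"
        by (metis bergman_pairing_cnj)
    qed
    finally have "norm (\<Sum>a\<in>F. x a * cnj (f a / of_real (ker_norm k p' a))) \<le> bergman_norm k p' ?X * bergman_norm k p f"
      using bergman_Holder(3)[OF p(2,1) p' X f] by (simp add: bergman_pairing_def)
    also have "\<dots> \<le> C * (\<Sum>a\<in>F. norm (x a) powr p') powr (1 / p') * bergman_norm k p f"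
      by (intro mult_right_mono C F bergman_norm_nonneg)
    finally show ?thesis .
  qed
  show ?thesis
  proof (rule that[OF C(1) 1])
    fix F and f :: "complex ^ 'n \<Rightarrow> complex" assume F: "finite F" "F \<subseteq> S" and f: "f \<in> bergman_space k p"
    show "(\<Sum>a\<in>F. norm (f a / of_real (ker_norm k p' a)) powr p) powr (1 / p) \<le> C * bergman_norm k p f"
    proof (rule finite_lp_duality[OF p F(1)])
      show "0 \<le> C * bergman_norm k p f" using C(1) by (simp add: bergman_norm_nonneg)
      fix y :: "complex ^ 'n \<Rightarrow> complex"
      have "norm (\<Sum>a\<in>F. f a / of_real (ker_norm k p' a) * cnj (y a)) = norm (cnj (\<Sum>a\<in>F. y a * cnj (f a / of_real (ker_norm k p' a))))"
        by (simp add: mult.commute)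
      also have "\<dots> \<le> C * (\<Sum>a\<in>F. norm (y a) powr p') powr (1 / p') * bergman_norm k p f"
        unfolding complex_mod_cnj by (rule 1[OF F f])
      finally show "norm (\<Sum>a\<in>F. f a / of_real (ker_norm k p' a) * cnj (y a)) \<le> C * bergman_norm k p f * (\<Sum>a\<in>F. norm (y a) powr p') powr (1 / p')"
        by (simp add: mult_ac)
    qed
  qed blast+
qed

section \<open>Besselian kernels and the lower bound\<close>

text \<open>
  Multiplying the family by unimodular \<open>cis (n b * t)\<close> with distinct frequencies and averaging
  over \<open>t\<close> isolates the diagonal (in place of random signs).
\<close>

lemma circle_diagonal_bound:
  fixes M :: "'a \<Rightarrow> 'a \<Rightarrow> complex"
  assumes B: "finite B" and n: "inj_on n B"
    and bd: "\<And>t. norm (\<Sum>b\<in>B. \<Sum>c\<in>B. M b c * cis (of_int (n b - n c) * t)) \<le> K"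
  shows "norm (\<Sum>b\<in>B. M b b) \<le> K"
proof -
  interpret C: prob_space circle_measure by (rule circle_measure_prob)
  have int: "integrable circle_measure (\<lambda>t. M b c * cis (of_int (n b - n c) * t))" for b c
    by (rule integrable_circle_bounded[of _ "norm (M b c)"]) (auto simp: norm_mult)
  let ?h = "\<lambda>t. \<Sum>b\<in>B. \<Sum>c\<in>B. M b c * cis (of_int (n b - n c) * t)"
  have "(LINT t|circle_measure. ?h t) = (\<Sum>b\<in>B. \<Sum>c\<in>B. LINT t|circle_measure. M b c * cis (of_int (n b - n c) * t))"
    by (subst Bochner_Integration.integral_sum, intro Bochner_Integration.integrable_sum int)
       (intro sum.cong refl Bochner_Integration.integral_sum int)
  also have "\<dots> = (\<Sum>b\<in>B. \<Sum>c\<in>B. if c = b then M b b else 0)"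
  proof (intro sum.cong refl)
    fix b c assume bc: "b \<in> B" "c \<in> B"
    have "n b - n c = 0 \<longleftrightarrow> c = b" using n bc by (auto simp: inj_on_def)
    then show "(LINT t|circle_measure. M b c * cis (of_int (n b - n c) * t)) = (if c = b then M b b else 0)"
      unfolding integral_mult_right_zero circle_orthogonality by auto
  qed
  also have "\<dots> = (\<Sum>b\<in>B. M b b)" using B by simp
  finally have eq: "(LINT t|circle_measure. ?h t) = (\<Sum>b\<in>B. M b b)" .
  have "norm (LINT t|circle_measure. ?h t) \<le> (LINT t|circle_measure. norm (?h t))"
    by (rule integral_norm_bound)
  also have "\<dots> \<le> (LINT t|circle_measure. K)"
    by (intro integral_mono integrable_norm Bochner_Integration.integrable_sum int) (use bd in auto)
  also have "\<dots> = K" by (simp add: C.prob_space[simplified])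
  finally show ?thesis unfolding eq .
qed

text \<open>Since 1/r = 1/p + 1/q, this is Hoelder's inequality for the r-th powers with exponents p
  / r = p - 1 and q / r = (p - 1) / (p - 2).\<close>

lemma bergman_product:
  fixes f g :: "complex ^ 'n \<Rightarrow> complex"
  assumes p: "2 < p" and q: "1 / q = 1 - 2 / p" and r: "1 / p + 1 / r = 1"
    and f: "f \<in> bergman_space k p" and g: "g \<in> bergman_space k q"
  shows "(\<lambda>z. f z * g z) \<in> bergman_space k r"
    and "bergman_norm k r (\<lambda>z. f z * g z) \<le> bergman_norm k p f * bergman_norm k q g"
proof -
  have qe: "q = p / (p - 2)"
  proof -
    have "1 / q = (p - 2) / p" using q p by (simp add: field_simps)
    then have "1 / (1 / q) = 1 / ((p - 2) / p)" by simp
    then show ?thesis by simp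
  qed
  have re: "r = p / (p - 1)"
  proof -
    have "1 / r = (p - 1) / p" using r p by (simp add: field_simps)
    then have "1 / (1 / r) = 1 / ((p - 1) / p)" by simp
    then show ?thesis by simp
  qed
  have r0: "0 < r" using p by (simp add: re)
  define s where "s = p - 1"
  define s' where "s' = (p - 1) / (p - 2)"
  have s: "1 < s" "1 < s'" "1 / s + 1 / s' = 1"
    using p by (auto simp: s_def s'_def field_simps)
  have e1: "r * s = p" "r * s' = q" using p by (auto simp: re qe s_def s'_def)
  have [measurable]: "f \<in> borel_measurable borel" "g \<in> borel_measurable borel"
    using f g by (auto simp: bergman_space_iff hol_ball_measurable)
  have pf: "(norm (f z) powr r) powr s = norm (f z) powr p" for z by (simp add: powr_powr e1)
  have pg: "(norm (g z) powr r) powr s' = norm (g z) powr q" for z by (simp add: powr_powr e1)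
  note H = Holder_integral[OF s, of "\<lambda>z. norm (f z) powr r" "bergman_measure k" "\<lambda>z. norm (g z) powr r"]
  have int: "integrable (bergman_measure k) (\<lambda>z. norm (f z) powr r * norm (g z) powr r)"
    and le: "(LINT z|bergman_measure k. norm (f z) powr r * norm (g z) powr r) \<le>
       (LINT z|bergman_measure k. norm (f z) powr p) powr (1 / s) * (LINT z|bergman_measure k. norm (g z) powr q) powr (1 / s')"
    using H f g unfolding pf pg by (auto simp: bergman_space_iff cong: measurable_cong_sets)
  have eq: "norm (f z * g z) powr r = norm (f z) powr r * norm (g z) powr r" for z
    by (simp add: norm_mult powr_mult)
  show "(\<lambda>z. f z * g z) \<in> bergman_space k r"
    using f g int by (simp add: bergman_space_iff eq hol_ball_mult)
  have "bergman_norm k r (\<lambda>z. f z * g z) \<le> ((LINT z|bergman_measure k. norm (f z) powr p) powr (1 / s) * (LINT z|bergman_measure k. norm (g z) powr q) powr (1 / s')) powr (1 / r)"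
    unfolding bergman_norm_def eq using r0 by (intro powr_mono2 le Bochner_Integration.integral_nonneg) auto
  also have "\<dots> = bergman_norm k p f * bergman_norm k q g"
  proof -
    have "1 / s * (1 / r) = 1 / p" "1 / s' * (1 / r) = 1 / q" by (simp_all add: e1[symmetric])
    then show ?thesis unfolding bergman_norm_def powr_mult powr_powr by simp
  qed
  finally show "bergman_norm k r (\<lambda>z. f z * g z) \<le> bergman_norm k p f * bergman_norm k q g" .
qed

text \<open>To bound y it suffices to test it against \<nu> in the dual sequence space, and for that
  to have a function h in the space with exponent p' whose pairings with the k_{b,p} are the
  \<nu>_b. The product of an extension of one factor of \<nu> and a kernel sum built from the other
  is such a function on the diagonal, with norm controlled by Hoelder; pairing it with the sum of
  the y_b k_{b,p} gives the bound.\<close>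

lemma kernels_besselian:
  fixes S :: "(complex ^ 'n) set"
  assumes S: "S \<subseteq> ball 0 1" and \<epsilon>: "0 < \<epsilon>" "box_separated \<epsilon> S" and p: "2 < p" and p': "1 / p + 1 / p' = 1"
    and D: "0 < D"
    and ext: "\<And>F c. finite F \<Longrightarrow> F \<subseteq> S \<Longrightarrow> \<exists>f \<in> bergman_space k p.
        bergman_norm k p f \<le> D * (\<Sum>a\<in>F. norm (c a) powr p) powr (1 / p) \<and> (\<forall>a\<in>F. f a = c a * of_real (ker_norm k p' a))"
  obtains C where "0 < C"
    "\<And>B y. finite B \<Longrightarrow> B \<subseteq> S \<Longrightarrow>
      (\<Sum>b\<in>B. norm (y b) powr p) powr (1 / p) \<le> C * bergman_norm k p (\<lambda>z. \<Sum>b\<in>B. y b * normalized_kernel k p b z)"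
proof -
  let ?N = "real (CARD('n) + k + 1)"
  define q where "q = p / (p - 2)"
  have q: "1 < q" "1 / q = 1 - 2 / p" using p by (auto simp: q_def field_simps)
  have p1: "1 < p" using p by simp
  have p'1: "1 < p'"
  proof -
    have "1 / p' = (p - 1) / p" using p p' by (simp add: field_simps)
    then have "1 / (1 / p') = 1 / ((p - 1) / p)" by simp
    then have "p' = p / (p - 1)" by simp
    then show ?thesis using p by simp
  qed
  obtain C1 where C1: "0 < C1" "\<And>A x. finite A \<Longrightarrow> A \<subseteq> S \<Longrightarrow>
      bergman_norm k q (\<lambda>z. \<Sum>a\<in>A. x a * normalized_kernel k q a z) \<le> C1 * (\<Sum>a\<in>A. norm (x a) powr q) powr (1 / q)"
    by (rule kernel_synthesis_bounded[OF S \<epsilon> q(1)]) blast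
  obtain Cp where P: "0 < Cp" "\<And>a::complex ^ 'n. a \<in> ball 0 1 \<Longrightarrow> ker_norm k p a \<le> Cp * wt a powr - (?N * (1 - 1 / p))"
    by (rule bergman_kernel_norm_estimate[OF p1, of k, where 'n = 'n]) blast
  obtain Cq where Q: "0 < Cq" "\<And>a::complex ^ 'n. a \<in> ball 0 1 \<Longrightarrow> ker_norm k q a \<le> Cq * wt a powr - (?N * (1 - 1 / q))"
    by (rule bergman_kernel_norm_estimate[OF q(1), of k, where 'n = 'n]) blast
  obtain c' where P': "0 < c'" "\<And>a::complex ^ 'n. a \<in> ball 0 1 \<Longrightarrow> c' * wt a powr - (?N * (1 - 1 / p')) \<le> ker_norm k p' a"
    by (rule bergman_kernel_norm_estimate[OF p'1, of k, where 'n = 'n]) blast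
  \<comment> \<open>The correction that makes the diagonal entries exactly
    \<open>y b * cnj (\<nu> b)\<close>. It is bounded because the powers of \<open>wt a\<close> in
    the kernel norms balance: (1 - 1/p) + (1 - 1/q) = (1 - 1/p') + 1.\<close>
  define \<gamma> where "\<gamma> a = ker_norm k p a * ker_norm k q a / (ker_norm k p' a * wt a powr - ?N)" for a :: "complex ^ 'n"
  define \<Gamma> where "\<Gamma> = Cp * Cq / c'"
  have \<Gamma>: "0 < \<Gamma>" using P Q P' by (simp add: \<Gamma>_def)
  have \<gamma>: "0 \<le> \<gamma> a" "\<gamma> a \<le> \<Gamma>" if a: "a \<in> ball 0 1" for a :: "complex ^ 'n"
  proof -
    note w = wt_pos[OF a]
    show "0 \<le> \<gamma> a" by (simp add: \<gamma>_def bergman_norm_nonneg)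
    have "\<gamma> a \<le> (Cp * wt a powr - (?N * (1 - 1 / p))) * (Cq * wt a powr - (?N * (1 - 1 / q))) / ((c' * wt a powr - (?N * (1 - 1 / p'))) * wt a powr - ?N)"
      unfolding \<gamma>_def using P Q P' w a
      by (intro frac_le mult_mono mult_right_mono) (auto simp: bergman_norm_nonneg)
    also have "\<dots> = \<Gamma> * (wt a powr - (?N * (1 - 1 / p)) * wt a powr - (?N * (1 - 1 / q)) / (wt a powr - (?N * (1 - 1 / p')) * wt a powr - ?N))"
    proof -
      have "Cp * x * (Cq * y) / (c' * z * u) = Cp * Cq / c' * (x * y / (z * u))" for x y z u :: real
        unfolding times_divide_times_eq by (simp only: mult_ac)
      then show ?thesis unfolding \<Gamma>_def .
    qed
    also have "wt a powr - (?N * (1 - 1 / p)) * wt a powr - (?N * (1 - 1 / q)) = wt a powr - (?N * (1 - 1 / p')) * wt a powr - ?N"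
    proof -
      have "- (?N * (1 - 1 / p)) + - (?N * (1 - 1 / q)) = - ?N * (2 - 1 / p - 1 / q)" by (simp add: algebra_simps)
      also have "2 - 1 / p - 1 / q = (1 - 1 / p') + 1" using p' q(2) by simp
      also have "- ?N * ((1 - 1 / p') + 1) = - (?N * (1 - 1 / p')) + - ?N" by (simp add: algebra_simps)
      finally show ?thesis by (simp only: powr_add[symmetric])
    qed
    finally show "\<gamma> a \<le> \<Gamma>" using w by simp
  qed
  define K where "K = D * (C1 * \<Gamma>)"
  have K: "0 < K" using D C1 \<Gamma> by (simp add: K_def)
  show ?thesis
  proof (rule that[OF K])
    fix B y assume B: "finite B" "B \<subseteq> S"
    let ?Y = "\<lambda>z. \<Sum>b\<in>B. y b * normalized_kernel k p b z"
    have bB: "b \<in> ball 0 1" if "b \<in> B" for b using that B S by blast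
    have nk: "normalized_kernel k p b \<in> bergman_space k p" if "b \<in> B" for b
      using normalized_kernel_in_space[OF bB[OF that]] p1 by simp
    have Y: "?Y \<in> bergman_space k p"
      using p1 by (intro bergman_space_sum bergman_space_cmult nk) auto
    show "(\<Sum>b\<in>B. norm (y b) powr p) powr (1 / p) \<le> K * bergman_norm k p ?Y"
    proof (rule finite_lp_duality[OF p1 p'1 p' B(1)])
      show "0 \<le> K * bergman_norm k p ?Y" using K by (simp add: bergman_norm_nonneg)
      fix \<nu> :: "complex ^ 'n \<Rightarrow> complex"
      define X where "X = (\<Sum>a\<in>B. norm (\<nu> a) powr p')"
      have X0: "0 \<le> X" by (auto simp: X_def intro: sum_nonneg)
      \<comment> \<open>Factorization of \<nu> according to 1/p' = 1/p + 1/q: the p-th powers of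
        \<open>lam\<close> and the q-th powers of \<open>\<mu>\<close> both have sum X, and the
        phase of \<nu> is put into \<open>lam\<close>.\<close>
      define lam where "lam a = sgn (\<nu> a) * of_real (norm (\<nu> a) powr (p' / p))" for a
      define \<mu> where "\<mu> a = (of_real (norm (\<nu> a) powr (p' / q)) :: complex)" for a
      have lm: "lam a * \<mu> a = \<nu> a" for a
      proof (cases "\<nu> a = 0")
        case False
        have "1 / p + 1 / q = 1 / p'" using p' q(2) by simp
        then have "p' / p + p' / q = 1" using p'1 by (simp add: field_simps)
        then have "norm (\<nu> a) powr (p' / p) * norm (\<nu> a) powr (p' / q) = norm (\<nu> a)"
          by (simp add: powr_add[symmetric])
        then show ?thesis using False by (simp add: lam_def \<mu>_def sgn_eq mult.assoc flip: of_real_mult)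
      qed (simp add: lam_def)
      have nl: "norm (lam a) powr p = norm (\<nu> a) powr p'" for a
        using p1 by (cases "\<nu> a = 0") (auto simp: lam_def norm_mult norm_sgn powr_powr)
      have nm: "norm (\<mu> a) powr q = norm (\<nu> a) powr p'" for a
        using q(1) by (simp add: \<mu>_def powr_powr)
      obtain n :: "complex ^ 'n \<Rightarrow> int" where n: "inj_on n B"
        using finite_imp_inj_to_nat_seg[OF B(1)] by (metis comp_inj_on inj_of_nat inj_on_subset top_greatest)
      \<comment> \<open>At the point b the kernel sum picks up every kernel c, not just its own; M
        collects these contributions, of which only c = b is wanted.\<close>
      define M where "M b c = y b * cnj (lam b * of_real (ker_norm k p' b) * (\<mu> c * of_real (\<gamma> c) * normalized_kernel k q c b) / of_real (ker_norm k p b))" for b c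
      have diag: "M b b = y b * cnj (\<nu> b)" if b: "b \<in> B" for b
      proof -
        note w = wt_pos[OF bB[OF b]]
        have pos: "0 < ker_norm k p b" "0 < ker_norm k q b" "0 < ker_norm k p' b"
          using ker_norm_pos bB[OF b] p1 q(1) p'1 by auto
        have "1 - cip b b = of_real (wt b)" by (simp add: cip_self)
        then have "bergman_kernel k b b = of_real (wt b powr - ?N)"
          using bB[OF b] w unfolding bergman_kernel_cip powr_minus powr_realpow[OF w]
          by simp
        then have nb: "normalized_kernel k q b b = of_real (wt b powr - ?N / ker_norm k q b)"
          by (simp add: normalized_kernel_def)
        have "of_real (ker_norm k p' b) * (of_real (\<gamma> b) * normalized_kernel k q b b) / of_real (ker_norm k p b)
           = (of_real (ker_norm k p' b * (\<gamma> b * (wt b powr - ?N / ker_norm k q b)) / ker_norm k p b) :: complex)"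
          unfolding nb by simp
        also have "ker_norm k p' b * (\<gamma> b * (wt b powr - ?N / ker_norm k q b)) / ker_norm k p b = 1"
        proof -
          have "0 < wt b powr - ?N" using w by simp
          then show ?thesis using pos unfolding \<gamma>_def by (simp add: field_simps)
        qed
        finally have one: "of_real (ker_norm k p' b) * (of_real (\<gamma> b) * normalized_kernel k q b b) / of_real (ker_norm k p b) = (1 :: complex)" by simp
        have "M b b = y b * cnj (lam b * \<mu> b * (of_real (ker_norm k p' b) * (of_real (\<gamma> b) * normalized_kernel k q b b) / of_real (ker_norm k p b)))"
          unfolding M_def by (simp add: mult_ac)
        then show ?thesis unfolding one lm by simp
      qed
      have bd: "norm (\<Sum>b\<in>B. \<Sum>c\<in>B. M b c * cis (of_int (n b - n c) * t)) \<le> K * bergman_norm k p ?Y * X powr (1 / p')" for t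
      proof -
        \<comment> \<open>Opposite phases for the two factors: after conjugation the entry (b, c)
          has frequency n b - n c, so the diagonal is unchanged. The norms of both families do not
          depend on t, hence neither does the bound.\<close>
        let ?l = "\<lambda>a. cis (- of_int (n a) * t) * lam a"
        let ?m = "\<lambda>a. cis (of_int (n a) * t) * \<mu> a * of_real (\<gamma> a)"
        obtain f where f: "f \<in> bergman_space k p" "bergman_norm k p f \<le> D * (\<Sum>a\<in>B. norm (?l a) powr p) powr (1 / p)"
          "\<And>a. a \<in> B \<Longrightarrow> f a = ?l a * of_real (ker_norm k p' a)"
          using ext[OF B, of ?l] by blast
        have nf: "bergman_norm k p f \<le> D * X powr (1 / p)"
          using f(2) by (simp add: norm_mult nl X_def)
        let ?g = "\<lambda>z. \<Sum>c\<in>B. ?m c * normalized_kernel k q c z"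
        have g: "?g \<in> bergman_space k q"
          using q(1) by (intro bergman_space_sum bergman_space_cmult normalized_kernel_in_space bB) auto
        have ng: "bergman_norm k q ?g \<le> C1 * \<Gamma> * X powr (1 / q)"
        proof -
          have "(\<Sum>a\<in>B. norm (?m a) powr q) \<le> (\<Sum>a\<in>B. \<Gamma> powr q * norm (\<nu> a) powr p')"
          proof (rule sum_mono)
            fix a assume a: "a \<in> B"
            have "norm (?m a) powr q = \<gamma> a powr q * norm (\<mu> a) powr q"
              using \<gamma>(1)[OF bB[OF a]] by (simp add: norm_mult powr_mult mult.commute)
            also have "\<dots> \<le> \<Gamma> powr q * norm (\<mu> a) powr q"
              using \<gamma>[OF bB[OF a]] q(1) by (intro mult_right_mono powr_mono2) auto
            finally show "norm (?m a) powr q \<le> \<Gamma> powr q * norm (\<nu> a) powr p'" by (simp only: nm)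
          qed
          also have "\<dots> = \<Gamma> powr q * X" by (simp add: X_def sum_distrib_left)
          finally have le: "(\<Sum>a\<in>B. norm (?m a) powr q) \<le> \<Gamma> powr q * X" .
          have "bergman_norm k q ?g \<le> C1 * (\<Sum>a\<in>B. norm (?m a) powr q) powr (1 / q)"
            by (rule C1(2)[OF B])
          also have "\<dots> \<le> C1 * (\<Gamma> powr q * X) powr (1 / q)"
            using C1(1) q(1) by (intro mult_left_mono powr_mono2 le sum_nonneg) auto
          also have "\<dots> = C1 * \<Gamma> * X powr (1 / q)"
            using \<Gamma> q(1) by (simp add: powr_mult powr_powr)
          finally show ?thesis .
        qed
        let ?h = "\<lambda>z. f z * ?g z"
        have h: "?h \<in> bergman_space k p'" and nh: "bergman_norm k p' ?h \<le> bergman_norm k p f * bergman_norm k q ?g"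
          using bergman_product[OF p q(2) p' f(1) g] by auto
        have "bergman_pairing k ?Y ?h = (\<Sum>b\<in>B. y b * bergman_pairing k (normalized_kernel k p b) ?h)"
          by (rule bergman_pairing_sum_left[OF p1 p'1 p' nk h])
        also have "\<dots> = (\<Sum>b\<in>B. \<Sum>c\<in>B. M b c * cis (of_int (n b - n c) * t))"
        proof (rule sum.cong[OF refl])
          fix b assume b: "b \<in> B"
          have "bergman_pairing k (normalized_kernel k p b) ?h = cnj (bergman_pairing k ?h (normalized_kernel k p b))"
            by (rule bergman_pairing_cnj[symmetric])
          also have "bergman_pairing k ?h (normalized_kernel k p b) = ?h b / of_real (ker_norm k p b)"
            by (rule pairing_normalized_kernel[OF less_imp_le[OF p'1] h bB[OF b]])
          also have "?h b / of_real (ker_norm k p b) = (\<Sum>c\<in>B. (lam b * of_real (ker_norm k p' b) * (\<mu> c * of_real (\<gamma> c) * normalized_kernel k q c b) / of_real (ker_norm k p b)) * (cis (- of_int (n b) * t) * cis (of_int (n c) * t)))"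
            unfolding f(3)[OF b] sum_distrib_left sum_divide_distrib by (intro sum.cong refl) (simp add: mult_ac)
          also have "cnj \<dots> = (\<Sum>c\<in>B. cnj (lam b * of_real (ker_norm k p' b) * (\<mu> c * of_real (\<gamma> c) * normalized_kernel k q c b) / of_real (ker_norm k p b)) * cis (of_int (n b - n c) * t))"
            unfolding cnj_sum by (intro sum.cong refl) (simp add: cis_mult cis_cnj algebra_simps)
          finally show "y b * bergman_pairing k (normalized_kernel k p b) ?h = (\<Sum>c\<in>B. M b c * cis (of_int (n b - n c) * t))"
            by (simp add: M_def sum_distrib_left mult.assoc)
        qed
        finally have "norm (\<Sum>b\<in>B. \<Sum>c\<in>B. M b c * cis (of_int (n b - n c) * t)) \<le> bergman_norm k p ?Y * bergman_norm k p' ?h"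
          using bergman_Holder(3)[OF p1 p'1 p' Y h] by (simp add: bergman_pairing_def)
        also have "\<dots> \<le> bergman_norm k p ?Y * ((D * X powr (1 / p)) * (C1 * \<Gamma> * X powr (1 / q)))"
          using nh mult_mono[OF nf ng] D by (intro mult_left_mono bergman_norm_nonneg) (auto simp: bergman_norm_nonneg)
        also have "\<dots> = K * bergman_norm k p ?Y * (X powr (1 / p) * X powr (1 / q))"
          by (simp add: K_def)
        also have "X powr (1 / p) * X powr (1 / q) = X powr (1 / p')"
        proof -
          have "1 / p + 1 / q = 1 / p'" using p' q(2) by simp
          then show ?thesis by (simp only: powr_add[symmetric])
        qed
        finally show ?thesis .
      qed
      have "norm (\<Sum>b\<in>B. M b b) \<le> K * bergman_norm k p ?Y * X powr (1 / p')"
        by (rule circle_diagonal_bound[OF B(1) n bd])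
      then show "norm (\<Sum>b\<in>B. y b * cnj (\<nu> b)) \<le> K * bergman_norm k p ?Y * (\<Sum>a\<in>B. norm (\<nu> a) powr p') powr (1 / p')"
        unfolding X_def by (simp add: diag cong: sum.cong)
    qed
  qed
qed

section \<open>From besselian kernels to the Grammian\<close>

lemma has_sum_finite_sum:
  fixes f :: "'b \<Rightarrow> 'a \<Rightarrow> complex"
  assumes "finite B" "\<And>b. b \<in> B \<Longrightarrow> (f b has_sum s b) S"
  shows "((\<lambda>a. \<Sum>b\<in>B. f b a) has_sum (\<Sum>b\<in>B. s b)) S"
  using assms by (induction B rule: finite_induct) (auto intro: has_sum_add has_sum_0)

theorem theorem3p6:
  fixes S :: "(complex ^ 'n) set" and k :: nat and p :: real
  assumes "2 < p"
    and "countable S" and "S \<subseteq> ball 0 1"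
    and "interpolating k p S"
    and "linear_extension_with_range k p S (kernel_span k p S)"
  shows "strictly_interpolating k p S"
proof -
  note S = \<open>S \<subseteq> ball 0 1\<close>
  define p' where "p' = conj_exp p"
  have p: "1 < p" "0 < p" and p': "1 < p'" "1 / p + 1 / p' = 1" "1 / p' + 1 / p = 1" "0 < p'"
    using \<open>2 < p\<close> by (auto simp: p'_def conj_exp_def field_simps)
  have \<kappa>: "0 < ker_norm k p' a" if "a \<in> S" for a
    using that S p' by (intro ker_norm_pos) auto
  obtain E where E_all: "bounded_linear_lp_bergman k p S E \<and>
      (\<forall>x \<in> lp_space p S. \<forall>a\<in>S. bergman_pairing k (E x) (normalized_kernel k (conj_exp p) a) = x a) \<and>
      E ` lp_space p S = kernel_span k p S"
    using \<open>linear_extension_with_range k p S (kernel_span k p S)\<close>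
    unfolding linear_extension_with_range_def by (elim exE)
  have Ex: "bergman_pairing k (E x) (normalized_kernel k p' a) = x a" if "x \<in> lp_space p S" "a \<in> S" for x a
    using E_all[THEN conjunct2, THEN conjunct1, rule_format, OF that] by (simp only: p'_def)
  have range: "E ` lp_space p S = kernel_span k p S"
    using E_all by (elim conjE)
  have E: "bounded_linear_lp_bergman k p S E"
    using E_all by (elim conjE)
  have Esp: "E x \<in> bergman_space k p" if "x \<in> lp_space p S" for x
    using E that unfolding bounded_linear_lp_bergman_def image_subset_iff by simp
  have "\<exists>D0. \<forall>x \<in> lp_space p S. bergman_norm k p (E x) \<le> D0 * lp_norm p S x"
    using E unfolding bounded_linear_lp_bergman_def by (elim conjE)
  then obtain D0 where D0: "bergman_norm k p (E x) \<le> D0 * lp_norm p S x" if "x \<in> lp_space p S" for x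
    by (elim exE) (rule that, erule bspec)
  define D where "D = max D0 1"
  have D: "0 < D" "\<And>x. x \<in> lp_space p S \<Longrightarrow> bergman_norm k p (E x) \<le> D * lp_norm p S x"
  proof -
    fix x assume "x \<in> lp_space p S"
    then have "bergman_norm k p (E x) \<le> D0 * lp_norm p S x" by (rule D0)
    also have "\<dots> \<le> D * lp_norm p S x" by (intro mult_right_mono lp_norm_nonneg) (simp add: D_def)
    finally show "bergman_norm k p (E x) \<le> D * lp_norm p S x" .
  qed (simp add: D_def)
  \<comment> \<open>The values are recorded on all of S, with zeros off F: the dual functions below
    need the zeros, and so does the identification of the restriction of f with a finite family.
    Membership in the span is what the final approximation uses.\<close>
  have ext: "\<exists>f \<in> kernel_span k p S. f \<in> bergman_space k p \<and>
        bergman_norm k p f \<le> D * (\<Sum>a\<in>F. norm (c a) powr p) powr (1 / p) \<and>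
        (\<forall>a\<in>S. f a = (if a \<in> F then c a else 0) * of_real (ker_norm k p' a))"
    if F: "finite F" "F \<subseteq> S" for F c
  proof -
    let ?x = "\<lambda>a. if a \<in> F then c a else 0"
    have x: "?x \<in> lp_space p S" "lp_norm p S ?x = (\<Sum>a\<in>F. norm (?x a) powr p) powr (1 / p)"
      using lp_finite_support[OF F, of ?x p] p by auto
    have "E ?x a = ?x a * of_real (ker_norm k p' a)" if a: "a \<in> S" for a
    proof -
      have "E ?x a / of_real (ker_norm k p' a) = ?x a"
        using Ex[OF x(1) a] pairing_normalized_kernel[OF _ Esp[OF x(1)], of a p'] p a S by auto
      moreover have nz: "(of_real (ker_norm k p' a) :: complex) \<noteq> 0" using \<kappa>[OF a] by simp
      ultimately show ?thesis by (simp only: nonzero_divide_eq_eq[OF nz])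
    qed
    moreover have "bergman_norm k p (E ?x) \<le> D * (\<Sum>a\<in>F. norm (c a) powr p) powr (1 / p)"
      using D(2)[OF x(1)] x(2) by simp
    moreover have "E ?x \<in> kernel_span k p S"
      unfolding range[symmetric] by (rule imageI[OF x(1)])
    ultimately show ?thesis using Esp[OF x(1)] by (intro bexI[of _ "E ?x"] conjI ballI) assumption+
  qed
  \<comment> \<open>Extensions of the unit sequences: the dual family to which the separation
    argument applies, with the norm of the extension operator as uniform bound.\<close>
  have "\<exists>\<rho>. \<forall>a\<in>S. \<rho> a \<in> bergman_space k p \<and> bergman_norm k p (\<rho> a) \<le> D \<and>
      (\<forall>b\<in>S. \<rho> a b = (if b = a then of_real (ker_norm k p' a) else 0))"
  proof (rule bchoice, rule ballI)
    fix a assume a: "a \<in> S"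
    show "\<exists>f. f \<in> bergman_space k p \<and> bergman_norm k p f \<le> D \<and>
      (\<forall>b\<in>S. f b = (if b = a then of_real (ker_norm k p' a) else 0))"
      using ext[of "{a}" "\<lambda>_. 1"] a by auto
  qed
  then obtain \<rho> where \<rho>: "\<And>a. a \<in> S \<Longrightarrow> \<rho> a \<in> bergman_space k p" "\<And>a. a \<in> S \<Longrightarrow> bergman_norm k p (\<rho> a) \<le> D"
      "\<And>a b. a \<in> S \<Longrightarrow> b \<in> S \<Longrightarrow> \<rho> a b = (if b = a then of_real (ker_norm k p' a) else 0)"
    by blast
  obtain \<epsilon> where \<epsilon>: "0 < \<epsilon>" "box_separated \<epsilon> S"
    by (rule separated_of_dual_family[OF S p(1) p'(1,2) D(1) \<rho>(1,2)]) (auto simp: \<rho>(3))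
  \<comment> \<open>On the Bergman space this is the pairing with k_{a,p'}. Written as a weighted
    point value it is visibly linear in f.\<close>
  define R where "R f a = f a / of_real (ker_norm k p' a)" for f :: "complex ^ 'n \<Rightarrow> complex" and a
  obtain C2 where C2: "0 < C2"
    "\<And>F x f. finite F \<Longrightarrow> F \<subseteq> S \<Longrightarrow> f \<in> bergman_space k p \<Longrightarrow>
      norm (\<Sum>a\<in>F. x a * cnj (R f a)) \<le> C2 * (\<Sum>a\<in>F. norm (x a) powr p') powr (1 / p') * bergman_norm k p f"
    "\<And>F f. finite F \<Longrightarrow> F \<subseteq> S \<Longrightarrow> f \<in> bergman_space k p \<Longrightarrow>
      (\<Sum>a\<in>F. norm (R f a) powr p) powr (1 / p) \<le> C2 * bergman_norm k p f"
    unfolding R_def by (rule carleson_embedding[OF S \<epsilon> p(1) p'(1,2)]) blast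
  obtain C3 where C3: "0 < C3"
    "\<And>B y. finite B \<Longrightarrow> B \<subseteq> S \<Longrightarrow>
      (\<Sum>b\<in>B. norm (y b) powr p) powr (1 / p) \<le> C3 * bergman_norm k p (\<lambda>z. \<Sum>b\<in>B. y b * normalized_kernel k p b z)"
  proof (rule kernels_besselian[OF S \<epsilon> \<open>2 < p\<close> p'(2) D(1)])
    fix F c assume F: "finite F" "F \<subseteq> S"
    from ext[OF this, of c] obtain f where "f \<in> bergman_space k p"
      "bergman_norm k p f \<le> D * (\<Sum>a\<in>F. norm (c a) powr p) powr (1 / p)"
      "\<forall>a\<in>S. f a = (if a \<in> F then c a else 0) * of_real (ker_norm k p' a)" by blast
    then show "\<exists>f \<in> bergman_space k p. bergman_norm k p f \<le> D * (\<Sum>a\<in>F. norm (c a) powr p) powr (1 / p) \<and>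
      (\<forall>a\<in>F. f a = c a * of_real (ker_norm k p' a))"
      using F by (intro bexI[of _ f]) auto
  qed blast
  obtain C4 where C4: "0 < C4"
    "\<And>A x. finite A \<Longrightarrow> A \<subseteq> S \<Longrightarrow>
      bergman_norm k p (\<lambda>z. \<Sum>a\<in>A. x a * normalized_kernel k p a z) \<le> C4 * (\<Sum>a\<in>A. norm (x a) powr p) powr (1 / p)"
    by (rule kernel_synthesis_bounded[OF S \<epsilon> p(1)]) blast
  have nk: "normalized_kernel k p b \<in> bergman_space k p" if "b \<in> S" for b
    by (rule normalized_kernel_in_space) (use that S p in auto)
  have Ysp: "(\<lambda>z. \<Sum>b\<in>B. y b * normalized_kernel k p b z) \<in> bergman_space k p" if "B \<subseteq> S" for B y
    using that p by (intro bergman_space_sum bergman_space_cmult nk) auto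
  have gram: "grammian k p a b = cnj (R (normalized_kernel k p b) a)" if "a \<in> S" "b \<in> S" for a b
  proof -
    have "bergman_pairing k (normalized_kernel k p b) (normalized_kernel k p' a) = R (normalized_kernel k p b) a"
      unfolding R_def using that S p by (intro pairing_normalized_kernel[OF _ nk]) auto
    then show ?thesis unfolding grammian_def p'_def[symmetric] by (metis bergman_pairing_cnj)
  qed
  \<comment> \<open>Besides the convergence demanded of the Grammian, this permits splitting the sum
    over S when f is written as a kernel sum plus a remainder.\<close>
  have summ: "(\<lambda>a. x a * cnj (R f a)) summable_on S"
    if x: "x \<in> lp_space p' S" and f: "f \<in> bergman_space k p" for x f
  proof -
    have "(\<lambda>a. norm (x a * cnj (R f a))) summable_on S"
    proof (rule nonneg_bdd_above_summable_on)
      have "(\<Sum>a\<in>F. norm (x a * cnj (R f a))) \<le> lp_norm p' S x * (C2 * bergman_norm k p f)" if F: "finite F" "F \<subseteq> S" for F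
      proof -
        have "(\<Sum>a\<in>F. norm (x a * cnj (R f a))) = (\<Sum>a\<in>F. norm (x a) * norm (R f a))"
          by (simp add: norm_mult)
        also have "\<dots> \<le> (\<Sum>a\<in>F. norm (x a) powr p') powr (1 / p') * (\<Sum>a\<in>F. norm (R f a) powr p) powr (1 / p)"
          by (rule Holder_sum[OF p'(1) p(1) p'(3) F(1)]) auto
        also have "\<dots> \<le> lp_norm p' S x * (C2 * bergman_norm k p f)"
          by (intro mult_mono lp_partial_sum_le[OF x F p'(4)] C2(3)[OF F f] lp_norm_nonneg powr_ge_zero)
        finally show ?thesis .
      qed
      then show "bdd_above (sum (\<lambda>a. norm (x a * cnj (R f a))) ` {F. F \<subseteq> S \<and> finite F})"
        by (intro bdd_aboveI) auto
    qed simp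
    then show ?thesis by (rule abs_summable_summable)
  qed
  have infb: "norm (\<Sum>\<^sub>\<infinity>a\<in>S. x a * cnj (R f a)) \<le> C2 * lp_norm p' S x * bergman_norm k p f"
    if x: "x \<in> lp_space p' S" and f: "f \<in> bergman_space k p" for x f
  proof (rule norm_has_sum_le[OF has_sum_infsum[OF summ[OF x f]]])
    fix F assume F: "finite F" "F \<subseteq> S"
    have "norm (\<Sum>a\<in>F. x a * cnj (R f a)) \<le> C2 * (\<Sum>a\<in>F. norm (x a) powr p') powr (1 / p') * bergman_norm k p f"
      by (rule C2(2)[OF F f])
    also have "\<dots> \<le> C2 * lp_norm p' S x * bergman_norm k p f"
      using C2(1) by (intro mult_right_mono mult_left_mono lp_partial_sum_le[OF x F p'(4)] bergman_norm_nonneg) auto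
    finally show "norm (\<Sum>a\<in>F. x a * cnj (R f a)) \<le> C2 * lp_norm p' S x * bergman_norm k p f" .
  qed
  let ?G = "grammian_apply k p S"
  have Gx: "?G x b = (\<Sum>\<^sub>\<infinity>a\<in>S. x a * cnj (R (normalized_kernel k p b) a))" if "b \<in> S" for x b
    unfolding grammian_apply_def using that by (simp add: gram cong: infsum_cong)
  \<comment> \<open>The Grammian factors through restriction and synthesis: its entry at (a, b) is
    the conjugate of \<open>R\<close> of k_{b,p} at a. Hence testing \<open>?G x\<close> against y
    is testing x against the restriction of the kernel sum with coefficients y.\<close>
  have GY: "(\<Sum>b\<in>B. cnj (y b) * ?G x b) = (\<Sum>\<^sub>\<infinity>a\<in>S. x a * cnj (R (\<lambda>z. \<Sum>b\<in>B. y b * normalized_kernel k p b z) a))"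
    if x: "x \<in> lp_space p' S" and B: "finite B" "B \<subseteq> S" for x B y
  proof -
    have "((\<lambda>a. \<Sum>b\<in>B. cnj (y b) * (x a * cnj (R (normalized_kernel k p b) a))) has_sum (\<Sum>b\<in>B. cnj (y b) * ?G x b)) S"
    proof (rule has_sum_finite_sum[OF B(1)])
      fix b assume "b \<in> B"
      then have b: "b \<in> S" using B by blast
      have "((\<lambda>a. x a * cnj (R (normalized_kernel k p b) a)) has_sum ?G x b) S"
        unfolding Gx[OF b] by (rule has_sum_infsum[OF summ[OF x nk[OF b]]])
      then show "((\<lambda>a. cnj (y b) * (x a * cnj (R (normalized_kernel k p b) a))) has_sum cnj (y b) * ?G x b) S"
        by (rule has_sum_cmult_right)
    qed
    also have "(\<lambda>a. \<Sum>b\<in>B. cnj (y b) * (x a * cnj (R (normalized_kernel k p b) a))) = (\<lambda>a. x a * cnj (R (\<lambda>z. \<Sum>b\<in>B. y b * normalized_kernel k p b z) a))"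
      by (simp add: R_def sum_distrib_left sum_divide_distrib mult_ac)
    finally show ?thesis by (rule infsumI[symmetric])
  qed
  \<comment> \<open>Also needed for the lower bound, where finite partial sums of
    \<open>?G x\<close> are compared with its norm.\<close>
  have upper: "?G x \<in> lp_space p' S" if x: "x \<in> lp_space p' S" for x
  proof (rule lp_space_of_bounded_sums(1)[OF p'(4)])
    show "?G x b = 0" if "b \<notin> S" for b using that by (simp add: grammian_apply_def)
    fix B assume B: "finite B" "B \<subseteq> S"
    show "(\<Sum>b\<in>B. norm (?G x b) powr p') powr (1 / p') \<le> C2 * lp_norm p' S x * C4"
    proof (rule finite_lp_duality[OF p'(1) p(1) p'(3) B(1)])
      show "0 \<le> C2 * lp_norm p' S x * C4" using C2(1) C4(1) by (simp add: lp_norm_nonneg)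
      fix y :: "complex ^ 'n \<Rightarrow> complex"
      let ?Y = "\<lambda>z. \<Sum>b\<in>B. y b * normalized_kernel k p b z"
      have "norm (\<Sum>b\<in>B. ?G x b * cnj (y b)) = norm (\<Sum>b\<in>B. cnj (y b) * ?G x b)" by (simp add: mult.commute)
      also have "\<dots> \<le> C2 * lp_norm p' S x * bergman_norm k p ?Y"
        unfolding GY[OF x B] by (rule infb[OF x Ysp[OF B(2)]])
      also have "\<dots> \<le> C2 * lp_norm p' S x * (C4 * (\<Sum>a\<in>B. norm (y a) powr p) powr (1 / p))"
        using C2(1) by (intro mult_left_mono C4(2)[OF B] mult_nonneg_nonneg lp_norm_nonneg) auto
      finally show "norm (\<Sum>b\<in>B. ?G x b * cnj (y b)) \<le> C2 * lp_norm p' S x * C4 * (\<Sum>a\<in>B. norm (y a) powr p) powr (1 / p)"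
        by (simp add: mult.assoc)
    qed
  qed
  \<comment> \<open>C3 bounds coefficients by the norm of the kernel sum, 4 comes from the
    quasi-triangle inequality, and D is the bound of the extension operator.\<close>
  define K where "K = C3 * (4 * D)"
  have K: "0 < K" using C3(1) D(1) by (simp add: K_def)
  have lower: "lp_norm p' S x \<le> K * lp_norm p' S (?G x)" if x: "x \<in> lp_space p' S" for x
  proof (rule lp_space_of_bounded_sums(2)[OF p'(4)])
    show "x a = 0" if "a \<notin> S" for a using x that by (simp add: lp_space_def)
    let ?g = "lp_norm p' S (?G x)"
    have g0: "0 \<le> ?g" by (rule lp_norm_nonneg)
    fix F assume F: "finite F" "F \<subseteq> S"
    show "(\<Sum>a\<in>F. norm (x a) powr p') powr (1 / p') \<le> K * ?g"
    proof (rule finite_lp_duality[OF p'(1) p(1) p'(3) F(1)])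
      show "0 \<le> K * ?g" using K g0 by simp
      fix l :: "complex ^ 'n \<Rightarrow> complex"
      assume off: "\<And>a. a \<notin> F \<Longrightarrow> l a = 0"
      define L where "L = (\<Sum>a\<in>F. norm (l a) powr p) powr (1 / p)"
      have L0: "0 \<le> L" by (simp add: L_def)
      obtain f where f: "f \<in> kernel_span k p S" "f \<in> bergman_space k p" "bergman_norm k p f \<le> D * L"
         "\<And>a. a \<in> S \<Longrightarrow> f a = (if a \<in> F then l a else 0) * of_real (ker_norm k p' a)"
        using ext[OF F, of l] unfolding L_def by blast
      have Rf: "R f a = l a" if "a \<in> S" for a
        using f(4)[OF that] \<kappa>[OF that] off[of a] by (simp add: R_def)
      have sf: "(\<Sum>a\<in>F. x a * cnj (l a)) = (\<Sum>\<^sub>\<infinity>a\<in>S. x a * cnj (R f a))"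
      proof -
        have "(\<Sum>\<^sub>\<infinity>a\<in>S. x a * cnj (R f a)) = (\<Sum>\<^sub>\<infinity>a\<in>F. x a * cnj (l a))"
          by (rule infsum_cong_neutral) (use Rf F off in auto)
        then show ?thesis using F(1) by simp
      qed
      define T where "T = norm (\<Sum>a\<in>F. x a * cnj (l a))"
      have approx: "T \<le> K * ?g * L + \<delta> * (C2 * lp_norm p' S x + C3 * 4 * ?g)" if \<delta>: "0 < \<delta>" for \<delta>
      proof -
        \<comment> \<open>Here the range hypothesis is used. Neither B nor y is controlled as
          \<delta> shrinks, but the besselian bound estimates the p-norm of y by the norm of the
          kernel sum, and that norm stays close to the norm of f.\<close>
        obtain B y where B: "finite B" "B \<subseteq> S"
          "bergman_norm k p (\<lambda>z. f z - (\<Sum>b\<in>B. y b * normalized_kernel k p b z)) < \<delta>"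
          using f(1) \<delta> unfolding kernel_span_def by blast
        let ?Y = "\<lambda>z. \<Sum>b\<in>B. y b * normalized_kernel k p b z"
        let ?d = "\<lambda>z. f z - ?Y z"
        have d: "?d \<in> bergman_space k p" by (rule bergman_space_diff[OF p(2) f(2) Ysp[OF B(2)]])
        have "(\<Sum>\<^sub>\<infinity>a\<in>S. x a * cnj (R f a)) = (\<Sum>\<^sub>\<infinity>a\<in>S. x a * cnj (R ?d a) + x a * cnj (R ?Y a))"
          by (simp add: R_def diff_divide_distrib algebra_simps)
        also have "\<dots> = (\<Sum>\<^sub>\<infinity>a\<in>S. x a * cnj (R ?d a)) + (\<Sum>b\<in>B. cnj (y b) * ?G x b)"
          unfolding GY[OF x B(1,2)] by (rule infsum_add[OF summ[OF x d] summ[OF x Ysp[OF B(2)]]])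
        finally have "T \<le> norm (\<Sum>\<^sub>\<infinity>a\<in>S. x a * cnj (R ?d a)) + norm (\<Sum>b\<in>B. cnj (y b) * ?G x b)"
          unfolding T_def sf by (simp only: norm_triangle_ineq)
        also have "norm (\<Sum>\<^sub>\<infinity>a\<in>S. x a * cnj (R ?d a)) \<le> C2 * lp_norm p' S x * \<delta>"
        proof -
          have "C2 * lp_norm p' S x * bergman_norm k p ?d \<le> C2 * lp_norm p' S x * \<delta>"
            using B(3) C2(1) by (intro mult_left_mono) (auto simp: lp_norm_nonneg)
          then show ?thesis using infb[OF x d] by linarith
        qed
        also have "norm (\<Sum>b\<in>B. cnj (y b) * ?G x b) \<le> ?g * (C3 * (4 * (D * L + \<delta>)))"
        proof -
          have "norm (\<Sum>b\<in>B. cnj (y b) * ?G x b) \<le> (\<Sum>b\<in>B. norm (?G x b) * norm (y b))"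
            by (rule sum_norm_le) (simp add: norm_mult)
          also have "\<dots> \<le> (\<Sum>b\<in>B. norm (?G x b) powr p') powr (1 / p') * (\<Sum>b\<in>B. norm (y b) powr p) powr (1 / p)"
            by (rule Holder_sum[OF p'(1) p(1) p'(3) B(1)]) auto
          also have "\<dots> \<le> ?g * (C3 * bergman_norm k p ?Y)"
            by (intro mult_mono lp_partial_sum_le[OF upper[OF x] B(1,2) p'(4)] C3(2)[OF B(1,2)] g0 powr_ge_zero)
          also have "bergman_norm k p ?Y \<le> 4 * (D * L + \<delta>)"
          proof -
            have "bergman_norm k p ?Y = bergman_norm k p (\<lambda>z. f z + (-1) * ?d z)" by simp
            also have "\<dots> \<le> 4 * (bergman_norm k p f + bergman_norm k p (\<lambda>z. (-1) * ?d z))"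
              using p by (intro bergman_norm_add_le f(2) bergman_space_cmult d) auto
            also have "bergman_norm k p (\<lambda>z. (-1) * ?d z) = bergman_norm k p ?d"
              by (simp only: bergman_norm_def norm_mult norm_minus_cancel norm_one mult_1_left)
            finally show ?thesis using f(3) B(3) by simp
          qed
          finally show ?thesis using g0 C3(1) by (simp add: mult_left_mono)
        qed
        finally show ?thesis by (simp add: K_def algebra_simps)
      qed
      \<comment> \<open>The factor multiplying \<delta> depends on x alone, and B and y have
        disappeared, so \<delta> may tend to 0.\<close>
      have "T \<le> K * ?g * L"
      proof (rule field_le_epsilon)
        fix e :: real assume e: "0 < e"
        let ?H = "C2 * lp_norm p' S x + C3 * 4 * ?g"
        have H: "0 \<le> ?H" using C2(1) C3(1) g0 by (simp add: lp_norm_nonneg)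
        have "e / (?H + 1) * ?H \<le> e" using e H by (simp add: pos_divide_le_eq)
        moreover have "T \<le> K * ?g * L + e / (?H + 1) * ?H" by (rule approx) (use e H in simp)
        ultimately show "T \<le> K * ?g * L + e" by linarith
      qed
      then show "norm (\<Sum>a\<in>F. x a * cnj (l a)) \<le> K * ?g * (\<Sum>a\<in>F. norm (l a) powr p) powr (1 / p)"
        by (simp only: T_def L_def)
    qed
  qed
  show ?thesis
    unfolding strictly_interpolating_def p'_def[symmetric]
  proof (intro conjI ballI exI[of _ "1 / K"])
    show "0 < 1 / K" using K by simp
    fix x assume x: "x \<in> lp_space p' S"
    show "?G x \<in> lp_space p' S" by (rule upper[OF x])
    show "1 / K * lp_norm p' S x \<le> lp_norm p' S (?G x)"
      using lower[OF x] K by (simp add: pos_divide_le_eq mult.commute)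
    fix b assume b: "b \<in> S"
    show "(\<lambda>a. x a * grammian k p a b) summable_on S"
      using summ[OF x nk[OF b]] by (rule summable_on_cong[THEN iffD1, rotated]) (simp add: gram b)
  qed
qed

end
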